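(* Let $m\geq 2$ be an integer. For every $a\in(0,\frac1m)$, both $(f_a,\mathrm{Leb})$ (where $\mathrm{Leb}$ is the Lebesgue measure on $[0,1]^2$) and $(g_a,\mathrm{Leb})$ (where $\mathrm{Leb}$ is the Lebesgue measure on $[0,1]^3$) are mixing of all orders.
   Context: Heterochaos baker maps. Let $m\ge2$ be an integer. For $a\in(0,\frac1m)$ define $\tau_a\colon[0,1]\to[0,1]$ by $\tau_a(x)=\frac{x-(i-1)a}{a}$ on $[(i-1)a,ia)$ for $i\in\{1,\dots,m\}$, and $\tau_a(x)=\frac{x-ma}{1-ma}$ on $[ma,1]$. Put $\Omega_{\alpha_i}^+=[(i-1)a,ia)\times[0,1]$ for $i\in\{1,\dots,m\}$; $\Omega_{\beta_i}^+=[ma,1]\times[\frac{i-1}{m},\frac im)$ for $i\in\{1,\dots,m-1\}$ and $\Omega_{\beta_m}^+=[ma,1]\times[\frac{m-1}{m},1]$. Define $f_a\colon[0,1]^2\to[0,1]^2$ by $f_a(x,y)=(\tau_a(x),\frac ym+\frac{i-1}{m})$ on $\Omega_{\alpha_i}^+$ and $f_a(x,y)=(\tau_a(x),my-i+1)$ on $\Omega_{\beta_i}^+$. Put $\Omega_{\alpha_i}=\Omega_{\alpha_i}^+\times[0,1]$, $\Omega_{\beta_i}=\Omega_{\beta_i}^+\times[0,1]$. For $a,b\in(0,\frac1m)$ define $f_{a,b}\colon[0,1]^3\to[0,1]^3$ by $f_{a,b}(x,y,z)=(f_a(x,y),(1-mb)z)$ on $\Omega_{\alpha_i}$ and $f_{a,b}(x,y,z)=(f_a(x,y),bz+1+b(i-m-1))$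 on $\Omega_{\beta_i}$. Put $g_a=f_{a,\frac1m-a}$. The maps $f_a$ and $g_a$ preserve the Lebesgue measure on $[0,1]^2$ and $[0,1]^3$ respectively. Mixing. Let $(X,\mathscr B,\nu)$ be a probability space and $T\colon X\to X$ a measurable map preserving $\nu$. For an integer $k\ge2$, $(T,\nu)$ is $k$-mixing if for all $A_0,\dots,A_{k-1}\in\mathscr B$, $\lim_{n_1,\dots,n_{k-1}\to\infty}\nu(A_0\cap T^{-n_1}(A_1)\cap\cdots\cap T^{-n_1-n_2-\cdots-n_{k-1}}(A_{k-1}))=\prod_{j=0}^{k-1}\nu(A_j)$. $(T,\nu)$ is mixing of all orders if it is $k$-mixing for every $k\ge2$. *)

theory Defs
  imports "HOL-Probability.Probability"
begin

definition tau :: "nat \<Rightarrow> real \<Rightarrow> real \<Rightarrow> real" where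
  "tau m a x =
    (if \<exists>i\<in>{1..m}. x \<in> {(real i - 1) * a ..< real i * a}
     then (x - (real (THE i. i \<in> {1..m} \<and> x \<in> {(real i - 1) * a ..< real i * a}) - 1) * a) / a
     else (x - real m * a) / (1 - real m * a))"

definition Omega_alpha2 :: "nat \<Rightarrow> real \<Rightarrow> nat \<Rightarrow> (real \<times> real) set" where
  "Omega_alpha2 m a i = {(real i - 1) * a ..< real i * a} \<times> {0..1}"

definition Omega_beta2 :: "nat \<Rightarrow> real \<Rightarrow> nat \<Rightarrow> (real \<times> real) set" where
  "Omega_beta2 m a i = {real m * a .. 1} \<times>
     (if i < m then {(real i - 1) / real m ..< real i / real m} else {(real m - 1) / real m .. 1})"

text \<open>
  The maps are total functions; the value outside the unit square (cube) is a dummy.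
  On the unit square the sets above form a partition, so the index picked by
  \<open>THE\<close> is determined, see the lemmas \<open>baker2_alpha\<close> to \<open>baker3_beta\<close> below.
\<close>

definition baker2 :: "nat \<Rightarrow> real \<Rightarrow> real \<times> real \<Rightarrow> real \<times> real" where
  "baker2 m a p =
    (if \<exists>i\<in>{1..m}. p \<in> Omega_alpha2 m a i
     then let i = (THE i. i \<in> {1..m} \<and> p \<in> Omega_alpha2 m a i)
          in (tau m a (fst p), snd p / real m + (real i - 1) / real m)
     else if \<exists>i\<in>{1..m}. p \<in> Omega_beta2 m a i
     then let i = (THE i. i \<in> {1..m} \<and> p \<in> Omega_beta2 m a i)
          in (tau m a (fst p), real m * snd p - real i + 1)
     else p)"

definition Omega_alpha3 :: "nat \<Rightarrow> real \<Rightarrow> nat \<Rightarrow> ((real \<times> real) \<times> real) set" where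
  "Omega_alpha3 m a i = Omega_alpha2 m a i \<times> {0..1}"

definition Omega_beta3 :: "nat \<Rightarrow> real \<Rightarrow> nat \<Rightarrow> ((real \<times> real) \<times> real) set" where
  "Omega_beta3 m a i = Omega_beta2 m a i \<times> {0..1}"

definition baker3 :: "nat \<Rightarrow> real \<Rightarrow> real \<Rightarrow> (real \<times> real) \<times> real \<Rightarrow> (real \<times> real) \<times> real" where
  "baker3 m a b p =
    (if \<exists>i\<in>{1..m}. p \<in> Omega_alpha3 m a i
     then (baker2 m a (fst p), (1 - real m * b) * snd p)
     else if \<exists>i\<in>{1..m}. p \<in> Omega_beta3 m a i
     then let i = (THE i. i \<in> {1..m} \<and> p \<in> Omega_beta3 m a i)
          in (baker2 m a (fst p), b * snd p + 1 + b * (real i - real m - 1))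
     else p)"

definition baker3_vol :: "nat \<Rightarrow> real \<Rightarrow> (real \<times> real) \<times> real \<Rightarrow> (real \<times> real) \<times> real" where
  "baker3_vol m a = baker3 m a (1 / real m - a)"

definition unit_square :: "(real \<times> real) set" where
  "unit_square = {0..1} \<times> {0..1}"

definition unit_cube :: "((real \<times> real) \<times> real) set" where
  "unit_cube = ({0..1} \<times> {0..1}) \<times> {0..1}"

definition preserves_measure :: "'a measure \<Rightarrow> ('a \<Rightarrow> 'a) \<Rightarrow> bool" where
  "preserves_measure M T \<longleftrightarrow> T \<in> measurable M M \<and> distr M M T = M"

text \<open>
  The filter below on \<open>n :: nat \<Rightarrow> nat\<close> expresses that \<open>n 1, \<dots>, n (k - 1)\<close> tend to
  infinity jointly and independently of each other; see \<open>tendsto_joint_iff\<close>.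
\<close>

definition k_mixing :: "'a measure \<Rightarrow> ('a \<Rightarrow> 'a) \<Rightarrow> nat \<Rightarrow> bool" where
  "k_mixing M T k \<longleftrightarrow> prob_space M \<and> preserves_measure M T \<and>
    (\<forall>A. (\<forall>j<k. A j \<in> sets M) \<longrightarrow>
      ((\<lambda>n. measure M (\<Inter>j<k. (T ^^ (\<Sum>i=1..j. n i)) -` A j \<inter> space M))
         \<longlongrightarrow> (\<Prod>j<k. measure M (A j)))
       (INF i\<in>{1..<k}. filtercomap (\<lambda>n::nat \<Rightarrow> nat. n i) at_top))"

definition mixing_all_orders :: "'a measure \<Rightarrow> ('a \<Rightarrow> 'a) \<Rightarrow> bool" where
  "mixing_all_orders M T \<longleftrightarrow> (\<forall>k\<ge>2. k_mixing M T k)"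

lemma eventually_joint_iff:
  "eventually P (INF i\<in>{1..<k}. filtercomap (\<lambda>n::nat \<Rightarrow> nat. n i) at_top) \<longleftrightarrow>
     (\<exists>N. \<forall>n. (\<forall>i\<in>{1..<k}. N \<le> n i) \<longrightarrow> P n)"
proof
  assume "eventually P (INF i\<in>{1..<k}. filtercomap (\<lambda>n::nat \<Rightarrow> nat. n i) at_top)"
  then obtain Q where Q: "\<And>i. i \<in> {1..<k} \<Longrightarrow> eventually (Q i) (filtercomap (\<lambda>n::nat \<Rightarrow> nat. n i) at_top)"
    and QP: "\<And>n. (\<forall>i\<in>{1..<k}. Q i n) \<Longrightarrow> P n"
    unfolding eventually_INF_finite[OF finite_atLeastLessThan] by blast
  have "\<forall>i\<in>{1..<k}. \<exists>N. \<forall>n. N \<le> n i \<longrightarrow> Q i n"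
    using Q by (fastforce simp: eventually_filtercomap eventually_at_top_linorder)
  then obtain N where N: "\<And>i n. i \<in> {1..<k} \<Longrightarrow> N i \<le> n i \<Longrightarrow> Q i n"
    by metis
  have "P n" if "\<forall>i\<in>{1..<k}. (\<Sum>i\<in>{1..<k}. N i) \<le> n i" for n
  proof (rule QP, rule ballI)
    fix i assume i: "i \<in> {1..<k}"
    have "N i \<le> (\<Sum>i\<in>{1..<k}. N i)" using i by (intro member_le_sum) auto
    then show "Q i n" using N[OF i] that i le_trans by blast
  qed
  then show "\<exists>N. \<forall>n. (\<forall>i\<in>{1..<k}. N \<le> n i) \<longrightarrow> P n" by blast
next
  assume "\<exists>N. \<forall>n. (\<forall>i\<in>{1..<k}. N \<le> n i) \<longrightarrow> P n"
  then obtain N where N: "\<And>n. (\<forall>i\<in>{1..<k}. N \<le> n i) \<Longrightarrow> P n" by blast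
  show "eventually P (INF i\<in>{1..<k}. filtercomap (\<lambda>n::nat \<Rightarrow> nat. n i) at_top)"
  proof (subst eventually_INF_finite)
    show "\<exists>Q. (\<forall>i\<in>{1..<k}. eventually (Q i) (filtercomap (\<lambda>n::nat \<Rightarrow> nat. n i) at_top)) \<and>
           (\<forall>n. (\<forall>i\<in>{1..<k}. Q i n) \<longrightarrow> P n)"
      by (rule exI[of _ "\<lambda>i n. N \<le> n i"])
         (use N in \<open>auto intro!: eventually_filtercomapI eventually_ge_at_top\<close>)
  qed simp
qed

lemma tendsto_joint_iff:
  fixes F :: "(nat \<Rightarrow> nat) \<Rightarrow> real"
  shows "(F \<longlongrightarrow> L) (INF i\<in>{1..<k}. filtercomap (\<lambda>n::nat \<Rightarrow> nat. n i) at_top) \<longleftrightarrow>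
     (\<forall>e>0. \<exists>N. \<forall>n. (\<forall>i\<in>{1..<k}. N \<le> n i) \<longrightarrow> \<bar>F n - L\<bar> < e)"
  by (simp only: tendsto_iff eventually_joint_iff dist_real_def)

lemma alpha_index_unique:
  assumes "0 < a" "x \<in> {(real i - 1) * a ..< real i * a}" "x \<in> {(real j - 1) * a ..< real j * a}"
  shows "i = j"
proof -
  have "(real i - 1) * a < real j * a" "(real j - 1) * a < real i * a"
    using assms unfolding atLeastLessThan_iff by linarith+
  then have "real i - 1 < real j" "real j - 1 < real i"
    using assms(1) mult_less_cancel_right_pos by blast+
  then show ?thesis by linarith
qed

lemma alpha_less:
  assumes "0 < a" "i \<le> m" "x < real i * a" shows "x < real m * a"
  using assms by (meson less_le_trans mult_right_mono of_nat_mono less_imp_le)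

lemma Omega_beta2_index_unique:
  assumes "0 < m" "i \<in> {1..m}" "j \<in> {1..m}" "p \<in> Omega_beta2 m a i" "p \<in> Omega_beta2 m a j"
  shows "i = j"
proof -
  have key: "real i \<le> real m * snd p + 1 \<and> (i < m \<longrightarrow> real m * snd p < real i)"
    if "i \<in> {1..m}" "p \<in> Omega_beta2 m a i" for i
    using that \<open>0 < m\<close> by (auto simp: Omega_beta2_def field_simps split: if_splits)
  show ?thesis
    using key[OF assms(2,4)] key[OF assms(3,5)] assms(2,3) by (cases "i < m"; cases "j < m") auto
qed

lemma tau_alpha:
  assumes "0 < a" "i \<in> {1..m}" "x \<in> {(real i - 1) * a ..< real i * a}"
  shows "tau m a x = (x - (real i - 1) * a) / a"
proof -
  have "(THE i. i \<in> {1..m} \<and> x \<in> {(real i - 1) * a ..< real i * a}) = i"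
    using assms alpha_index_unique[OF assms(1)] by (intro the_equality) blast+
  then show ?thesis using assms unfolding tau_def by auto
qed

lemma tau_beta:
  assumes "0 < a" "real m * a \<le> x"
  shows "tau m a x = (x - real m * a) / (1 - real m * a)"
proof -
  have "\<not> (\<exists>i\<in>{1..m}. x \<in> {(real i - 1) * a ..< real i * a})"
    using alpha_less[OF assms(1)] assms(2) by fastforce
  then show ?thesis unfolding tau_def by (simp only: if_False)
qed

lemma Omega_alpha_beta2_disjoint:
  assumes "0 < a" "i \<in> {1..m}" "p \<in> Omega_alpha2 m a i"
  shows "p \<notin> Omega_beta2 m a j"
  using alpha_less[OF assms(1), of i m "fst p"] assms(2,3)
  by (auto simp: Omega_alpha2_def Omega_beta2_def)

lemma baker2_alpha:
  assumes "0 < a" "i \<in> {1..m}" "(x, y) \<in> Omega_alpha2 m a i"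
  shows "baker2 m a (x, y) = (tau m a x, y / real m + (real i - 1) / real m)"
proof -
  have "(THE i. i \<in> {1..m} \<and> (x, y) \<in> Omega_alpha2 m a i) = i"
    using assms alpha_index_unique[OF assms(1)]
    by (intro the_equality) (unfold Omega_alpha2_def, blast+)
  then show ?thesis using assms unfolding baker2_def by auto
qed

lemma baker2_beta:
  assumes "0 < a" "0 < m" "i \<in> {1..m}" "(x, y) \<in> Omega_beta2 m a i"
  shows "baker2 m a (x, y) = (tau m a x, real m * y - real i + 1)"
proof -
  have "(THE i. i \<in> {1..m} \<and> (x, y) \<in> Omega_beta2 m a i) = i"
    using assms Omega_beta2_index_unique[OF assms(2)] by (intro the_equality) blast+
  moreover have "\<not> (\<exists>i\<in>{1..m}. (x, y) \<in> Omega_alpha2 m a i)"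
    using Omega_alpha_beta2_disjoint[OF assms(1)] assms(4) by blast
  ultimately show ?thesis using assms unfolding baker2_def by auto
qed

lemma baker3_alpha:
  assumes "i \<in> {1..m}" "((x, y), z) \<in> Omega_alpha3 m a i"
  shows "baker3 m a b ((x, y), z) = (baker2 m a (x, y), (1 - real m * b) * z)"
  using assms unfolding baker3_def by auto

lemma baker3_beta:
  assumes "0 < a" "0 < m" "i \<in> {1..m}" "((x, y), z) \<in> Omega_beta3 m a i"
  shows "baker3 m a b ((x, y), z) = (baker2 m a (x, y), b * z + 1 + b * (real i - real m - 1))"
proof -
  have "(THE i. i \<in> {1..m} \<and> ((x, y), z) \<in> Omega_beta3 m a i) = i"
    using assms Omega_beta2_index_unique[OF assms(2)]
    by (intro the_equality) (unfold Omega_beta3_def, blast+)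
  moreover have "\<not> (\<exists>i\<in>{1..m}. ((x, y), z) \<in> Omega_alpha3 m a i)"
    using Omega_alpha_beta2_disjoint[OF assms(1)] assms(4)
    unfolding Omega_alpha3_def Omega_beta3_def by blast
  ultimately show ?thesis using assms unfolding baker3_def by auto
qed

lemma unit_square_partition:
  assumes "0 < a" "a < 1 / real m" "0 < m"
  shows "unit_square = (\<Union>i\<in>{1..m}. Omega_alpha2 m a i \<union> Omega_beta2 m a i)"
proof (intro subset_antisym subsetI)
  fix p assume p: "p \<in> unit_square"
  obtain x y where xy: "p = (x, y)" "0 \<le> x" "x \<le> 1" "0 \<le> y" "y \<le> 1"
    using p by (auto simp: unit_square_def)
  show "p \<in> (\<Union>i\<in>{1..m}. Omega_alpha2 m a i \<union> Omega_beta2 m a i)"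
  proof (cases "x < real m * a")
    case True
    define i where "i = nat \<lfloor>x / a\<rfloor> + 1"
    have "real (i - 1) \<le> x / a" "x / a < real i"
      using xy assms by (auto simp: i_def) linarith+
    moreover have "x / a < real m" using True assms by (simp add: field_simps)
    moreover have "1 \<le> i" by (simp add: i_def)
    ultimately have "real i - 1 < real m" "1 \<le> i" by (linarith, simp)
    then have "i \<in> {1..m}" by auto
    with \<open>real (i - 1) \<le> x / a\<close> \<open>x / a < real i\<close> have "i \<in> {1..m}" "(real i - 1) * a \<le> x" "x < real i * a"
      using assms by (auto simp: i_def field_simps)
    then show ?thesis using xy by (auto simp: Omega_alpha2_def)
  next
    case False
    define i where "i = nat \<lfloor>real m * y\<rfloor> + 1"
    show ?thesis
    proof (cases "i < m")
      case True
      have "real (i - 1) \<le> real m * y" "real m * y < real i"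
        using xy by (auto simp: i_def) linarith+
      then have "i \<in> {1..m}" "p \<in> Omega_beta2 m a i"
        using xy assms False True by (auto simp: i_def Omega_beta2_def field_simps)
      then show ?thesis by blast
    next
      case 2: False
      have "real (i - 1) \<le> real m * y" using xy by (auto simp: i_def)
      moreover have "real m - 1 \<le> real (i - 1)" using 2 by linarith
      ultimately have "(real m - 1) / real m \<le> y" using assms by (simp add: field_simps)
      then have "p \<in> Omega_beta2 m a m" using xy False by (auto simp: Omega_beta2_def)
      then show ?thesis using assms by force
    qed
  qed
next
  fix p assume "p \<in> (\<Union>i\<in>{1..m}. Omega_alpha2 m a i \<union> Omega_beta2 m a i)"
  then obtain i where i: "i \<in> {1..m}" "p \<in> Omega_alpha2 m a i \<or> p \<in> Omega_beta2 m a i" by blast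
  have ma: "real m * a < 1" using assms by (simp add: field_simps)
  show "p \<in> unit_square"
  proof (cases "p \<in> Omega_alpha2 m a i")
    case True
    have "0 \<le> (real i - 1) * a" using i assms by simp
    then show ?thesis
      using True alpha_less[OF assms(1), of i m "fst p"] i ma
      by (auto simp: Omega_alpha2_def unit_square_def)
  next
    case False
    have le: "real i / real m \<le> 1" "0 \<le> (real i - 1) / real m" "0 \<le> (real m - 1) / real m" "0 \<le> real m * a"
      using i assms by auto
    have "p \<in> Omega_beta2 m a i" using False i by blast
    moreover have "y \<le> 1" if "y < real i / real m" for y
      using le(1) that by linarith
    moreover have "0 \<le> x" if "real m * a \<le> x" for x
      using le(4) that by linarith
    moreover have "0 \<le> y" if "(real i - 1) / real m \<le> y" for y
      using le(2) that by linarith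
    moreover have "0 \<le> y" if "(real m - 1) / real m \<le> y" for y
      using le(3) that by linarith
    ultimately show ?thesis
      by (auto simp: Omega_beta2_def unit_square_def simp del: zero_le_divide_iff split: if_splits)
  qed
qed

end

theory Submission
  imports Defs
begin

text \<open>
  Write \<open>p = m a\<close>. The second coordinate of the planar map is a stack of base-\<open>m\<close> digits: with
  probability \<open>p\<close> a uniform digit is pushed, with probability \<open>1 - p\<close> the top digit is popped. On
  functions of \<open>y\<close> alone the transfer operator is therefore \<open>p U + (1 - p) U*\<close>, where \<open>U\<close> is
  composition with \<open>y \<mapsto> m y mod 1\<close> and \<open>U*\<close> its adjoint. If \<open>U* \<psi> = 0\<close>, the functions \<open>U\<^sup>k \<psi>\<close> are
  orthogonal and the transfer operator acts on them as a random walk killed at \<open>0\<close>, whose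
  distributions tend to \<open>0\<close> in \<open>l\<^sup>2\<close>, for every \<open>p\<close>. So the iterates of a density depending on \<open>y\<close> only
  converge in \<open>L\<^sup>1\<close> to its mean; expansion in \<open>x\<close> extends this to all densities, that is, the planar map
  is exact. Exactness gives mixing uniformly in the target set, and mixing of all orders follows by
  induction on the number of sets. The spatial map contracts the third coordinate, so after finitely many
  iterations every set is close to one that depends on the first two coordinates only.
\<close>

section \<open>Mixing from a core family of sets\<close>

text \<open>Ordinary mixing is too weak for the induction on the number of sets: after splitting off
  \<open>A 0\<close>, the remaining intersection is one target set that itself moves with the later
  times, so the rate must not depend on it. This is why an L1 statement about densities is aimed at.
  The spatial map is essentially invertible, so it cannot mix uniformly over all Borel targets;
  hence the uniformity is demanded only on a family \<open>F\<close> that is stable under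
  intersections and preimages. For p \<le> 1/2 the mass of the walk is absorbed, for p > 1/2 part of
  it drifts to infinity; a decreasing energy treats all cases at once. In place of the abstract
  decomposition, the indicators of [0, c) are expanded explicitly, each further level costing a
  factor 1/m.\<close>

lemma (in prob_space) prob_Inter_diff_le:
  assumes "finite I" "\<And>j. j \<in> I \<Longrightarrow> X j \<in> events" "\<And>j. j \<in> I \<Longrightarrow> Y j \<in> events"
  shows "\<bar>prob (space M \<inter> (\<Inter>j\<in>I. X j)) - prob (space M \<inter> (\<Inter>j\<in>I. Y j))\<bar>
          \<le> (\<Sum>j\<in>I. prob (sym_diff (X j) (Y j)))"
proof -
  have ev: "space M \<inter> (\<Inter>j\<in>I. Z j) \<in> events" if "\<And>j. j \<in> I \<Longrightarrow> Z j \<in> events" for Z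
    using that assms(1) by (cases "I = {}") auto
  have U: "(\<Union>j\<in>I. sym_diff (X j) (Y j)) \<in> events"
    using assms by auto
  have le: "prob (space M \<inter> (\<Inter>j\<in>I. Z j))
      \<le> prob (space M \<inter> (\<Inter>j\<in>I. W j)) + prob (\<Union>j\<in>I. sym_diff (X j) (Y j))"
    if "\<And>j. j \<in> I \<Longrightarrow> Z j \<in> events" "\<And>j. j \<in> I \<Longrightarrow> W j \<in> events"
       "\<And>j. j \<in> I \<Longrightarrow> Z j - W j \<subseteq> sym_diff (X j) (Y j)" for Z W
  proof -
    have "prob (space M \<inter> (\<Inter>j\<in>I. Z j))
        \<le> prob ((space M \<inter> (\<Inter>j\<in>I. W j)) \<union> (\<Union>j\<in>I. sym_diff (X j) (Y j)))"
      using that(3) by (intro finite_measure_mono sets.Un ev that U) blast+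
    also have "\<dots> \<le> prob (space M \<inter> (\<Inter>j\<in>I. W j)) + prob (\<Union>j\<in>I. sym_diff (X j) (Y j))"
      by (intro measure_Un_le ev that U)
    finally show ?thesis .
  qed
  have "prob (\<Union>j\<in>I. sym_diff (X j) (Y j)) \<le> (\<Sum>j\<in>I. prob (sym_diff (X j) (Y j)))"
    using assms by (intro finite_measure_subadditive_finite) auto
  then show ?thesis
    using le[of X Y] le[of Y X] assms(2,3) by (simp add: abs_le_iff)
qed

lemma preserves_measure_funpow:
  assumes "preserves_measure M T"
  shows "T ^^ n \<in> measurable M M" "distr M M (T ^^ n) = M"
proof -
  have T: "T \<in> measurable M M" "distr M M T = M"
    using assms by (auto simp: preserves_measure_def)
  show *: "T ^^ n \<in> measurable M M" for n
    using T(1) by (induction n) (auto simp: comp_def)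
  show "distr M M (T ^^ n) = M"
  proof (induction n)
    case (Suc n)
    have "distr M M (T ^^ Suc n) = distr (distr M M (T ^^ n)) M T"
      unfolding funpow.simps(2) using T(1) * by (intro distr_distr[symmetric]) auto
    then show ?case unfolding Suc T .
  qed (simp add: distr_id)
qed

lemma measure_vimage_funpow:
  assumes "preserves_measure M T" "space M = UNIV" "A \<in> sets M"
  shows "(T ^^ n) -` A \<in> sets M" "measure M ((T ^^ n) -` A) = measure M A"
    "emeasure M ((T ^^ n) -` A) = emeasure M A"
proof -
  note P = preserves_measure_funpow[OF assms(1), of n]
  show "(T ^^ n) -` A \<in> sets M"
    using measurable_sets[OF P(1) assms(3)] assms(2) by simp
  show "measure M ((T ^^ n) -` A) = measure M A"
    using measure_distr[OF P(1) assms(3)] P(2) assms(2) by simp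
  show "emeasure M ((T ^^ n) -` A) = emeasure M A"
    using emeasure_distr[OF P(1) assms(3)] P(2) assms(2) by simp
qed

lemma abs_prod_diff_le:
  fixes f g :: "'a \<Rightarrow> real"
  assumes "finite I" "\<And>i. i \<in> I \<Longrightarrow> \<bar>f i\<bar> \<le> 1" "\<And>i. i \<in> I \<Longrightarrow> \<bar>g i\<bar> \<le> 1"
  shows "\<bar>(\<Prod>i\<in>I. f i) - (\<Prod>i\<in>I. g i)\<bar> \<le> (\<Sum>i\<in>I. \<bar>f i - g i\<bar>)"
  using norm_prod_diff[of I f g] assms by simp

lemma (in prob_space) abs_prob_diff_le:
  assumes "A \<in> events" "B \<in> events"
  shows "\<bar>prob A - prob B\<bar> \<le> prob (sym_diff A B)"
  using prob_Inter_diff_le[of "{()}" "\<lambda>_. A" "\<lambda>_. B"] assms sets.sets_into_space by (simp add: Int_absorb1)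

text \<open>On \<open>F\<close> an induction peels off one set at a time, using that
  \<open>N\<close> in \<open>mix\<close> serves all \<open>B\<close> simultaneously. General sets
  reduce to \<open>F\<close> because replacing every set by its preimage under the same iterate
  changes neither the correlations nor the product; this is why \<open>approx\<close> may use an
  iterate of \<open>A\<close> instead of \<open>A\<close> itself.\<close>

lemma mixing_all_orders_core:
  fixes M :: "'a measure"
  assumes M: "prob_space M" "space M = UNIV" "preserves_measure M T"
    and F: "F \<subseteq> sets M" "\<And>A B. A \<in> F \<Longrightarrow> B \<in> F \<Longrightarrow> A \<inter> B \<in> F" "\<And>A. A \<in> F \<Longrightarrow> T -` A \<in> F"
    and mix: "\<And>A e. A \<in> F \<Longrightarrow> 0 < e \<Longrightarrow>
      \<exists>N. \<forall>n\<ge>N. \<forall>B\<in>F. \<bar>measure M (A \<inter> (T ^^ n) -` B) - measure M A * measure M B\<bar> < e"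
    and approx: "\<And>A e. A \<in> sets M \<Longrightarrow> 0 < e \<Longrightarrow> \<exists>n. \<exists>B\<in>F. measure M (sym_diff ((T ^^ n) -` A) B) < e"
  shows "mixing_all_orders M T"
proof -
  interpret prob_space M by fact
  have Fn: "(T ^^ n) -` A \<in> F" if "A \<in> F" for A n
    using that by (induction n arbitrary: A) (auto simp: F(3) vimage_comp[symmetric] funpow_Suc_right simp del: funpow.simps(2))
  define N where "N n j = (\<Sum>i=1..j. n i)" for n :: "nat \<Rightarrow> nat" and j
  define C where "C k n A = (\<Inter>j<k. (T ^^ N n j) -` A j)" for k n and A :: "nat \<Rightarrow> 'a set"
  \<comment> \<open>Every observation time after the first contains the summand \<open>n 1\<close>,
    so the corresponding iterate factors out of the rest of the intersection.\<close>
  have CSuc: "C (Suc (Suc k)) n A = A 0 \<inter> (T ^^ n 1) -` C (Suc k) (\<lambda>i. n (Suc i)) (\<lambda>j. A (Suc j))" for k n A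
  proof -
    have NS: "N n (Suc j) = N (\<lambda>i. n (Suc i)) j + n 1" for j
      using sum.atLeast_Suc_atMost[of 1 "Suc j" n] sum.shift_bounds_cl_Suc_ivl[of n 1 j]
      by (simp add: N_def del: sum.cl_ivl_Suc)
    have "C (Suc (Suc k)) n A = (T ^^ N n 0) -` A 0 \<inter> (\<Inter>j<Suc k. (T ^^ N n (Suc j)) -` A (Suc j))"
      unfolding C_def by (subst lessThan_Suc_eq_insert_0) auto
    also have "(\<Inter>j<Suc k. (T ^^ N n (Suc j)) -` A (Suc j)) = (T ^^ n 1) -` C (Suc k) (\<lambda>i. n (Suc i)) (\<lambda>j. A (Suc j))"
      unfolding C_def NS by (auto simp: funpow_add)
    finally show ?thesis by (simp add: N_def)
  qed
  have CF: "C (Suc k) n A \<in> F" if "\<And>j. j \<le> k \<Longrightarrow> A j \<in> F" for k n A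
    using that
  proof (induction k arbitrary: n A)
    case 0
    then show ?case by (simp add: C_def N_def lessThan_Suc)
  next
    case (Suc k)
    have "C (Suc k) (\<lambda>i. n (Suc i)) (\<lambda>j. A (Suc j)) \<in> F"
      by (rule Suc.IH) (use Suc.prems in auto)
    with Suc.prems[of 0] show ?case unfolding CSuc by (intro F(2) Fn) auto
  qed
  \<comment> \<open>The two errors of size \<open>e / 2\<close> are the correlation of
    \<open>A 0\<close> with the rest, and the induction hypothesis for the rest multiplied by
    \<open>prob (A 0)\<close>, which is at most 1.\<close>
  have core: "\<exists>L. \<forall>n. (\<forall>i\<in>{1..<Suc k}. L \<le> n i) \<longrightarrow> \<bar>prob (C (Suc k) n A) - (\<Prod>j<Suc k. prob (A j))\<bar> < e"
    if "\<And>j. j \<le> k \<Longrightarrow> A j \<in> F" "0 < e" for k A e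
    using that
  proof (induction k arbitrary: A e)
    case 0
    then show ?case by (simp add: C_def N_def lessThan_Suc)
  next
    case (Suc k)
    obtain L1 where L1: "\<And>n B. L1 \<le> n \<Longrightarrow> B \<in> F \<Longrightarrow> \<bar>prob (A 0 \<inter> (T ^^ n) -` B) - prob (A 0) * prob B\<bar> < e / 2"
      using mix[of "A 0" "e / 2"] Suc.prems by force
    obtain L2 where L2: "\<And>n. (\<forall>i\<in>{1..<Suc k}. L2 \<le> n i) \<Longrightarrow>
        \<bar>prob (C (Suc k) n (\<lambda>j. A (Suc j))) - (\<Prod>j<Suc k. prob (A (Suc j)))\<bar> < e / 2"
      using Suc.IH[of "\<lambda>j. A (Suc j)" "e / 2"] Suc.prems by force
    show ?case
    proof (intro exI allI impI)
      fix n assume n: "\<forall>i\<in>{1..<Suc (Suc k)}. max L1 L2 \<le> n i"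
      define B where "B = C (Suc k) (\<lambda>i. n (Suc i)) (\<lambda>j. A (Suc j))"
      have B: "B \<in> F" unfolding B_def by (rule CF) (use Suc.prems in auto)
      have a: "\<bar>prob (A 0 \<inter> (T ^^ n 1) -` B) - prob (A 0) * prob B\<bar> < e / 2"
        by (rule L1) (use n B in auto)
      define P where "P = (\<Prod>j<Suc k. prob (A (Suc j)))"
      have b: "\<bar>prob B - P\<bar> < e / 2"
        unfolding B_def P_def by (rule L2) (use n in auto)
      have "\<bar>prob (A 0) * prob B - prob (A 0) * P\<bar> \<le> 1 * \<bar>prob B - P\<bar>"
        unfolding right_diff_distrib[symmetric] abs_mult by (intro mult_right_mono) auto
      then have c: "\<bar>prob (A 0) * prob B - prob (A 0) * P\<bar> < e / 2"
        using b by (metis mult_1 order.strict_trans1)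
      have tri: "\<bar>x - v\<bar> < e" if "\<bar>x - u\<bar> < e / 2" "\<bar>u - v\<bar> < e / 2" for x u v :: real
        using that by linarith
      have d: "(\<Prod>j<Suc (Suc k). prob (A j)) = prob (A 0) * P"
        unfolding P_def by (rule prod.lessThan_Suc_shift)
      show "\<bar>prob (C (Suc (Suc k)) n A) - (\<Prod>j<Suc (Suc k). prob (A j))\<bar> < e"
        unfolding CSuc B_def[symmetric] d using a c by (rule tri)
    qed
  qed
  have gen: "\<exists>L. \<forall>n. (\<forall>i\<in>{1..<Suc k}. L \<le> n i) \<longrightarrow> \<bar>prob (C (Suc k) n A) - (\<Prod>j<Suc k. prob (A j))\<bar> < e"
    if A: "\<And>j. j \<le> k \<Longrightarrow> A j \<in> sets M" and e: "0 < e" for k A e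
  proof -
    \<comment> \<open>Passing to the approximating sets costs \<open>Suc k\<close> times
      \<open>d\<close>, that is \<open>e / 4\<close>, once in the intersection and once in the
      product; \<open>e / 2\<close> remains for \<open>core\<close>.\<close>
    define d where "d = e / (4 * real (Suc k))"
    have d: "0 < d" "real (Suc k) * d = e / 4" using e by (auto simp: d_def field_simps)
    have "\<exists>n. \<exists>B\<in>F. prob (sym_diff ((T ^^ n) -` A j) B) < d" if "j < Suc k" for j
      using approx[of "A j" d] A[of j] d that by simp
    then obtain nn where "\<And>j. j < Suc k \<Longrightarrow> \<exists>B\<in>F. prob (sym_diff ((T ^^ nn j) -` A j) B) < d"
      by metis
    then obtain BB where nB: "\<And>j. j < Suc k \<Longrightarrow> BB j \<in> F"
      "\<And>j. j < Suc k \<Longrightarrow> prob (sym_diff ((T ^^ nn j) -` A j) (BB j)) < d"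
      by metis
    \<comment> \<open>A common number of iterates for all sets. Exceeding \<open>nn j\<close> is
      harmless: the approximating set is pulled back by the missing iterates and stays in
      \<open>F\<close>.\<close>
    define n0 where "n0 = (\<Sum>j<Suc k. nn j)"
    have n0: "nn j \<le> n0" if "j < Suc k" for j
      unfolding n0_def using that by (intro member_le_sum) auto
    define B where "B j = (T ^^ (n0 - nn j)) -` BB j" for j
    have BF: "B j \<in> F" if "j < Suc k" for j unfolding B_def using nB that Fn by blast
    have As: "(T ^^ n) -` A j \<in> sets M" if "j < Suc k" for j n
      using measure_vimage_funpow[OF M(3,2)] A that by auto
    have Bd: "prob (sym_diff ((T ^^ n0) -` A j) (B j)) < d" if j: "j < Suc k" for j
    proof -
      have "T ^^ n0 = (T ^^ nn j) \<circ> (T ^^ (n0 - nn j))"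
        using funpow_add[of "nn j" "n0 - nn j" T] n0[OF j] by simp
      then have "sym_diff ((T ^^ n0) -` A j) (B j)
          = (T ^^ (n0 - nn j)) -` (sym_diff ((T ^^ nn j) -` A j) (BB j))"
        unfolding B_def by (simp add: vimage_comp[symmetric] vimage_Diff vimage_Un)
      moreover have "prob (\<dots>) = prob (sym_diff ((T ^^ nn j) -` A j) (BB j))"
        using As[OF j] F(1) nB(1)[OF j]
        by (intro measure_vimage_funpow(2)[OF M(3,2)]) auto
      ultimately show ?thesis using nB(2)[OF j] by simp
    qed
    have Bs: "B j \<in> sets M" if "j < Suc k" for j using BF F that by auto
    obtain L where L: "\<And>n. (\<forall>i\<in>{1..<Suc k}. L \<le> n i) \<Longrightarrow> \<bar>prob (C (Suc k) n B) - (\<Prod>j<Suc k. prob (B j))\<bar> < e / 2"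
      using core[of k B "e / 2"] BF e by (metis half_gt_zero less_Suc_eq_le)
    show ?thesis
    proof (intro exI allI impI)
      fix n assume n: "\<forall>i\<in>{1..<Suc k}. L \<le> n i"
      have Cs: "C (Suc k) n A \<in> sets M"
        unfolding C_def using As by (intro sets.finite_INT) auto
      have "prob (C (Suc k) n A) = prob ((T ^^ n0) -` C (Suc k) n A)"
        using measure_vimage_funpow(2)[OF M(3,2) Cs] by simp
      also have "(T ^^ n0) -` C (Suc k) n A = (\<Inter>j<Suc k. (T ^^ N n j) -` (T ^^ n0) -` A j)"
        unfolding C_def vimage_INT vimage_comp funpow_add[symmetric] by (simp add: add.commute)
      finally have "\<bar>prob (C (Suc k) n A) - prob (C (Suc k) n B)\<bar>
         \<le> (\<Sum>j<Suc k. prob (sym_diff ((T ^^ N n j) -` (T ^^ n0) -` A j) ((T ^^ N n j) -` B j)))"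
        using prob_Inter_diff_le[of "{..<Suc k}" "\<lambda>j. (T ^^ N n j) -` (T ^^ n0) -` A j" "\<lambda>j. (T ^^ N n j) -` B j"]
          As Bs measure_vimage_funpow(1)[OF M(3,2)]
        unfolding C_def by (simp add: M(2))
      also have "\<dots> \<le> (\<Sum>j<Suc k. d)"
      proof (rule sum_mono)
        fix j assume j: "j \<in> {..<Suc k}"
        have "sym_diff ((T ^^ N n j) -` (T ^^ n0) -` A j) ((T ^^ N n j) -` B j)
           = (T ^^ N n j) -` sym_diff ((T ^^ n0) -` A j) (B j)" by auto
        then have "prob (sym_diff ((T ^^ N n j) -` (T ^^ n0) -` A j) ((T ^^ N n j) -` B j))
           = prob (sym_diff ((T ^^ n0) -` A j) (B j))"
          using measure_vimage_funpow(2)[OF M(3,2)] As Bs j by (metis lessThan_iff sets.Diff sets.Un)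
        then show "prob (sym_diff ((T ^^ N n j) -` (T ^^ n0) -` A j) ((T ^^ N n j) -` B j)) \<le> d"
          using Bd[of j] j by simp
      qed
      finally have 1: "\<bar>prob (C (Suc k) n A) - prob (C (Suc k) n B)\<bar> \<le> e / 4"
        using d(2) by simp
      have "\<bar>(\<Prod>j<Suc k. prob (A j)) - (\<Prod>j<Suc k. prob (B j))\<bar> \<le> (\<Sum>j<Suc k. \<bar>prob (A j) - prob (B j)\<bar>)"
        by (rule abs_prod_diff_le) auto
      also have "\<dots> \<le> (\<Sum>j<Suc k. d)"
      proof (rule sum_mono)
        fix j assume j: "j \<in> {..<Suc k}"
        then have "prob (A j) = prob ((T ^^ n0) -` A j)"
          using measure_vimage_funpow(2)[OF M(3,2)] A by auto
        then show "\<bar>prob (A j) - prob (B j)\<bar> \<le> d"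
          using abs_prob_diff_le[of "(T ^^ n0) -` A j" "B j"] As Bs Bd[of j] j by fastforce
      qed
      finally have 2: "\<bar>(\<Prod>j<Suc k. prob (A j)) - (\<Prod>j<Suc k. prob (B j))\<bar> \<le> e / 4"
        using d(2) by simp
      show "\<bar>prob (C (Suc k) n A) - (\<Prod>j<Suc k. prob (A j))\<bar> < e"
        using 1 2 L[of n] n by linarith
    qed
  qed
  show ?thesis
    unfolding mixing_all_orders_def k_mixing_def
  proof (intro allI impI conjI M)
    fix k :: nat and A :: "nat \<Rightarrow> 'a set" assume k: "2 \<le> k" and A: "\<forall>j<k. A j \<in> events"
    obtain k' where k': "k = Suc k'" using k by (cases k) auto
    show "((\<lambda>n. prob (\<Inter>j<k. (T ^^ (\<Sum>i = 1..j. n i)) -` A j \<inter> space M)) \<longlongrightarrow> (\<Prod>j<k. prob (A j)))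
          (INF i\<in>{1..<k}. filtercomap (\<lambda>n. n i) at_top)"
      unfolding tendsto_joint_iff using gen[of k' A] A unfolding k' C_def N_def M(2) by (simp add: less_Suc_eq_le)
  qed
qed

section \<open>From a Borel model to the completed Lebesgue measure\<close>

lemma lebesgue_on_mod_null:
  fixes S :: "'a::euclidean_space set"
  defines "D \<equiv> density lborel (indicator S)"
  assumes "S \<in> sets borel" "X \<subseteq> S" "Y \<in> sets borel" "W \<in> sets borel" "emeasure D W = 0"
    and sub: "sym_diff X Y \<inter> S \<subseteq> W"
  shows "X \<in> sets (lebesgue_on S)" "emeasure (lebesgue_on S) X = emeasure D Y"
proof -
  have SL: "S \<in> sets lebesgue" using assms by simp
  have eD: "emeasure D Z = emeasure lborel (Z \<inter> S)" if "Z \<in> sets borel" for Z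
    using that assms(2) unfolding D_def by (subst emeasure_restricted) (auto simp: Int_commute)
  have W0: "W \<inter> S \<in> null_sets lborel"
    using assms eD[of W] by (auto simp: null_sets_def)
  have X2: "sym_diff X (Y \<inter> S) \<in> null_sets lebesgue"
    by (rule null_sets_completion_subset[OF _ null_sets_completionI[OF W0]]) (use sub assms(3) in blast)
  have YL: "Y \<inter> S \<in> sets lebesgue" using assms by auto
  have "X = (Y \<inter> S - (Y \<inter> S - X)) \<union> (X - Y \<inter> S)" by auto
  moreover have "Y \<inter> S - X \<in> null_sets lebesgue" "X - Y \<inter> S \<in> null_sets lebesgue"
    by (rule null_sets_completion_subset[OF _ null_sets_completionI[OF W0]]; use sub assms(3) in blast)+
  ultimately have XL: "X \<in> sets lebesgue"
    using YL by (metis sets.Diff sets.Un null_setsD2)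
  then show "X \<in> sets (lebesgue_on S)"
    using assms SL by (auto simp: sets_restrict_space_iff)
  have "emeasure (lebesgue_on S) X = emeasure lebesgue X"
    using assms SL by (subst emeasure_restrict_space) auto
  also have "\<dots> = emeasure lebesgue (Y \<inter> S)"
  proof (rule emeasure_eq_AE[OF _ XL YL])
    show "AE x in lebesgue. (x \<in> X) = (x \<in> Y \<inter> S)"
      by (rule AE_I'[OF X2]) auto
  qed
  also have "\<dots> = emeasure D Y" using assms eD by auto
  finally show "emeasure (lebesgue_on S) X = emeasure D Y" .
qed

lemma lebesgue_on_obtain_borel:
  fixes S :: "'a::euclidean_space set"
  assumes "S \<in> sets borel" "A \<in> sets (lebesgue_on S)"
  obtains B Z where "B \<in> sets borel" "Z \<in> sets borel" "emeasure (density lborel (indicator S)) Z = 0"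
    "sym_diff A B \<subseteq> Z" "A \<subseteq> S"
proof -
  have SL: "S \<in> sets lebesgue" using assms by simp
  have A: "A \<in> sets lebesgue" "A \<subseteq> S"
    using assms SL by (auto simp: sets_restrict_space_iff)
  from A(1) obtain B N N' where B: "A = B \<union> N" "N \<subseteq> N'" "N' \<in> null_sets lborel" "B \<in> sets lborel"
    by (auto elim: sets_completionE)
  show thesis
  proof (rule that[of B N'])
    have "N' \<inter> S \<in> null_sets lborel" using B assms by (auto intro: null_set_Int2)
    then show "emeasure (density lborel (indicator S)) N' = 0"
      using B assms by (subst emeasure_restricted) (auto simp: Int_commute)
  qed (use B A in auto)
qed

text \<open>Orbits that start in \<open>S\<close> are the same under \<open>T\<close> and
  \<open>T'\<close>, and a Lebesgue measurable set is a Borel set up to a subset of a Borel null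
  set. Since \<open>T'\<close> preserves the density measure, preimages of these null sets under its
  iterates are null again, so every set occurring in the mixing condition has a Borel counterpart of
  the same measure.\<close>

lemma mixing_all_orders_lebesgue_on:
  fixes S :: "'a::euclidean_space set"
  assumes S: "S \<in> sets borel"
    and mix: "mixing_all_orders (density lborel (indicator S)) T'"
    and T: "\<And>x. x \<in> S \<Longrightarrow> T x \<in> S" "\<And>x. x \<in> S \<Longrightarrow> T x = T' x"
  shows "mixing_all_orders (lebesgue_on S) T"
proof -
  define D where "D = density lborel (indicator S :: 'a \<Rightarrow> ennreal)"
  have sD: "sets D = sets borel" "space D = UNIV" by (auto simp: D_def)
  have kD: "k_mixing D T' k" if "2 \<le> k" for k
    using mix that unfolding mixing_all_orders_def D_def by blast
  have D: "prob_space D" "preserves_measure D T'"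
    using kD[of 2] by (auto simp: k_mixing_def)
  interpret prob_space D by fact
  have Tn: "(T ^^ n) x \<in> S" "(T ^^ n) x = (T' ^^ n) x" if "x \<in> S" for x n
    using that T by (induction n) auto
  have spL: "space (lebesgue_on S) = S" by simp
  have borelvim: "(T' ^^ n) -` A \<in> sets borel" "emeasure D ((T' ^^ n) -` A) = emeasure D A"
    if "A \<in> sets borel" for A n
    using measure_vimage_funpow[OF D(2) sD(2), of A n] that sD by auto
  have preim: "(T ^^ n) -` A \<inter> S \<in> sets (lebesgue_on S) \<and> emeasure (lebesgue_on S) ((T ^^ n) -` A \<inter> S) = emeasure (lebesgue_on S) A"
    if A: "A \<in> sets (lebesgue_on S)" for A n
  proof -
    obtain B Z where B: "B \<in> sets borel" "Z \<in> sets borel" "emeasure D Z = 0"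
      "sym_diff A B \<subseteq> Z" "A \<subseteq> S"
      using lebesgue_on_obtain_borel[OF S A] unfolding D_def by metis
    have 1: "emeasure (lebesgue_on S) A = emeasure D B"
      unfolding D_def by (rule lebesgue_on_mod_null(2)[OF S, of A B Z]) (use B in \<open>auto simp: D_def\<close>)
    have sub: "sym_diff ((T ^^ n) -` A \<inter> S) ((T' ^^ n) -` B) \<inter> S \<subseteq> (T' ^^ n) -` Z"
      using B(4) Tn by auto
    have "emeasure D ((T' ^^ n) -` Z) = 0" using borelvim B by simp
    then show ?thesis
      using lebesgue_on_mod_null[OF S _ _ _ _ sub] borelvim B 1 unfolding D_def by auto
  qed
  have p: "prob_space (lebesgue_on S)"
  proof
    have "emeasure (lebesgue_on S) S = emeasure D UNIV"
      unfolding D_def by (rule lebesgue_on_mod_null(2)[OF S, of S UNIV "{}"]) (auto simp: S)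
    then show "emeasure (lebesgue_on S) (space (lebesgue_on S)) = 1"
      using emeasure_space_1 sD spL by simp
  qed
  have pres: "preserves_measure (lebesgue_on S) T"
    unfolding preserves_measure_def
  proof
    show meas: "T \<in> measurable (lebesgue_on S) (lebesgue_on S)"
      using preim[of _ 1] T(1) by (intro measurableI) (auto simp: spL)
    show "distr (lebesgue_on S) (lebesgue_on S) T = lebesgue_on S"
      using preim[of _ 1] by (intro measure_eqI) (auto simp: emeasure_distr[OF meas])
  qed
  show ?thesis
    unfolding mixing_all_orders_def k_mixing_def
  proof (intro allI impI conjI p pres)
    fix k :: nat and A :: "nat \<Rightarrow> 'a set" assume k: "2 \<le> k" and A: "\<forall>j<k. A j \<in> sets (lebesgue_on S)"
    have "\<forall>j. \<exists>B Z. j < k \<longrightarrow> B \<in> sets borel \<and> Z \<in> sets borel \<and> emeasure D Z = 0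
        \<and> sym_diff (A j) B \<subseteq> Z \<and> A j \<subseteq> S"
      using A lebesgue_on_obtain_borel[OF S] unfolding D_def by metis
    then obtain B Z where B: "\<And>j. j < k \<Longrightarrow> B j \<in> sets borel" "\<And>j. j < k \<Longrightarrow> Z j \<in> sets borel"
       "\<And>j. j < k \<Longrightarrow> emeasure D (Z j) = 0"
       "\<And>j. j < k \<Longrightarrow> sym_diff (A j) (B j) \<subseteq> Z j" "\<And>j. j < k \<Longrightarrow> A j \<subseteq> S"
      by metis
    have 1: "measure (lebesgue_on S) (A j) = measure D (B j)" if "j < k" for j
    proof -
      have "emeasure (lebesgue_on S) (A j) = emeasure D (B j)"
        unfolding D_def by (rule lebesgue_on_mod_null(2)[OF S, of _ _ "Z j"]) (use B[OF that] in \<open>auto simp: D_def\<close>)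
      then show ?thesis by (simp add: measure_def)
    qed
    have 2: "measure (lebesgue_on S) (\<Inter>j<k. (T ^^ (\<Sum>i=1..j. n i)) -` A j \<inter> space (lebesgue_on S))
        = measure D (\<Inter>j<k. (T' ^^ (\<Sum>i=1..j. n i)) -` B j \<inter> space D)" for n
    proof -
      let ?N = "\<lambda>j. \<Sum>i=1..j. n i"
      let ?X = "\<Inter>j<k. (T ^^ ?N j) -` A j \<inter> S" and ?Y = "\<Inter>j<k. (T' ^^ ?N j) -` B j"
      \<comment> \<open>A point of \<open>S\<close> that distinguishes the two intersections must do
        so for some \<open>j\<close>, hence lies in the pulled-back exceptional set of that
        \<open>j\<close>.\<close>
      let ?W = "\<Union>j<k. (T' ^^ ?N j) -` Z j"
      have "emeasure (lebesgue_on S) ?X = emeasure D ?Y"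
        unfolding D_def
      proof (rule lebesgue_on_mod_null(2)[OF S])
        show "?X \<subseteq> S" using k by (intro INF_lower2[of 0]) auto
        show "?Y \<in> sets borel" using B borelvim k by (intro sets.finite_INT) (auto simp: lessThan_empty_iff)
        show "?W \<in> sets borel" using B borelvim by auto
        have "?W \<in> null_sets D"
          using B borelvim by (intro null_sets.finite_UN) (auto simp: null_sets_def sD)
        then show "emeasure (density lborel (indicator S)) ?W = 0" by (simp add: D_def null_sets_def)
        show "sym_diff ?X ?Y \<inter> S \<subseteq> ?W"
        proof
          fix x assume x: "x \<in> sym_diff ?X ?Y \<inter> S"
          then obtain j where j: "j < k" "((T ^^ ?N j) x \<in> A j) \<noteq> ((T' ^^ ?N j) x \<in> B j)"
            using k by (auto simp: lessThan_empty_iff)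
          then have "(T' ^^ ?N j) x \<in> sym_diff (A j) (B j)"
            using Tn(2) x by auto
          then show "x \<in> ?W" using B(4)[of j] j by blast
        qed
      qed
      then show ?thesis unfolding spL sD by (simp add: measure_def)
    qed
    have "((\<lambda>n. measure D (\<Inter>j<k. (T' ^^ (\<Sum>i = 1..j. n i)) -` B j \<inter> space D)) \<longlongrightarrow> (\<Prod>j<k. measure D (B j)))
          (INF i\<in>{1..<k}. filtercomap (\<lambda>n. n i) at_top)"
      using kD[OF k] B(1) unfolding k_mixing_def sD by blast
    then show "((\<lambda>n. measure (lebesgue_on S) (\<Inter>j<k. (T ^^ (\<Sum>i = 1..j. n i)) -` A j \<inter> space (lebesgue_on S))) \<longlongrightarrow> (\<Prod>j<k. measure (lebesgue_on S) (A j)))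
          (INF i\<in>{1..<k}. filtercomap (\<lambda>n. n i) at_top)"
      unfolding 2 by (simp add: 1)
  qed
qed

section \<open>A random walk killed at zero\<close>

text \<open>The probability of being at level \<open>k\<close> after \<open>n\<close> steps when
  starting at \<open>j\<close>, given by the forward equation: up with probability \<open>p\<close>,
  down with \<open>1 - p\<close>. A step down from level 0 loses its mass.\<close>

primrec walk :: "real \<Rightarrow> nat \<Rightarrow> nat \<Rightarrow> nat \<Rightarrow> real" where
  "walk p j 0 = (\<lambda>k. if k = j then 1 else 0)"
| "walk p j (Suc n) = (\<lambda>k. p * (if k = 0 then 0 else walk p j n (k - 1)) + (1 - p) * walk p j n (Suc k))"

lemma walk_nonneg: "0 \<le> p \<Longrightarrow> p \<le> 1 \<Longrightarrow> 0 \<le> walk p j n k"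
  by (induction n arbitrary: k) auto

lemma walk_eq_0: "n + j < k \<Longrightarrow> walk p j n k = 0"
  by (induction n arbitrary: k) auto

lemma sum_walk_le_1:
  assumes "0 \<le> p" "p \<le> 1" "finite K"
  shows "(\<Sum>k\<in>K. walk p j n k) \<le> 1"
proof -
  have *: "(\<Sum>k\<le>L. walk p j n k) \<le> 1" for L
  proof (induction n arbitrary: L)
    case 0
    then show ?case by simp
  next
    case (Suc n)
    have "(\<Sum>k\<le>L. if k = 0 then 0 else walk p j n (k - 1)) \<le> (\<Sum>k\<le>Suc L. if k = 0 then 0 else walk p j n (k - 1))"
      using walk_nonneg[OF assms(1,2)] by (intro sum_mono2) auto
    also have "\<dots> = (\<Sum>k\<le>L. walk p j n k)"
      by (subst sum.atMost_Suc_shift) simp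
    finally have 1: "(\<Sum>k\<le>L. if k = 0 then 0 else walk p j n (k - 1)) \<le> 1"
      using Suc[of L] by linarith
    have "(\<Sum>k\<le>L. walk p j n (Suc k)) \<le> (\<Sum>k\<le>Suc L. walk p j n k)"
      using walk_nonneg[OF assms(1,2)] by (subst sum.atMost_Suc_shift) simp
    then have 2: "(\<Sum>k\<le>L. walk p j n (Suc k)) \<le> 1"
      using Suc[of "Suc L"] by linarith
    have "(\<Sum>k\<le>L. walk p j (Suc n) k)
       = p * (\<Sum>k\<le>L. if k = 0 then 0 else walk p j n (k - 1)) + (1 - p) * (\<Sum>k\<le>L. walk p j n (Suc k))"
      by (simp add: sum.distrib sum_distrib_left)
    also have "\<dots> \<le> p * 1 + (1 - p) * 1"
      using 1 2 assms by (intro add_mono mult_left_mono) auto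
    finally show ?case by simp
  qed
  have "(\<Sum>k\<in>K. walk p j n k) \<le> (\<Sum>k\<le>Max (insert 0 K). walk p j n k)"
    using walk_nonneg[OF assms(1,2)] assms(3) by (intro sum_mono2) auto
  with * show ?thesis by (meson order_trans)
qed

text \<open>The identity \<open>(p u + (1 - p) v)^2 = p u^2 + (1 - p) v^2 - p (1 - p) (u -
  v)^2\<close> is summed over all levels, where \<open>u\<close> and \<open>v\<close> are the
  weights one level below and above. The sum of squares therefore drops at least by the loss at
  level \<open>k + 1\<close>, whose neighbours are \<open>k\<close> and
  \<open>k + 2\<close>.\<close>

lemma walk_energy:
  assumes p: "0 \<le> p" "p \<le> 1"
  shows "(\<Sum>k\<le>Suc n + j. (walk p j (Suc n) k)\<^sup>2) + p * (1 - p) * (walk p j n k - walk p j n (k + 2))\<^sup>2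
          \<le> (\<Sum>k\<le>n + j. (walk p j n k)\<^sup>2)"
proof -
  define w where "w = walk p j n"
  define u where "u k = (if k = 0 then 0 else w (k - 1))" for k
  \<comment> \<open>Large enough for the support after the step and for the level
    \<open>Suc k\<close> whose loss is retained.\<close>
  define I where "I = {..max (Suc n + j) (Suc k)}"
  have w0: "w l = 0" if "n + j < l" for l unfolding w_def using that by (rule walk_eq_0)
  have S: "(\<Sum>k\<le>n + j. (w k)\<^sup>2) = (\<Sum>l\<le>L. (w l)\<^sup>2)" if "n + j \<le> L" for L
    using that w0 by (intro sum.mono_neutral_left) auto
  have 1: "(\<Sum>k\<le>Suc n + j. (walk p j (Suc n) k)\<^sup>2) = (\<Sum>l\<in>I. (walk p j (Suc n) l)\<^sup>2)"
    unfolding I_def by (intro sum.mono_neutral_left) (auto simp del: walk.simps simp: walk_eq_0)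
  have "(walk p j (Suc n) l)\<^sup>2 = p * (u l)\<^sup>2 + (1 - p) * (w (Suc l))\<^sup>2 - p * (1 - p) * (u l - w (Suc l))\<^sup>2" for l
    by (simp add: u_def w_def power2_eq_square) (simp add: algebra_simps)
  then have 2: "(\<Sum>l\<in>I. (walk p j (Suc n) l)\<^sup>2)
      = p * (\<Sum>l\<in>I. (u l)\<^sup>2) + (1 - p) * (\<Sum>l\<in>I. (w (Suc l))\<^sup>2) - p * (1 - p) * (\<Sum>l\<in>I. (u l - w (Suc l))\<^sup>2)"
    by (simp add: sum.distrib sum_subtractf sum_distrib_left)
  obtain L where L: "I = {..Suc L}" "n + j \<le> L" unfolding I_def
    by (metis Suc_le_mono add_Suc max.cobounded1 max_Suc_Suc)
  have "(\<Sum>l\<in>I. (u l)\<^sup>2) = (\<Sum>l\<le>L. (w l)\<^sup>2)"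
    unfolding L by (subst sum.atMost_Suc_shift) (simp add: u_def)
  then have 3: "(\<Sum>l\<in>I. (u l)\<^sup>2) = (\<Sum>k\<le>n + j. (w k)\<^sup>2)" using S[OF L(2)] by simp
  have "(\<Sum>l\<in>I. (w (Suc l))\<^sup>2) \<le> (\<Sum>l\<le>Suc (Suc L). (w l)\<^sup>2)"
    unfolding L by (subst (2) sum.atMost_Suc_shift) simp
  then have 4: "(\<Sum>l\<in>I. (w (Suc l))\<^sup>2) \<le> (\<Sum>k\<le>n + j. (w k)\<^sup>2)"
    using S[of "Suc (Suc L)"] L by simp
  have "(u (Suc k) - w (Suc (Suc k)))\<^sup>2 \<le> (\<Sum>l\<in>I. (u l - w (Suc l))\<^sup>2)"
    by (rule member_le_sum[of "Suc k" I "\<lambda>l. (u l - w (Suc l))\<^sup>2"]) (auto simp: I_def)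
  then have 5: "p * (1 - p) * (w k - w (k + 2))\<^sup>2 \<le> p * (1 - p) * (\<Sum>l\<in>I. (u l - w (Suc l))\<^sup>2)"
    using p by (intro mult_left_mono) (auto simp: u_def)
  have "(1 - p) * (\<Sum>l\<in>I. (w (Suc l))\<^sup>2) \<le> (1 - p) * (\<Sum>k\<le>n + j. (w k)\<^sup>2)"
    using p 4 by (intro mult_left_mono) auto
  with 1 2 3 5 show ?thesis unfolding w_def by (simp add: algebra_simps)
qed

text \<open>The energy inequality forces \<open>walk p j n k\<close> and \<open>walk p j n (k + 2)\<close> to be uniformly close for
  large \<open>n\<close>; as the total mass is at most 1, no single value can stay large.\<close>

lemma sum_walk_square_tendsto_0:
  assumes p: "0 < p" "p < 1"
  shows "(\<lambda>n. \<Sum>k\<le>n + j. (walk p j n k)\<^sup>2) \<longlonglongrightarrow> 0"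
proof -
  define S where "S n = (\<Sum>k\<le>n + j. (walk p j n k)\<^sup>2)" for n
  have pq: "0 < p * (1 - p)" using p by simp
  have en: "S (Suc n) + p * (1 - p) * (walk p j n k - walk p j n (k + 2))\<^sup>2 \<le> S n" for n k
    unfolding S_def using p by (intro walk_energy) auto
  have "S (Suc n) \<le> S n" for n
    using en[of n 0] pq mult_nonneg_nonneg[OF less_imp_le[OF pq] zero_le_power2] by (smt (verit))
  then have "decseq S" by (rule decseq_SucI)
  moreover have S0: "0 \<le> S n" for n unfolding S_def by (intro sum_nonneg) auto
  ultimately obtain L where L: "S \<longlonglongrightarrow> L" using decseq_convergent by blast
  \<comment> \<open>The energy converges, so its decrement vanishes; the decrement dominates the
    squared difference at every level, which makes the closeness uniform in
    \<open>k\<close>.\<close>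
  have lim: "(\<lambda>n. (S n - S (Suc n)) / (p * (1 - p))) \<longlonglongrightarrow> 0"
    using tendsto_divide[OF tendsto_diff[OF L LIMSEQ_Suc[OF L]] tendsto_const, of "p * (1 - p)"] p by simp
  have close: "\<exists>N. \<forall>n\<ge>N. \<forall>k. \<bar>walk p j n k - walk p j n (k + 2)\<bar> \<le> d" if "0 < d" for d
  proof -
    obtain N where N: "\<And>n. N \<le> n \<Longrightarrow> (S n - S (Suc n)) / (p * (1 - p)) < d\<^sup>2"
      using order_tendstoD(2)[OF lim, of "d\<^sup>2"] \<open>0 < d\<close>
      unfolding eventually_sequentially by (metis zero_less_power)
    have "\<bar>walk p j n k - walk p j n (k + 2)\<bar> \<le> d" if "N \<le> n" for n k
    proof (rule power2_le_imp_le)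
      have "(walk p j n k - walk p j n (k + 2))\<^sup>2 \<le> (S n - S (Suc n)) / (p * (1 - p))"
        using en[of n k] pq by (simp add: field_simps)
      then show "\<bar>walk p j n k - walk p j n (k + 2)\<bar>\<^sup>2 \<le> d\<^sup>2" using N[OF that] by simp
    qed (use \<open>0 < d\<close> in simp)
    then show ?thesis by blast
  qed
  show ?thesis
    unfolding S_def[symmetric]
  proof (rule LIMSEQ_I)
    fix e :: real assume e: "0 < e"
    \<comment> \<open>Averaging over the \<open>J\<close> levels \<open>k, k + 2, ...\<close> bounds
      a single weight by \<open>1 / J\<close>, less than \<open>e / 2\<close>, plus at most
      \<open>J\<close> comparisons of size \<open>d = e / (4 J)\<close>, together
      \<open>e / 4\<close>. This gives the bound \<open>3 * e / 4\<close>.\<close>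
    obtain J :: nat where J: "2 / e < real J" using reals_Archimedean2 by blast
    have J0: "0 < real J" using J e by (smt (verit) divide_pos_pos)
    define d where "d = e / (4 * real J)"
    have d: "0 < d" using e J0 by (simp add: d_def)
    obtain N where N: "\<And>n k. N \<le> n \<Longrightarrow> \<bar>walk p j n k - walk p j n (k + 2)\<bar> \<le> d"
      using close[OF d] by blast
    have "norm (S n - 0) < e" if n: "N \<le> n" for n
    proof -
      have w0: "0 \<le> walk p j n k" for k using p by (intro walk_nonneg) auto
      have step: "walk p j n k \<le> walk p j n (k + 2 * i) + real i * d" for k i
      proof (induction i)
        case (Suc i)
        have "walk p j n (k + 2 * i) \<le> walk p j n (k + 2 * i + 2) + d"
          using N[OF n, of "k + 2 * i"] by linarith
        with Suc show ?case by (simp add: algebra_simps)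
      qed simp
      have up: "walk p j n k \<le> 3 * e / 4" for k
      proof -
        have "real J * walk p j n k = (\<Sum>i<J. walk p j n k)" by simp
        also have "\<dots> \<le> (\<Sum>i<J. walk p j n (k + 2 * i) + real J * d)"
        proof (rule sum_mono)
          fix i assume "i \<in> {..<J}"
          then have "real i * d \<le> real J * d" using d by (intro mult_right_mono) auto
          then show "walk p j n k \<le> walk p j n (k + 2 * i) + real J * d"
            using step[of k i] by linarith
        qed
        also have "\<dots> = (\<Sum>l\<in>(\<lambda>i. k + 2 * i) ` {..<J}. walk p j n l) + real J * (real J * d)"
          by (subst sum.reindex) (auto simp: inj_on_def sum.distrib)
        also have "\<dots> \<le> 1 + real J * (e / 4)"
          using sum_walk_le_1[of p "(\<lambda>i. k + 2 * i) ` {..<J}" j n] p J0 by (simp add: d_def)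
        finally have "walk p j n k \<le> 1 / real J + e / 4" using J0 by (simp add: field_simps)
        moreover have "1 / real J < e / 2" using J J0 e by (simp add: field_simps)
        ultimately show ?thesis by simp
      qed
      \<comment> \<open>A sum of squares is at most the largest weight times the total mass.\<close>
      have "S n \<le> (\<Sum>k\<le>n + j. 3 * e / 4 * walk p j n k)"
        unfolding S_def power2_eq_square using up w0 by (intro sum_mono mult_right_mono) auto
      also have "\<dots> \<le> 3 * e / 4 * 1"
        unfolding sum_distrib_left[symmetric] using sum_walk_le_1[of p "{..n + j}" j n] p e
        by (intro mult_left_mono) auto
      finally show ?thesis using e S0[of n] by simp
    qed
    then show "\<exists>N. \<forall>n\<ge>N. norm (S n - 0) < e" by blast
  qed
qed

section \<open>The uniform distribution and base-m digits\<close>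

text \<open>A class closed under all operations below and integrable for every finite Borel measure,
  so that integrability never has to be argued case by case.\<close>

definition bounded_borel :: "('a::topological_space \<Rightarrow> real) \<Rightarrow> bool" where
  "bounded_borel f \<longleftrightarrow> f \<in> borel_measurable borel \<and> (\<exists>C. \<forall>x. \<bar>f x\<bar> \<le> C)"

named_theorems bb_intros

lemma bb_measurable: "bounded_borel f \<Longrightarrow> f \<in> borel_measurable borel"
  by (simp add: bounded_borel_def)

lemma bb_const[bb_intros]: "bounded_borel (\<lambda>_. c)"
  by (auto simp: bounded_borel_def)

lemma bb_indicator[bb_intros]: "A \<in> sets borel \<Longrightarrow> bounded_borel (indicator A)"
  by (auto simp: bounded_borel_def intro!: exI[of _ 1] split: split_indicator)

lemma bb_add[bb_intros]: "bounded_borel f \<Longrightarrow> bounded_borel g \<Longrightarrow> bounded_borel (\<lambda>x. f x + g x)"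
  unfolding bounded_borel_def by (auto intro: borel_measurable_add) (meson abs_triangle_ineq add_mono order_trans)

lemma bb_mult[bb_intros]: "bounded_borel f \<Longrightarrow> bounded_borel g \<Longrightarrow> bounded_borel (\<lambda>x. f x * g x)"
  unfolding bounded_borel_def
proof (elim conjE exE, intro conjI)
  fix C D assume "\<forall>x. \<bar>f x\<bar> \<le> C" "\<forall>x. \<bar>g x\<bar> \<le> D"
  then show "\<exists>C. \<forall>x. \<bar>f x * g x\<bar> \<le> C"
    by (intro exI[of _ "C * D"]) (auto simp: abs_mult intro!: mult_mono intro: order_trans[OF abs_ge_zero])
qed (rule borel_measurable_times)

lemma bb_cmult[bb_intros]: "bounded_borel f \<Longrightarrow> bounded_borel (\<lambda>x. c * f x)"
  by (intro bb_intros)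

lemma bb_divide[bb_intros]: "bounded_borel f \<Longrightarrow> bounded_borel (\<lambda>x. f x / c)"
  using bb_cmult[of f "1 / c"] by simp

lemma bb_diff[bb_intros]: "bounded_borel f \<Longrightarrow> bounded_borel g \<Longrightarrow> bounded_borel (\<lambda>x. f x - g x)"
  using bb_add[of f "\<lambda>x. - 1 * g x"] bb_cmult[of g "-1"] by simp

lemma bb_abs[bb_intros]: "bounded_borel f \<Longrightarrow> bounded_borel (\<lambda>x. \<bar>f x\<bar>)"
  by (auto simp: bounded_borel_def)

lemma bb_sum[bb_intros]: "(\<And>i. i \<in> I \<Longrightarrow> bounded_borel (f i)) \<Longrightarrow> bounded_borel (\<lambda>x. \<Sum>i\<in>I. f i x)"
  by (induction I rule: infinite_finite_induct) (auto intro: bb_intros)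

lemma bb_comp: "bounded_borel f \<Longrightarrow> g \<in> measurable borel borel \<Longrightarrow> bounded_borel (\<lambda>x. f (g x))"
  unfolding bounded_borel_def by (auto intro: measurable_compose)

lemma bb_integrable:
  assumes "finite_measure M" "sets M = sets borel" "bounded_borel f"
  shows "integrable M f"
proof -
  interpret finite_measure M by fact
  obtain C where "\<forall>x. \<bar>f x\<bar> \<le> C" using assms by (auto simp: bounded_borel_def)
  then show ?thesis
    using assms bb_measurable[OF assms(3)]
    by (intro integrable_const_bound[of _ C]) (auto simp: measurable_cong_sets[OF assms(2) refl])
qed

text \<open>The uniform distribution on [0,1], carried by the whole line: its space is
  \<open>UNIV\<close>, so total maps act on it without restricting domains.\<close>

definition lam :: "real measure" where
  "lam = density lborel (indicator {0..1})"

lemma sets_lam[simp, measurable_cong]: "sets lam = sets borel"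
  by (simp add: lam_def)

lemma space_lam[simp]: "space lam = UNIV"
  by (simp add: lam_def)

lemma emeasure_lam: "A \<in> sets borel \<Longrightarrow> emeasure lam A = emeasure lborel ({0..1} \<inter> A)"
  unfolding lam_def by (rule emeasure_restricted) auto

interpretation lam: prob_space lam
  by standard (simp add: emeasure_lam)

lemma integrable_lam: "bounded_borel f \<Longrightarrow> integrable lam f"
  by (rule bb_integrable) (auto intro: lam.finite_measure_axioms)

text \<open>The spare exceptional point \<open>c\<close> absorbs the common endpoint when an
  interval is cut in two closed pieces.\<close>

lemma AE_lam: "AE x in lam. 0 \<le> x \<and> x < 1 \<and> x \<noteq> c"
proof (rule AE_I)
  have meas: "- ({0..<1} - {c}) \<in> sets borel" by auto
  have "finite ({0..1} \<inter> - ({0..<1} - {c}))"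
    by (rule finite_subset[of _ "{c, 1}"]) auto
  then show "emeasure lam (- ({0..<1} - {c})) = 0"
    using meas by (subst emeasure_lam) (auto intro: emeasure_lborel_countable countable_finite)
  show "- ({0..<1} - {c}) \<in> sets lam" using meas by simp
qed auto

lemma lam_integral_cong:
  assumes "bounded_borel f" "bounded_borel g" "\<And>x. 0 \<le> x \<Longrightarrow> x < 1 \<Longrightarrow> f x = g x"
  shows "integral\<^sup>L lam f = integral\<^sup>L lam g"
proof (rule integral_cong_AE)
  show "AE x in lam. f x = g x"
    using AE_lam[of 0] by eventually_elim (use assms(3) in auto)
qed (use assms in \<open>auto dest: bb_measurable\<close>)

lemma lam_affine:
  assumes f: "bounded_borel f" and u: "0 \<le> u" "0 < s" "u + s \<le> 1"
  shows "s * (\<integral>x. f (u + s * x) \<partial>lam) = (\<integral>y. indicator {u..u + s} y * f y \<partial>lam)"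
proof -
  have lam_int: "integral\<^sup>L lam h = (\<integral>y. indicator {0..1} y * h y \<partial>lborel)" if "bounded_borel h" for h
  proof -
    have "lam = density lborel (\<lambda>y. ennreal (indicator {0..1} y))"
      by (simp add: lam_def ennreal_indicator)
    then have "integral\<^sup>L lam h = integral\<^sup>L (density lborel (\<lambda>y. ennreal (indicator {0..1} y))) h"
      by simp
    then show ?thesis using bb_measurable[OF that] by (simp add: integral_density)
  qed
  have 1: "bounded_borel (\<lambda>x. f (u + s * x))" by (rule bb_comp[OF f]) auto
  have 2: "bounded_borel (\<lambda>y. indicator {u..u + s} y * f y)" by (intro bb_intros f) auto
  have "(\<integral>y. indicator {0..1} y * (indicator {u..u + s} y * f y) \<partial>lborel)
      = \<bar>s\<bar> *\<^sub>R (\<integral>x. indicator {0..1} (u + s * x) * (indicator {u..u + s} (u + s * x) * f (u + s * x)) \<partial>lborel)"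
    by (rule lborel_integral_real_affine) (use u in auto)
  also have "\<dots> = s * (\<integral>x. indicator {0..1} x * f (u + s * x) \<partial>lborel)"
  proof -
    have "indicator {0..1} (u + s * x) * (indicator {u..u + s} (u + s * x) * f (u + s * x)) = indicator {0..1} x * f (u + s * x)" for x
    proof (cases "0 \<le> x \<and> x \<le> 1")
      case True
      then have "0 \<le> s * x" "s * x \<le> s" using u by (auto simp: mult_left_le)
      then have "0 \<le> u + s * x" "u + s * x \<le> 1" "u \<le> u + s * x" "u + s * x \<le> u + s"
        using u by linarith+
      then have "u + s * x \<in> {0..1}" "u + s * x \<in> {u..u + s}" by auto
      with True show ?thesis by simp
    next
      case False
      then have "\<not> (0 \<le> s * x \<and> s * x \<le> s)" using u by (auto simp: zero_le_mult_iff)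
      then have "u + s * x \<notin> {u..u + s}" by auto
      with False show ?thesis by simp
    qed
    then show ?thesis by (simp only: abs_of_pos[OF u(2)] real_scaleR_def)
  qed
  finally show ?thesis unfolding lam_int[OF 1] lam_int[OF 2] by simp
qed

lemma lam_integral_split2:
  assumes f: "bounded_borel f" and p: "0 < p" "p < 1"
  shows "integral\<^sup>L lam f = p * (\<integral>x. f (p * x) \<partial>lam) + (1 - p) * (\<integral>x. f (p + (1 - p) * x) \<partial>lam)"
proof -
  have "integral\<^sup>L lam f = (\<integral>x. indicator {0..p} x * f x + indicator {p..1} x * f x \<partial>lam)"
  proof (rule integral_cong_AE)
    show "AE x in lam. f x = indicator {0..p} x * f x + indicator {p..1} x * f x"
      using AE_lam[of p] by eventually_elim (auto split: split_indicator)
  qed (use bb_measurable[OF f] in auto)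
  also have "\<dots> = (\<integral>x. indicator {0..p} x * f x \<partial>lam) + (\<integral>x. indicator {p..1} x * f x \<partial>lam)"
    by (intro Bochner_Integration.integral_add integrable_lam bb_intros f) auto
  finally show ?thesis
    using lam_affine[OF f, of 0 p] lam_affine[OF f, of p "1 - p"] p by simp
qed

lemma lam_integral_split:
  assumes f: "bounded_borel f" and m: "0 < m"
  shows "integral\<^sup>L lam f = (\<Sum>i<m. \<integral>x. f ((x + real i) / real m) \<partial>lam) / real m"
proof -
  have *: "(\<integral>x. indicator {0..real k / m} x * f x \<partial>lam) = (\<Sum>i<k. \<integral>x. f ((x + real i) / real m) \<partial>lam) / real m"
    if "k \<le> m" for k
    using that
  proof (induction k)
    case 0
    have "(\<integral>x. indicator {0..real 0 / m} x * f x \<partial>lam) = (\<integral>x. 0 \<partial>lam)"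
    proof (rule integral_cong_AE)
      show "AE x in lam. indicator {0..real 0 / m} x * f x = 0"
        using AE_lam[of 0] by eventually_elim (auto split: split_indicator)
    qed (use bb_measurable[OF f] in auto)
    then show ?case by simp
  next
    case (Suc k)
    have le: "real k / m + 1 / m \<le> 1" using Suc.prems m by (simp add: field_simps)
    have "(\<integral>x. indicator {0..real (Suc k) / m} x * f x \<partial>lam)
        = (\<integral>x. indicator {0..real k / m} x * f x + indicator {real k / m..real k / m + 1 / m} x * f x \<partial>lam)"
    proof (rule integral_cong_AE)
      have e: "real (Suc k) / m = real k / m + 1 / m" by (simp add: add_divide_distrib)
      have "0 \<le> real k / m" "real k / m \<le> real k / m + 1 / m" using m by auto
      then show "AE x in lam. indicator {0..real (Suc k) / m} x * f x
         = indicator {0..real k / m} x * f x + indicator {real k / m..real k / m + 1 / m} x * f x"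
        unfolding e
      proof (intro eventually_mono[OF AE_lam[of "real k / m"]])
        have ind: "indicator {0..r + t} x * f x = indicator {0..r} x * f x + indicator {r..r + t} x * f x"
          if "0 \<le> r" "0 \<le> t" "x \<noteq> r" "0 \<le> x" for r t x
          using that by (auto split: split_indicator)
        show "indicator {0..real k / m + 1 / m} x * f x
           = indicator {0..real k / m} x * f x + indicator {real k / m..real k / m + 1 / m} x * f x"
          if "0 \<le> x \<and> x < 1 \<and> x \<noteq> real k / m" for x
          by (rule ind) (use that in auto)
      qed
    qed (use bb_measurable[OF f] in auto)
    also have "\<dots> = (\<integral>x. indicator {0..real k / m} x * f x \<partial>lam)
        + (\<integral>x. indicator {real k / m..real k / m + 1 / m} x * f x \<partial>lam)"
      by (intro Bochner_Integration.integral_add integrable_lam bb_intros f) auto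
    also have "(\<integral>x. indicator {real k / m..real k / m + 1 / m} x * f x \<partial>lam) = 1 / m * (\<integral>x. f (real k / m + 1 / m * x) \<partial>lam)"
      by (rule lam_affine[OF f, symmetric]) (use m le in auto)
    finally show ?case using Suc by (simp add: add_divide_distrib add.commute)
  qed
  have "integral\<^sup>L lam f = (\<integral>x. indicator {0..real m / m} x * f x \<partial>lam)"
    by (rule lam_integral_cong) (use m in \<open>auto intro!: bb_intros f split: split_indicator\<close>)
  with *[of m] show ?thesis by simp
qed

text \<open>The leading base-m digit. The minimum assigns the point 1 to the last digit, in
  agreement with the closed last strip of the baker map; accordingly
  \<open>sig m 1 = 1\<close>.\<close>

definition dig :: "nat \<Rightarrow> real \<Rightarrow> nat" where
  "dig m t = min (nat \<lfloor>real m * t\<rfloor>) (m - 1)"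

definition sig :: "nat \<Rightarrow> real \<Rightarrow> real" where
  "sig m t = real m * t - real (dig m t)"

lemma measurable_dig[measurable]: "dig m \<in> measurable borel (count_space UNIV)"
  unfolding dig_def by measurable

lemma measurable_sig[measurable]: "sig m \<in> borel_measurable borel"
  unfolding sig_def by measurable

lemma dig_less: "0 < m \<Longrightarrow> dig m t < m"
  by (auto simp: dig_def)

lemma dig_branch:
  assumes "0 \<le> x" "x < 1" "i < m"
  shows "dig m ((x + real i) / real m) = i" "sig m ((x + real i) / real m) = x"
proof -
  have "\<lfloor>x + real i\<rfloor> = int i" using assms by (intro floor_unique) auto
  then show "dig m ((x + real i) / real m) = i" using assms by (simp add: dig_def)
  then show "sig m ((x + real i) / real m) = x" using assms by (simp add: sig_def)
qed

lemma sig_bounds: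
  assumes "0 < m" "0 \<le> t"
  shows "0 \<le> sig m t" "t < 1 \<Longrightarrow> sig m t < 1" "t \<le> 1 \<Longrightarrow> sig m t \<le> 1"
proof -
  have f: "real (nat \<lfloor>real m * t\<rfloor>) \<le> real m * t" using assms by simp
  then show "0 \<le> sig m t" unfolding sig_def dig_def by linarith
  have *: "sig m t < 1" if "t < 1"
  proof -
    have "real m * t < real m" using that assms by simp
    then have "nat \<lfloor>real m * t\<rfloor> \<le> m - 1" using assms by linarith
    then have "dig m t = nat \<lfloor>real m * t\<rfloor>" by (simp add: dig_def)
    then show ?thesis unfolding sig_def using assms by linarith
  qed
  then show "t < 1 \<Longrightarrow> sig m t < 1" .
  have "sig m 1 = 1" using assms by (simp add: sig_def dig_def)
  with * show "t \<le> 1 \<Longrightarrow> sig m t \<le> 1" by (cases "t = 1") auto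
qed

lemma dig_sig: "0 < m \<Longrightarrow> (sig m t + real (dig m t)) / real m = t"
  by (simp add: sig_def)

text \<open>Lexicographic comparison of expansions. It is exact because \<open>x < 1\<close> and
  \<open>sig m t \<le> 1\<close>, so different leading digits already decide.\<close>

lemma less_iff_dig_sig:
  assumes "0 < m" "0 \<le> x" "x < 1" "0 \<le> t" "t \<le> 1"
  shows "(x + real i) / real m < t \<longleftrightarrow> i < dig m t \<or> i = dig m t \<and> x < sig m t"
proof -
  have *: "(x + real i) / real m < t \<longleftrightarrow> x + real i < sig m t + real (dig m t)"
    using assms by (simp add: sig_def field_simps)
  have s: "0 \<le> sig m t" "sig m t \<le> 1" using sig_bounds assms by auto
  show ?thesis
  proof (cases i "dig m t" rule: linorder_cases)
    case less
    then have "real i + 1 \<le> real (dig m t)" by linarith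
    then have "x + real i < sig m t + real (dig m t)" using s assms by linarith
    with less * show ?thesis by simp
  next
    case greater
    then have "real (dig m t) + 1 \<le> real i" by linarith
    then have "\<not> x + real i < sig m t + real (dig m t)" using s assms by linarith
    with greater * show ?thesis by simp
  qed (use * in simp)
qed

text \<open>The adjoint U* of composition with \<open>sig m\<close>: the mean over the m inverse
  branches.\<close>

definition avg :: "nat \<Rightarrow> (real \<Rightarrow> real) \<Rightarrow> real \<Rightarrow> real" where
  "avg m f y = (\<Sum>i<m. f ((y + real i) / real m)) / real m"

lemma bb_avg[bb_intros]:
  assumes "bounded_borel f"
  shows "bounded_borel (avg m f)"
  unfolding avg_def[abs_def] by (intro bb_divide bb_sum bb_comp[OF assms]) auto

lemma bb_sig: "bounded_borel f \<Longrightarrow> bounded_borel (\<lambda>x. f (sig m x))"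
  by (rule bb_comp) auto

lemma integral_avg:
  assumes "bounded_borel f" "0 < m"
  shows "integral\<^sup>L lam (avg m f) = integral\<^sup>L lam f"
proof -
  have "integral\<^sup>L lam (avg m f) = (\<Sum>i<m. \<integral>x. f ((x + real i) / real m) \<partial>lam) / real m"
    unfolding avg_def[abs_def] using assms
    by (subst integral_divide_zero, subst Bochner_Integration.integral_sum) (auto intro!: integrable_lam bb_comp[OF assms(1)])
  then show ?thesis using lam_integral_split[OF assms] by simp
qed

text \<open>\<open>f\<close> composed with \<open>sig m\<close> takes the same value
  \<open>f x\<close> on all inverse branches of \<open>x\<close>, so it leaves the average as a
  factor.\<close>

lemma integral_sig_mult:
  assumes "bounded_borel f" "bounded_borel g" "0 < m"
  shows "(\<integral>x. f (sig m x) * g x \<partial>lam) = (\<integral>x. f x * avg m g x \<partial>lam)"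
proof -
  have "(\<integral>x. f (sig m x) * g x \<partial>lam) = integral\<^sup>L lam (avg m (\<lambda>x. f (sig m x) * g x))"
    by (intro integral_avg[symmetric] bb_intros bb_sig assms)
  also have "\<dots> = (\<integral>x. f x * avg m g x \<partial>lam)"
    by (intro lam_integral_cong bb_intros bb_sig assms)
      (auto simp: avg_def dig_branch sum_distrib_left sum_divide_distrib)
  finally show ?thesis .
qed

lemma integral_sig:
  assumes "bounded_borel f" "0 < m"
  shows "(\<integral>x. f (sig m x) \<partial>lam) = integral\<^sup>L lam f"
proof -
  have "(\<integral>x. f (sig m x) \<partial>lam) = (\<integral>x. f x * avg m (\<lambda>_. 1) x \<partial>lam)"
    using integral_sig_mult[OF assms(1) bb_const assms(2), of 1] by simp
  then show ?thesis using assms(2) by (simp add: avg_def)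
qed

section \<open>The transfer operator of the two-dimensional map\<close>

lemma prob_lam_UNIV[simp]: "measure lam UNIV = 1"
  using lam.prob_space by simp

definition lam2 :: "(real \<times> real) measure" where
  "lam2 = lam \<Otimes>\<^sub>M lam"

lemma sets_lam2[simp, measurable_cong]: "sets lam2 = sets borel"
  unfolding lam2_def by (metis borel_prod sets_lam sets_pair_measure_cong)

lemma space_lam2[simp]: "space lam2 = UNIV"
  by (simp add: lam2_def space_pair_measure)

interpretation lam_lam: pair_prob_space lam lam ..

interpretation lam2: prob_space lam2
  unfolding lam2_def by (rule lam_lam.prob_space_axioms)

lemma prob_lam2_UNIV[simp]: "measure lam2 UNIV = 1"
  using lam2.prob_space by simp

lemma integrable_lam2: "bounded_borel f \<Longrightarrow> integrable lam2 f"
  by (rule bb_integrable) (auto intro: lam2.finite_measure_axioms)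

lemma bb_slice1: "bounded_borel f \<Longrightarrow> bounded_borel (\<lambda>y. f (x, y))"
  for f :: "'a::second_countable_topology \<times> 'b::second_countable_topology \<Rightarrow> real"
  by (rule bb_comp) (auto simp: borel_prod[symmetric])

lemma bb_slice2: "bounded_borel f \<Longrightarrow> bounded_borel (\<lambda>x. f (x, y))"
  for f :: "'a::second_countable_topology \<times> 'b::second_countable_topology \<Rightarrow> real"
  by (rule bb_comp) (auto simp: borel_prod[symmetric])

lemma bb_integral_slice:
  fixes f :: "'a::second_countable_topology \<times> real \<Rightarrow> real"
  assumes "bounded_borel f"
  shows "bounded_borel (\<lambda>x. \<integral>y. f (x, y) \<partial>lam)"
proof -
  obtain C where C: "\<And>z. \<bar>f z\<bar> \<le> C" using assms by (auto simp: bounded_borel_def)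
  have "f \<in> borel_measurable (borel \<Otimes>\<^sub>M lam)"
    using bb_measurable[OF assms]
    by (simp add: measurable_cong_sets[OF sets_pair_measure_cong[OF refl sets_lam] refl] borel_prod)
  then have "(\<lambda>x. \<integral>y. f (x, y) \<partial>lam) \<in> borel_measurable borel"
    by (intro lam.borel_measurable_lebesgue_integral) simp
  moreover have "\<bar>\<integral>y. f (x, y) \<partial>lam\<bar> \<le> C" for x
  proof -
    have "\<bar>\<integral>y. f (x, y) \<partial>lam\<bar> \<le> (\<integral>y. \<bar>f (x, y)\<bar> \<partial>lam)"
      by (rule integral_abs_bound)
    also have "\<dots> \<le> (\<integral>y. C \<partial>lam)"
      by (intro integral_mono integrable_lam bb_intros bb_slice1 assms C)
    finally show ?thesis by (simp add: lam.prob_space)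
  qed
  ultimately show ?thesis by (auto simp: bounded_borel_def)
qed

lemma bb_integral_slice2:
  fixes f :: "real \<times> 'a::second_countable_topology \<Rightarrow> real"
  assumes "bounded_borel f"
  shows "bounded_borel (\<lambda>y. \<integral>x. f (x, y) \<partial>lam)"
  using bb_integral_slice[OF bb_comp[OF assms, of "\<lambda>(y, x). (x, y)"]] by (simp add: borel_prod[symmetric])

lemma integral_lam2:
  assumes "bounded_borel f"
  shows "integral\<^sup>L lam2 f = (\<integral>x. \<integral>y. f (x, y) \<partial>lam \<partial>lam)"
    "integral\<^sup>L lam2 f = (\<integral>y. \<integral>x. f (x, y) \<partial>lam \<partial>lam)"
  using lam_lam.integral_fst'[of f] lam_lam.integral_snd[of "\<lambda>x y. f (x, y)"] integrable_lam2[OF assms]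
  unfolding lam2_def by simp_all

lemma lam2_integral_cong:
  assumes "bounded_borel f" "bounded_borel g" "\<And>z. z \<in> {0..<1} \<times> {0..<1} \<Longrightarrow> f z = g z"
  shows "integral\<^sup>L lam2 f = integral\<^sup>L lam2 g"
  unfolding integral_lam2(1)[OF assms(1)] integral_lam2(1)[OF assms(2)]
  by (intro lam_integral_cong bb_integral_slice bb_slice1 assms) auto

lemma integral_lam2_snd:
  assumes "bounded_borel f"
  shows "(\<integral>z. f (snd z) \<partial>lam2) = integral\<^sup>L lam f"
  by (subst integral_lam2) (auto intro!: bb_comp[OF assms] simp: lam.prob_space borel_prod[symmetric])

text \<open>Instead of \<open>a\<close>, the total width \<open>p = m a\<close> of the contracting
  columns serves as parameter; every \<open>p\<close> in (0,1) occurs.\<close>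

locale heterochaos =
  fixes m :: nat and p :: real
  assumes m2: "2 \<le> m" and p: "0 < p" "p < 1"
begin

lemma m: "0 < m"
  using m2 by simp

text \<open>The planar baker map in digit form: on the left the column number
  \<open>dig m (x / p)\<close> is pushed onto \<open>y\<close>, on the right the first digit of
  \<open>y\<close> is dropped.\<close>

definition hmap :: "real \<times> real \<Rightarrow> real \<times> real" where
  "hmap z = (if fst z < p then (sig m (fst z / p), (snd z + real (dig m (fst z / p))) / real m)
             else ((fst z - p) / (1 - p), sig m (snd z)))"

lemma measurable_hmap[measurable]: "hmap \<in> measurable borel borel"
  unfolding hmap_def borel_prod[symmetric] by measurable

text \<open>The Perron-Frobenius operator of \<open>hmap\<close>. A point has one preimage on the
  left, in the column named by the first digit of its second coordinate, and m on the right, one for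
  each dropped digit. The weights \<open>p\<close> and \<open>(1 - p) / m\<close> are the inverse
  Jacobians.\<close>

definition tr :: "(real \<times> real \<Rightarrow> real) \<Rightarrow> real \<times> real \<Rightarrow> real" where
  "tr h z = p * h (p * ((fst z + real (dig m (snd z))) / real m), sig m (snd z))
      + (1 - p) * ((\<Sum>i<m. h (p + (1 - p) * fst z, (snd z + real i) / real m)) / real m)"

lemma bb_tr_aux:
  assumes "bounded_borel h"
  shows "bounded_borel (\<lambda>z. h (p * ((fst z + real (dig m (snd z))) / real m), sig m (snd z)))"
    "bounded_borel (\<lambda>z. h (p + (1 - p) * fst z, (snd z + real i) / real m))"
    "bounded_borel (\<lambda>z. h (p * ((fst z + real i) / real m), snd z))"
    "bounded_borel (\<lambda>z. h (p + (1 - p) * fst z, snd z))"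
    "bounded_borel (\<lambda>z. h (p * fst z, snd z))"
  by (rule bb_comp[OF assms]; unfold borel_prod[symmetric]; measurable)+

lemma bb_tr[bb_intros]: "bounded_borel h \<Longrightarrow> bounded_borel (tr h)"
  unfolding tr_def[abs_def] by (intro bb_add bb_cmult bb_divide bb_sum bb_tr_aux)

lemma bb_tr_funpow[bb_intros]: "bounded_borel h \<Longrightarrow> bounded_borel ((tr ^^ n) h)"
  by (induction n) (auto intro: bb_tr)

lemma bb_hmap: "bounded_borel h \<Longrightarrow> bounded_borel (\<lambda>z. h (hmap z))"
  by (rule bb_comp) auto

lemma bb_hmap_funpow: "bounded_borel h \<Longrightarrow> bounded_borel (\<lambda>z. h ((hmap ^^ n) z))"
  by (rule bb_comp) (auto intro: measurable_compose_n)

lemma integral_tr: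
  assumes h: "bounded_borel h"
  shows "integral\<^sup>L lam2 (tr h) = integral\<^sup>L lam2 h"
proof -
  let ?q = "1 - p"
  \<comment> \<open>\<open>A\<close> and \<open>B\<close> are the contributions of the left and
    right strip. \<open>C\<close> is \<open>A\<close> cut into m columns; the first summand of
    \<open>tr h\<close> yields the same \<open>C\<close> when \<open>y\<close> is split by its
    leading digit, so columns are exchanged for horizontal strips.\<close>
  define A where "A = (\<integral>z. h (p * fst z, snd z) \<partial>lam2)"
  define B where "B = (\<integral>z. h (p + ?q * fst z, snd z) \<partial>lam2)"
  define C where "C = (\<Sum>i<m. \<integral>z. h (p * ((fst z + real i) / real m), snd z) \<partial>lam2) / real m"
  have hy: "bounded_borel (\<lambda>x. h (x, y))" for y by (rule bb_slice2[OF h])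
  have A': "bounded_borel (\<lambda>y. \<integral>x. h (p * x, y) \<partial>lam)"
    using bb_integral_slice2[OF bb_tr_aux(5)[OF h]] by simp
  have B': "bounded_borel (\<lambda>y. \<integral>x. h (p + ?q * x, y) \<partial>lam)"
    using bb_integral_slice2[OF bb_tr_aux(4)[OF h]] by simp
  have C': "bounded_borel (\<lambda>y. \<integral>x. h (p * ((x + real i) / real m), y) \<partial>lam)" for i
    using bb_integral_slice2[OF bb_tr_aux(3)[OF h]] by simp
  have C'': "bounded_borel (\<lambda>x. \<integral>y. h (p * ((x + real i) / real m), y) \<partial>lam)" for i
    using bb_integral_slice[OF bb_tr_aux(3)[OF h]] by simp
  have "integral\<^sup>L lam2 h = (\<integral>y. p * (\<integral>x. h (p * x, y) \<partial>lam) + ?q * (\<integral>x. h (p + ?q * x, y) \<partial>lam) \<partial>lam)"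
    unfolding integral_lam2(2)[OF h] by (subst lam_integral_split2[OF hy p]) (rule refl)
  also have "\<dots> = p * A + ?q * B"
    unfolding A_def B_def integral_lam2(2)[OF bb_tr_aux(4)[OF h]] integral_lam2(2)[OF bb_tr_aux(5)[OF h]]
    using integrable_lam[OF A'] integrable_lam[OF B'] by simp
  finally have 1: "integral\<^sup>L lam2 h = p * A + ?q * B" .
  have "A = (\<integral>y. (\<Sum>i<m. \<integral>x. h (p * ((x + real i) / real m), y) \<partial>lam) / real m \<partial>lam)"
    unfolding A_def integral_lam2(2)[OF bb_tr_aux(5)[OF h]] fst_conv snd_conv
    by (subst lam_integral_split[OF bb_comp[OF hy] m]) simp_all
  also have "\<dots> = C"
    unfolding C_def integral_lam2(2)[OF bb_tr_aux(3)[OF h]] fst_conv snd_conv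
    using integrable_lam[OF C'] by (subst integral_divide_zero) (simp add: Bochner_Integration.integral_sum)
  finally have 2: "A = C" .
  have "(\<integral>z. h (p * ((fst z + real (dig m (snd z))) / real m), sig m (snd z)) \<partial>lam2)
     = (\<integral>x. (\<Sum>i<m. \<integral>y. h (p * ((x + real i) / real m), y) \<partial>lam) / real m \<partial>lam)"
    unfolding integral_lam2(1)[OF bb_tr_aux(1)[OF h]] fst_conv snd_conv
  proof (rule Bochner_Integration.integral_cong[OF refl])
    fix x
    have s: "bounded_borel (\<lambda>y. h (p * ((x + real (dig m y)) / real m), sig m y))"
      using bb_slice1[OF bb_tr_aux(1)[OF h], of x] by simp
    have "(\<integral>y. h (p * ((x + real (dig m ((y + real i) / real m))) / real m), sig m ((y + real i) / real m)) \<partial>lam)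
        = (\<integral>y. h (p * ((x + real i) / real m), y) \<partial>lam)" if "i < m" for i
      by (intro lam_integral_cong bb_comp[OF s] bb_slice1 h) (auto simp: dig_branch that)
    then show "(\<integral>y. h (p * ((x + real (dig m y)) / real m), sig m y) \<partial>lam)
      = (\<Sum>i<m. \<integral>y. h (p * ((x + real i) / real m), y) \<partial>lam) / real m"
      unfolding lam_integral_split[OF s m] by simp
  qed
  also have "\<dots> = C"
    unfolding C_def integral_lam2(1)[OF bb_tr_aux(3)[OF h]] fst_conv snd_conv
    using integrable_lam[OF C''] by (subst integral_divide_zero) (simp add: Bochner_Integration.integral_sum)
  finally have 3: "(\<integral>z. h (p * ((fst z + real (dig m (snd z))) / real m), sig m (snd z)) \<partial>lam2) = C" .
  have b: "bounded_borel (\<lambda>z. (\<Sum>i<m. h (p + ?q * fst z, (snd z + real i) / real m)) / real m)"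
    by (intro bb_divide bb_sum bb_tr_aux h)
  have 4: "(\<integral>z. (\<Sum>i<m. h (p + ?q * fst z, (snd z + real i) / real m)) / real m \<partial>lam2) = B"
    unfolding B_def integral_lam2(1)[OF bb_tr_aux(4)[OF h]] integral_lam2(1)[OF b] fst_conv snd_conv
    using integral_avg[OF bb_slice1[OF h] m] by (simp add: avg_def[abs_def])
  have "integral\<^sup>L lam2 (tr h) = p * C + ?q * B"
    unfolding tr_def[abs_def] 3[symmetric] 4[symmetric]
    by (subst Bochner_Integration.integral_add[OF integrable_lam2[OF bb_cmult[OF bb_tr_aux(1)[OF h]]]
        integrable_lam2[OF bb_cmult[OF b]]]) simp
  with 1 2 show ?thesis by simp
qed

lemma hmap_left:
  assumes "0 \<le> x" "x < 1"
  shows "p * ((x + real (dig m y)) / real m) < p"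
    "hmap (p * ((x + real (dig m y)) / real m), sig m y) = (x, y)"
proof -
  have d: "dig m y < m" using dig_less m by simp
  have "(x + real (dig m y)) / real m < 1" using assms d m by (simp add: field_simps)
  then show *: "p * ((x + real (dig m y)) / real m) < p"
    using mult_strict_left_mono[of "(x + real (dig m y)) / real m" 1 p] p by (simp only: mult_1_right)
  then show "hmap (p * ((x + real (dig m y)) / real m), sig m y) = (x, y)"
    using assms d m p by (simp add: hmap_def dig_branch dig_sig)
qed

lemma hmap_right:
  assumes "0 \<le> x" "0 \<le> y" "y < 1" "i < m"
  shows "\<not> p + (1 - p) * x < p" "hmap (p + (1 - p) * x, (y + real i) / real m) = (x, y)"
proof -
  have "0 \<le> (1 - p) * x" using assms p by simp
  then show *: "\<not> p + (1 - p) * x < p" by linarith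
  then show "hmap (p + (1 - p) * x, (y + real i) / real m) = (x, y)"
    using assms p m by (simp add: hmap_def dig_branch)
qed

text \<open>Every point at which \<open>tr\<close> samples is mapped back to \<open>z\<close>, so
  the second factor is the constant \<open>H z\<close>. With a coordinate equal to 1 the digits may
  be wrong, hence the half-open square.\<close>

lemma tr_mult_hmap:
  assumes "z \<in> {0..<1} \<times> {0..<1}"
  shows "tr (\<lambda>z. h z * H (hmap z)) z = tr h z * H z"
proof -
  obtain x y where z: "z = (x, y)" "0 \<le> x" "x < 1" "0 \<le> y" "y < 1" using assms by (cases z) auto
  show ?thesis
    using z hmap_left(2)[of x y] hmap_right(2)[of x y]
    by (simp add: tr_def algebra_simps sum_distrib_left)
qed

lemma integral_mult_hmap:
  assumes "bounded_borel h" "bounded_borel H"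
  shows "(\<integral>z. h z * H (hmap z) \<partial>lam2) = (\<integral>z. tr h z * H z \<partial>lam2)"
proof -
  have b: "bounded_borel (\<lambda>z. h z * H (hmap z))" by (intro bb_intros bb_hmap assms)
  show ?thesis
    unfolding integral_tr[OF b, symmetric]
    by (rule lam2_integral_cong) (auto intro!: bb_tr[OF b] bb_mult bb_tr assms tr_mult_hmap)
qed

lemma integral_mult_hmap_funpow:
  assumes "bounded_borel h" "bounded_borel H"
  shows "(\<integral>z. h z * H ((hmap ^^ n) z) \<partial>lam2) = (\<integral>z. (tr ^^ n) h z * H z \<partial>lam2)"
  using assms(1)
proof (induction n arbitrary: h)
  case (Suc n)
  then show ?case
    using integral_mult_hmap[OF Suc.prems bb_hmap_funpow[OF assms(2)], of n] bb_tr[OF Suc.prems]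
    by (simp add: funpow_Suc_right del: funpow.simps(2))
qed simp

lemma tr_const[simp]: "tr (\<lambda>_. c) = (\<lambda>_. c)"
  using m by (auto simp: tr_def algebra_simps)

lemma preserves_measure_hmap: "preserves_measure lam2 hmap"
  unfolding preserves_measure_def
proof
  show meas: "hmap \<in> measurable lam2 lam2" by measurable
  show "distr lam2 lam2 hmap = lam2"
  proof (rule measure_eqI)
    fix A assume "A \<in> sets (distr lam2 lam2 hmap)"
    then have A: "A \<in> sets borel" by simp
    have hA: "hmap -` A \<in> sets borel" using measurable_sets[OF measurable_hmap A] by simp
    have "measure lam2 (hmap -` A) = (\<integral>z. 1 * indicator A (hmap z) \<partial>lam2)"
      by (simp add: indicator_vimage[symmetric] lam2.emeasure_eq_measure hA)
    also have "\<dots> = measure lam2 A"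
      using A by (subst integral_mult_hmap) (auto intro: bb_intros)
    finally show "emeasure (distr lam2 lam2 hmap) A = emeasure lam2 A"
      using A by (simp add: emeasure_distr[OF meas] lam2.emeasure_eq_measure)
  qed simp
qed

lemma tr_add: "tr (\<lambda>z. f z + g z) = (\<lambda>z. tr f z + tr g z)"
  by (auto simp: tr_def sum.distrib algebra_simps add_divide_distrib)

lemma tr_cmult: "tr (\<lambda>z. c * f z) = (\<lambda>z. c * tr f z)"
  by (auto simp: tr_def sum_distrib_left[symmetric] algebra_simps)

lemma tr_funpow_const: "(tr ^^ n) (\<lambda>_. c) = (\<lambda>_. c)"
  by (induction n) auto

lemma tr_funpow_add: "(tr ^^ n) (\<lambda>z. f z + g z) = (\<lambda>z. (tr ^^ n) f z + (tr ^^ n) g z)"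
  by (induction n) (auto simp: tr_add)

lemma tr_funpow_cmult: "(tr ^^ n) (\<lambda>z. c * f z) = (\<lambda>z. c * (tr ^^ n) f z)"
  by (induction n) (auto simp: tr_cmult)

text \<open>A positive operator that preserves integrals contracts L1.\<close>

lemma integral_abs_tr_le:
  assumes "bounded_borel h"
  shows "(\<integral>z. \<bar>tr h z\<bar> \<partial>lam2) \<le> (\<integral>z. \<bar>h z\<bar> \<partial>lam2)"
proof -
  have le: "\<bar>tr h z\<bar> \<le> tr (\<lambda>z. \<bar>h z\<bar>) z" for z
  proof -
    have "\<bar>\<Sum>i<m. h (p + (1 - p) * fst z, (snd z + real i) / real m)\<bar> / real m
        \<le> (\<Sum>i<m. \<bar>h (p + (1 - p) * fst z, (snd z + real i) / real m)\<bar>) / real m"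
      by (intro divide_right_mono sum_abs) auto
    then have "\<bar>(\<Sum>i<m. h (p + (1 - p) * fst z, (snd z + real i) / real m)) / real m\<bar>
        \<le> (\<Sum>i<m. \<bar>h (p + (1 - p) * fst z, (snd z + real i) / real m)\<bar>) / real m"
      by simp
    then have "\<bar>(1 - p) * ((\<Sum>i<m. h (p + (1 - p) * fst z, (snd z + real i) / real m)) / real m)\<bar>
        \<le> (1 - p) * ((\<Sum>i<m. \<bar>h (p + (1 - p) * fst z, (snd z + real i) / real m)\<bar>) / real m)"
      unfolding abs_mult[of "1 - p"] using p by (intro mult_mono) auto
    then show ?thesis
      unfolding tr_def using p by (intro order_trans[OF abs_triangle_ineq] add_mono) (auto simp: abs_mult)
  qed
  have "(\<integral>z. \<bar>tr h z\<bar> \<partial>lam2) \<le> (\<integral>z. tr (\<lambda>z. \<bar>h z\<bar>) z \<partial>lam2)"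
    by (intro integral_mono integrable_lam2 bb_abs bb_tr assms le)
  then show ?thesis using integral_tr[OF bb_abs[OF assms]] by simp
qed

section \<open>Asymptotic L1 deviation from the mean\<close>

definition dev :: "nat \<Rightarrow> (real \<times> real \<Rightarrow> real) \<Rightarrow> real" where
  "dev n h = (\<integral>z. \<bar>(tr ^^ n) h z - integral\<^sup>L lam2 h\<bar> \<partial>lam2)"

text \<open>On bounded Borel functions the limit exists, since \<open>dev n h\<close> decreases in
  \<open>n\<close>. It is a seminorm that ignores constants, is invariant under \<open>tr\<close>
  and is dominated by twice the L1 norm; exactness means that it vanishes, and these properties are
  all that is used to show it.\<close>

definition dev_lim :: "(real \<times> real \<Rightarrow> real) \<Rightarrow> real" where
  "dev_lim h = lim (\<lambda>n. dev n h)"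

lemma dev_nonneg: "0 \<le> dev n h"
  by (simp add: dev_def)

lemma dev_LIMSEQ:
  assumes h: "bounded_borel h"
  shows "(\<lambda>n. dev n h) \<longlonglongrightarrow> dev_lim h"
proof -
  have "dev (Suc n) h \<le> dev n h" for n
  proof -
    let ?c = "integral\<^sup>L lam2 h"
    have "(tr ^^ Suc n) h z - ?c = tr (\<lambda>z. (tr ^^ n) h z + - ?c) z" for z
      unfolding tr_add by simp
    then show ?thesis
      unfolding dev_def using integral_abs_tr_le[of "\<lambda>z. (tr ^^ n) h z + - ?c"]
      by (simp add: bb_intros h del: funpow.simps)
  qed
  then have "decseq (\<lambda>n. dev n h)" by (rule decseq_SucI)
  then have "convergent (\<lambda>n. dev n h)"
    using dev_nonneg decseq_convergent[of "\<lambda>n. dev n h" 0] unfolding convergent_def by metis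
  then show ?thesis unfolding dev_lim_def by (simp add: convergent_LIMSEQ_iff)
qed

lemma dev_lim_nonneg: "bounded_borel h \<Longrightarrow> 0 \<le> dev_lim h"
  by (rule LIMSEQ_le_const[OF dev_LIMSEQ]) (auto simp: dev_nonneg)

lemma dev_lim_add:
  assumes "bounded_borel f" "bounded_borel g"
  shows "dev_lim (\<lambda>z. f z + g z) \<le> dev_lim f + dev_lim g"
proof (rule LIMSEQ_le[OF dev_LIMSEQ tendsto_add[OF dev_LIMSEQ dev_LIMSEQ]])
  have "dev n (\<lambda>z. f z + g z) \<le> dev n f + dev n g" for n
  proof -
    have i: "integrable lam2 f" "integrable lam2 g" using assms integrable_lam2 by auto
    have b: "bounded_borel (\<lambda>z. (tr ^^ n) f z - integral\<^sup>L lam2 f)" "bounded_borel (\<lambda>z. (tr ^^ n) g z - integral\<^sup>L lam2 g)"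
      by (intro bb_intros assms)+
    have "dev n (\<lambda>z. f z + g z) \<le> (\<integral>z. \<bar>(tr ^^ n) f z - integral\<^sup>L lam2 f\<bar> + \<bar>(tr ^^ n) g z - integral\<^sup>L lam2 g\<bar> \<partial>lam2)"
      unfolding dev_def tr_funpow_add Bochner_Integration.integral_add[OF i]
      by (intro integral_mono integrable_lam2 bb_intros assms) auto
    also have "\<dots> = dev n f + dev n g"
      unfolding dev_def by (intro Bochner_Integration.integral_add integrable_lam2 bb_abs b)
    finally show ?thesis .
  qed
  then show "\<exists>N. \<forall>n\<ge>N. dev n (\<lambda>z. f z + g z) \<le> dev n f + dev n g" by blast
qed (intro bb_intros assms)+

lemma dev_lim_const: "dev_lim (\<lambda>_. c) = 0"
  by (simp add: dev_lim_def dev_def tr_funpow_const lam2.prob_space)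

lemma dev_lim_cmult:
  assumes "bounded_borel f"
  shows "dev_lim (\<lambda>z. c * f z) = \<bar>c\<bar> * dev_lim f"
proof (rule LIMSEQ_unique[OF dev_LIMSEQ])
  have "dev n (\<lambda>z. c * f z) = \<bar>c\<bar> * dev n f" for n
    by (simp add: dev_def tr_funpow_cmult right_diff_distrib[symmetric] abs_mult)
  then show "(\<lambda>n. dev n (\<lambda>z. c * f z)) \<longlonglongrightarrow> \<bar>c\<bar> * dev_lim f"
    by (simp add: tendsto_mult_left dev_LIMSEQ assms)
qed (intro bb_intros assms)

lemma dev_lim_sum:
  assumes "\<And>i. i \<in> I \<Longrightarrow> bounded_borel (f i)"
  shows "dev_lim (\<lambda>z. \<Sum>i\<in>I. f i z) \<le> (\<Sum>i\<in>I. dev_lim (f i))"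
  using assms
proof (induction I rule: infinite_finite_induct)
  case (insert i I)
  then have "dev_lim (\<lambda>z. f i z + (\<Sum>i\<in>I. f i z)) \<le> dev_lim (f i) + dev_lim (\<lambda>z. \<Sum>i\<in>I. f i z)"
    by (intro dev_lim_add bb_sum) auto
  with insert show ?case by auto
qed (auto simp: dev_lim_const)

lemma dev_lim_tr:
  assumes "bounded_borel f"
  shows "dev_lim (tr f) = dev_lim f"
proof (rule LIMSEQ_unique[OF dev_LIMSEQ])
  have "dev n (tr f) = dev (Suc n) f" for n
    by (simp add: dev_def integral_tr[OF assms] funpow_Suc_right del: funpow.simps(2))
  then show "(\<lambda>n. dev n (tr f)) \<longlonglongrightarrow> dev_lim f"
    using LIMSEQ_Suc[OF dev_LIMSEQ[OF assms]] by simp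
qed (intro bb_intros assms)

lemma dev_lim_le:
  assumes "bounded_borel f"
  shows "dev_lim f \<le> 2 * (\<integral>z. \<bar>f z\<bar> \<partial>lam2)"
proof -
  have le: "dev n f \<le> 2 * (\<integral>z. \<bar>f z\<bar> \<partial>lam2)" for n
  proof -
    have 1: "(\<integral>z. \<bar>(tr ^^ n) f z\<bar> \<partial>lam2) \<le> (\<integral>z. \<bar>f z\<bar> \<partial>lam2)"
      by (induction n) (auto intro: order_trans[OF integral_abs_tr_le] bb_tr_funpow assms)
    have "dev n f \<le> (\<integral>z. \<bar>(tr ^^ n) f z\<bar> + \<bar>integral\<^sup>L lam2 f\<bar> \<partial>lam2)"
      unfolding dev_def by (intro integral_mono integrable_lam2 bb_intros assms) auto
    also have "\<dots> = (\<integral>z. \<bar>(tr ^^ n) f z\<bar> \<partial>lam2) + \<bar>integral\<^sup>L lam2 f\<bar>"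
      by (subst Bochner_Integration.integral_add)
        (auto intro!: integrable_lam2 bb_abs bb_tr_funpow assms simp: lam2.prob_space)
    finally show ?thesis using 1 integral_abs_bound[of lam2 f] by linarith
  qed
  then show ?thesis by (intro LIMSEQ_le_const2[OF dev_LIMSEQ[OF assms]]) auto
qed

text \<open>All sampling points of \<open>tr\<close> lie in the half-open square when
  \<open>z\<close> does. Identities that hold only off the boundary can thus be iterated pointwise,
  without null sets.\<close>

lemma tr_cong:
  assumes "z \<in> {0..<1} \<times> {0..<1}" "\<And>w. w \<in> {0..<1} \<times> {0..<1} \<Longrightarrow> f w = g w"
  shows "tr f z = tr g z"
proof -
  obtain x y where z: "z = (x, y)" "0 \<le> x" "x < 1" "0 \<le> y" "y < 1" using assms by (cases z) auto
  have b: "0 \<le> (t + real i) / real m" "(t + real i) / real m < 1" if "0 \<le> t" "t < 1" "i < m" for t i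
  proof -
    have "t + real i < real m" using that by linarith
    then show "0 \<le> (t + real i) / real m" "(t + real i) / real m < 1" using that m by auto
  qed
  have 1: "(p * ((x + real (dig m y)) / real m), sig m y) \<in> {0..<1} \<times> {0..<1}"
  proof -
    have "p * ((x + real (dig m y)) / real m) < 1 * 1"
      using b[of x "dig m y"] z p dig_less[OF m] by (intro mult_strict_mono) auto
    then show ?thesis using b[of x "dig m y"] z p dig_less[OF m] sig_bounds[OF m, of y] by auto
  qed
  have 2: "(p + (1 - p) * x, (y + real i) / real m) \<in> {0..<1} \<times> {0..<1}" if "i < m" for i
  proof -
    have "(1 - p) * x < (1 - p) * 1" using z p by (intro mult_strict_left_mono) auto
    then have "p + (1 - p) * x < 1" by simp
    moreover have "0 \<le> (1 - p) * x" using z p by simp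
    ultimately show ?thesis using b[of y i] z p that by auto
  qed
  show ?thesis using assms(2)[OF 1] assms(2)[OF 2] by (simp add: tr_def z)
qed

lemma tr_funpow_cong:
  assumes "z \<in> {0..<1} \<times> {0..<1}" "\<And>w. w \<in> {0..<1} \<times> {0..<1} \<Longrightarrow> f w = g w"
  shows "(tr ^^ n) f z = (tr ^^ n) g z"
  using assms(1) by (induction n arbitrary: z) (auto intro: tr_cong assms(2))

lemma dev_lim_cong:
  assumes "bounded_borel f" "bounded_borel g" "\<And>w. w \<in> {0..<1} \<times> {0..<1} \<Longrightarrow> f w = g w"
  shows "dev_lim f = dev_lim g"
proof -
  have int_eq: "integral\<^sup>L lam2 f = integral\<^sup>L lam2 g" by (rule lam2_integral_cong[OF assms])
  have "dev n f = dev n g" for n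
    unfolding dev_def
    by (intro lam2_integral_cong bb_intros assms) (simp only: tr_funpow_cong[OF _ assms(3)] int_eq)
  then show ?thesis by (simp add: dev_lim_def)
qed

lemma tr_snd: "tr (\<lambda>z. f (snd z)) = (\<lambda>z. p * f (sig m (snd z)) + (1 - p) * avg m f (snd z))"
  by (auto simp: tr_def avg_def)

end

section \<open>Functions of the second coordinate\<close>

lemma bb_sig_funpow: "bounded_borel f \<Longrightarrow> bounded_borel (\<lambda>x. f ((sig m ^^ k) x))"
  by (rule bb_comp) (auto intro: measurable_compose_n)

lemma integral_sig_funpow:
  assumes "bounded_borel f" "0 < m"
  shows "(\<integral>x. f ((sig m ^^ k) x) \<partial>lam) = integral\<^sup>L lam f"
proof (induction k)
  case (Suc k)
  then show ?case
    using integral_sig[OF bb_sig_funpow[OF assms(1)] assms(2), of k m]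
    by (simp add: funpow_Suc_right del: funpow.simps(2))
qed simp

lemma avg_sig:
  assumes "0 < m" "0 \<le> y" "y < 1"
  shows "avg m (\<lambda>x. f (sig m x)) y = f y"
  using assms by (simp add: avg_def dig_branch)

text \<open>With \<open>k < l\<close>, invariance of the measure removes the first \<open>k\<close>
  shifts from both factors; one of the remaining shifts is then moved to the other side, where U*
  annihilates \<open>f\<close>.\<close>

lemma integral_kernel_avg_orthogonal:
  assumes f: "bounded_borel f" and m: "0 < m" and ker: "\<And>y. 0 \<le> y \<Longrightarrow> y < 1 \<Longrightarrow> avg m f y = 0"
  shows "(\<integral>x. f ((sig m ^^ k) x) * f ((sig m ^^ l) x) \<partial>lam) = (if k = l then \<integral>x. (f x)\<^sup>2 \<partial>lam else 0)"
proof -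
  have *: "(\<integral>x. f ((sig m ^^ k) x) * f ((sig m ^^ l) x) \<partial>lam) = 0" if kl: "k < l" for k l
  proof -
    obtain r where r: "l = Suc r + k" using kl by (metis add.commute less_iff_Suc_add add_Suc_right add_Suc)
    have "(\<integral>x. f ((sig m ^^ k) x) * f ((sig m ^^ l) x) \<partial>lam)
        = (\<integral>x. f ((sig m ^^ k) x) * f ((sig m ^^ Suc r) ((sig m ^^ k) x)) \<partial>lam)"
      unfolding r funpow_add by simp
    also have "\<dots> = (\<integral>x. f x * f ((sig m ^^ Suc r) x) \<partial>lam)"
      by (rule integral_sig_funpow) (intro bb_mult bb_sig_funpow f m)+
    also have "\<dots> = (\<integral>x. f ((sig m ^^ r) (sig m x)) * f x \<partial>lam)"
      by (simp add: funpow_Suc_right mult.commute del: funpow.simps(2))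
    also have "\<dots> = (\<integral>x. f ((sig m ^^ r) x) * avg m f x \<partial>lam)"
      by (rule integral_sig_mult) (intro bb_sig_funpow f m)+
    also have "\<dots> = (\<integral>x. 0 \<partial>lam)"
      by (intro lam_integral_cong bb_intros bb_sig_funpow f) (simp add: ker)
    finally show ?thesis by simp
  qed
  show ?thesis
  proof (cases k l rule: linorder_cases)
    case equal
    then show ?thesis
      using integral_sig_funpow[OF bb_mult[OF f f] m] by (simp add: power2_eq_square)
  next
    case greater
    then show ?thesis using *[of l k] by (simp add: mult.commute)
  qed (use * in auto)
qed

lemma (in prob_space) integral_abs_square_le:
  fixes f :: "'a \<Rightarrow> real"
  assumes "integrable M f" "integrable M (\<lambda>x. (f x)\<^sup>2)"
  shows "(\<integral>x. \<bar>f x\<bar> \<partial>M) \<le> sqrt (\<integral>x. (f x)\<^sup>2 \<partial>M)"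
proof (rule real_le_rsqrt)
  have "0 \<le> variance (\<lambda>x. \<bar>f x\<bar>)" by simp
  also have "\<dots> = (\<integral>x. (f x)\<^sup>2 \<partial>M) - (\<integral>x. \<bar>f x\<bar> \<partial>M)\<^sup>2"
    using assms by (subst variance_eq) auto
  finally show "(\<integral>x. \<bar>f x\<bar> \<partial>M)\<^sup>2 \<le> (\<integral>x. (f x)\<^sup>2 \<partial>M)" by simp
qed

context heterochaos
begin

lemma bb_snd: "bounded_borel f \<Longrightarrow> bounded_borel (\<lambda>z::real \<times> real. f (snd z))"
  by (rule bb_comp) (auto simp: borel_prod[symmetric])

text \<open>Since U* U is the identity and \<open>U* f = 0\<close>, the operator sends
  \<open>U^k f\<close> to \<open>p U^(k+1) f + (1 - p) U^(k-1) f\<close>, with no second term at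
  \<open>k = 0\<close>. The coefficients therefore obey the recursion of
  \<open>walk\<close>.\<close>

lemma tr_funpow_kernel_avg:
  assumes ker: "\<And>y. 0 \<le> y \<Longrightarrow> y < 1 \<Longrightarrow> avg m f y = 0"
    and "z \<in> {0..<1} \<times> {0..<1}"
  shows "(tr ^^ n) (\<lambda>z. f ((sig m ^^ j) (snd z))) z
      = (\<Sum>k\<le>n + j. walk p j n k * f ((sig m ^^ k) (snd z)))"
  using assms(2)
proof (induction n arbitrary: z)
  case 0
  then show ?case by (simp add: if_distrib[of "\<lambda>x. x * _"] cong: if_cong)
next
  case (Suc n)
  define y where "y = snd z"
  have y: "0 \<le> y" "y < 1" using Suc.prems by (auto simp: y_def)
  define w where "w k = walk p j n k" for k
  define g where "g k = f ((sig m ^^ k) y)" for k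
  define u where "u k = (if k = 0 then 0 else w (k - 1))" for k
  let ?N = "n + j"
  have avgk: "avg m (\<lambda>x. f ((sig m ^^ k) x)) y = (if k = 0 then 0 else g (k - 1))" for k
  proof (cases k)
    case (Suc l)
    then show ?thesis
      using avg_sig[OF m y, of "\<lambda>x. f ((sig m ^^ l) x)"] by (simp add: g_def funpow_Suc_right del: funpow.simps(2))
  qed (use ker y in simp)
  have "(tr ^^ Suc n) (\<lambda>z. f ((sig m ^^ j) (snd z))) z
      = tr (\<lambda>z. \<Sum>k\<le>?N. w k * f ((sig m ^^ k) (snd z))) z"
    using tr_cong[OF Suc.prems Suc.IH] by (simp add: w_def)
  also have "\<dots> = p * (\<Sum>k\<le>?N. w k * g (Suc k)) + (1 - p) * avg m (\<lambda>y. \<Sum>k\<le>?N. w k * f ((sig m ^^ k) y)) y"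
    by (simp add: tr_snd[of "\<lambda>y. \<Sum>k\<le>?N. w k * f ((sig m ^^ k) y)"] g_def y_def funpow_Suc_right del: funpow.simps(2))
  also have "avg m (\<lambda>y. \<Sum>k\<le>?N. w k * f ((sig m ^^ k) y)) y
      = (\<Sum>k\<le>?N. w k * avg m (\<lambda>x. f ((sig m ^^ k) x)) y)"
    unfolding avg_def by (subst sum.swap) (simp add: sum_distrib_left sum_divide_distrib)
  also have "\<dots> = (\<Sum>k\<le>?N. w k * (if k = 0 then 0 else g (k - 1)))" unfolding avgk ..
  \<comment> \<open>Two vanishing terms are appended so that, after the index shift, this sum has
    the same range as the upward one.\<close>
  also have "\<dots> = (\<Sum>k\<le>Suc (Suc ?N). w k * (if k = 0 then 0 else g (k - 1)))"
    using walk_eq_0[of n j _ p] by (intro sum.mono_neutral_left) (auto simp: w_def)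
  also have "\<dots> = (\<Sum>k\<le>Suc ?N. w (Suc k) * g k)"
    by (subst sum.atMost_Suc_shift) simp
  also have "(\<Sum>k\<le>?N. w k * g (Suc k)) = (\<Sum>k\<le>Suc ?N. u k * g k)"
    by (subst sum.atMost_Suc_shift) (simp add: u_def)
  also have "p * (\<Sum>k\<le>Suc ?N. u k * g k) + (1 - p) * (\<Sum>k\<le>Suc ?N. w (Suc k) * g k)
      = (\<Sum>k\<le>Suc ?N. (p * u k + (1 - p) * w (Suc k)) * g k)"
    unfolding sum_distrib_left sum.distrib[symmetric] by (intro sum.cong) (auto simp: algebra_simps)
  finally show ?case by (simp add: u_def w_def g_def y_def del: sum.atMost_Suc cong: if_cong)
qed

text \<open>The mean of \<open>f\<close> is 0, and L1 is bounded by L2. By orthogonality the squared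
  L2 norm of the n-th iterate is the energy of the walk times \<open>C\<close>.\<close>

lemma dev_lim_kernel_avg:
  assumes f: "bounded_borel f" and ker: "\<And>y. 0 \<le> y \<Longrightarrow> y < 1 \<Longrightarrow> avg m f y = 0"
  shows "dev_lim (\<lambda>z. f ((sig m ^^ j) (snd z))) = 0"
proof (rule LIMSEQ_unique[OF dev_LIMSEQ])
  let ?F = "\<lambda>z::real \<times> real. f ((sig m ^^ j) (snd z))"
  show bF: "bounded_borel ?F"
    using bb_snd[OF bb_sig_funpow[OF f]] by simp
  define C where "C = (\<integral>x. (f x)\<^sup>2 \<partial>lam)"
  define S where "S n = (\<Sum>k\<le>n + j. (walk p j n k)\<^sup>2)" for n
  have "integral\<^sup>L lam f = integral\<^sup>L lam (avg m f)" using integral_avg[OF f m] by simp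
  also have "\<dots> = (\<integral>x. 0 \<partial>lam)" by (intro lam_integral_cong bb_intros f) (simp add: ker)
  finally have mean: "integral\<^sup>L lam2 ?F = 0"
    using integral_lam2_snd[OF bb_sig_funpow[OF f]] integral_sig_funpow[OF f m] by simp
  have bound: "dev n ?F \<le> sqrt (S n * C)" for n
  proof -
    define h where "h y = (\<Sum>k\<le>n + j. walk p j n k * f ((sig m ^^ k) y))" for y
    have bh: "bounded_borel h"
      unfolding h_def[abs_def] by (intro bb_sum bb_cmult bb_sig_funpow f)
    have "dev n ?F = (\<integral>z. \<bar>h (snd z)\<bar> \<partial>lam2)"
      unfolding dev_def mean h_def
      by (intro lam2_integral_cong bb_intros bF bb_snd[OF bb_sig_funpow[OF f]])
        (simp_all add: tr_funpow_kernel_avg[OF ker])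
    also have "\<dots> = (\<integral>y. \<bar>h y\<bar> \<partial>lam)"
      by (rule integral_lam2_snd) (intro bb_abs bh)
    also have "\<dots> \<le> sqrt (\<integral>y. (h y)\<^sup>2 \<partial>lam)"
      by (rule lam.integral_abs_square_le) (auto intro!: integrable_lam bh bb_mult simp: power2_eq_square)
    also have "(\<integral>y. (h y)\<^sup>2 \<partial>lam)
       = (\<integral>y. (\<Sum>k\<le>n + j. \<Sum>l\<le>n + j. walk p j n k * walk p j n l * (f ((sig m ^^ k) y) * f ((sig m ^^ l) y))) \<partial>lam)"
      unfolding h_def power2_eq_square sum_product by (simp add: algebra_simps)
    also have "\<dots> = (\<Sum>k\<le>n + j. \<Sum>l\<le>n + j. walk p j n k * walk p j n l * (if k = l then C else 0))"
      unfolding C_def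
      by (simp add: integral_kernel_avg_orthogonal[OF f m ker] Bochner_Integration.integral_sum integrable_lam bb_sum bb_cmult bb_mult bb_sig_funpow f)
    also have "\<dots> = S n * C"
      by (simp add: S_def if_distrib[of "\<lambda>x. _ * x"] sum_distrib_right power2_eq_square cong: if_cong)
    finally show ?thesis .
  qed
  have "(\<lambda>n. sqrt (S n * C)) \<longlonglongrightarrow> sqrt (0 * C)"
    unfolding S_def by (intro tendsto_intros sum_walk_square_tendsto_0 p)
  then have lim: "(\<lambda>n. sqrt (S n * C)) \<longlonglongrightarrow> 0" by (simp only: mult_zero_left real_sqrt_zero)
  show "(\<lambda>n. dev n ?F) \<longlonglongrightarrow> 0"
    by (rule tendsto_sandwich[OF _ _ tendsto_const lim]) (simp_all only: dev_nonneg bound eventually_True)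
qed

text \<open>Counts the inverse branches of \<open>y\<close> that fall below \<open>c\<close>: those
  with a digit smaller than the first digit of \<open>c\<close> always do, the one with the same
  digit does if and only if \<open>y\<close> lies below the rest of \<open>c\<close>.\<close>

lemma avg_indicator_lessThan:
  assumes "0 \<le> c" "c \<le> 1" "0 \<le> y" "y < 1"
  shows "avg m (indicator {..<c}) y = real (dig m c) / real m + indicator {..<sig m c} y / real m"
proof -
  have d: "dig m c < m" using dig_less m by simp
  have "(\<Sum>i<m. indicator {..<c} ((y + real i) / real m))
      = (\<Sum>i<m. (if i < dig m c then 1 else 0) + (if i = dig m c then indicator {..<sig m c} y else 0) :: real)"
    by (intro sum.cong refl) (use less_iff_dig_sig[OF m assms(3,4,1,2)] in \<open>auto split: split_indicator\<close>)
  also have "\<dots> = real (card {i. i < m \<and> i < dig m c}) + indicator {..<sig m c} y"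
    using d by (simp add: sum.distrib sum.If_cases Int_def)
  also have "{i. i < m \<and> i < dig m c} = {..<dig m c}" using d by auto
  finally show ?thesis by (simp add: avg_def add_divide_distrib)
qed

text \<open>Subtracting from the indicator of \<open>[0, c)\<close> its part in the kernel of \<open>avg\<close> leaves a constant plus
  \<open>1 / m\<close> times a function of the same kind; hence all deviations vanish.\<close>

lemma dev_lim_lessThan:
  assumes "0 \<le> c" "c \<le> 1"
  shows "dev_lim (\<lambda>z. indicator {..<c} (snd z)) = 0"
proof -
  have bI: "bounded_borel (indicator {..<c} :: real \<Rightarrow> real)" for c
    by (rule bb_indicator) simp
  have bj: "bounded_borel (\<lambda>z::real \<times> real. indicator {..<c} ((sig m ^^ j) (snd z)))" for j c
    using bb_snd[OF bb_sig_funpow[OF bI]] by simp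
  have step: "dev_lim (\<lambda>z. indicator {..<c} ((sig m ^^ j) (snd z)))
      \<le> 1 / real m * dev_lim (\<lambda>z. indicator {..<sig m c} ((sig m ^^ Suc j) (snd z)))"
    if c: "0 \<le> c" "c \<le> 1" for c j
  proof -
    \<comment> \<open>The component \<open>f - U U* f\<close> of the indicator, annihilated by U*
      because U* U is the identity.\<close>
    define \<psi> where "\<psi> y = indicator {..<c} y - avg m (indicator {..<c}) (sig m y)" for y
    have b: "bounded_borel \<psi>"
      unfolding \<psi>_def[abs_def] by (intro bb_diff bI bb_sig bb_avg)
    have "avg m \<psi> y = 0" if "0 \<le> y" "y < 1" for y
    proof -
      have "avg m \<psi> y = avg m (indicator {..<c}) y - avg m (\<lambda>x. avg m (indicator {..<c}) (sig m x)) y"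
        unfolding \<psi>_def by (subst (1 2 4) avg_def) (simp only: sum_subtractf diff_divide_distrib)
      then show ?thesis using avg_sig[OF m that, of "avg m (indicator {..<c})"] by simp
    qed
    then have \<psi>0: "dev_lim (\<lambda>z. \<psi> ((sig m ^^ j) (snd z))) = 0"
      by (rule dev_lim_kernel_avg[OF b])
    have sigj: "0 \<le> (sig m ^^ k) y \<and> (sig m ^^ k) y < 1" if "0 \<le> y" "y < 1" for y k
      using that by (induction k) (auto intro: sig_bounds[OF m])
    let ?k = "real (dig m c) / real m"
    let ?g = "\<lambda>z::real \<times> real. 1 / real m * indicator {..<sig m c} ((sig m ^^ Suc j) (snd z))"
    have bg: "bounded_borel ?g" by (intro bb_cmult bj)
    have b\<psi>: "bounded_borel (\<lambda>z::real \<times> real. \<psi> ((sig m ^^ j) (snd z)))"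
      using bb_snd[OF bb_sig_funpow[OF b]] by simp
    have "dev_lim (\<lambda>z. indicator {..<c} ((sig m ^^ j) (snd z)))
        = dev_lim (\<lambda>z. \<psi> ((sig m ^^ j) (snd z)) + (?k + ?g z))"
    proof (rule dev_lim_cong)
      fix w :: "real \<times> real" assume "w \<in> {0..<1} \<times> {0..<1}"
      then have "0 \<le> (sig m ^^ Suc j) (snd w) \<and> (sig m ^^ Suc j) (snd w) < 1"
        by (intro sigj) auto
      then show "indicator {..<c} ((sig m ^^ j) (snd w)) = \<psi> ((sig m ^^ j) (snd w)) + (?k + ?g w)"
        using avg_indicator_lessThan[OF c] by (simp add: \<psi>_def)
    qed (intro bj bb_add b\<psi> bb_const bg)+
    also have "\<dots> \<le> dev_lim (\<lambda>z. \<psi> ((sig m ^^ j) (snd z))) + dev_lim (\<lambda>z. ?k + ?g z)"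
      by (intro dev_lim_add bb_add bb_const b\<psi> bg)
    also have "\<dots> \<le> 0 + (dev_lim (\<lambda>_. ?k) + dev_lim ?g)"
      unfolding \<psi>0 by (intro add_left_mono dev_lim_add bb_const bg)
    also have "\<dots> = 1 / real m * dev_lim (\<lambda>z. indicator {..<sig m c} ((sig m ^^ Suc j) (snd z)))"
      unfolding dev_lim_const dev_lim_cmult[OF bj] by simp
    finally show ?thesis .
  qed
  \<comment> \<open>\<open>step\<close> replaces \<open>c\<close> by \<open>sig m c\<close> and
    \<open>j\<close> by \<open>Suc j\<close>, so both vary in the induction; the start is the bound
    2 for a function with values in [0,1].\<close>
  have all: "dev_lim (\<lambda>z. indicator {..<c} ((sig m ^^ j) (snd z))) \<le> 2 * (1 / real m) ^ d"
    if "0 \<le> c" "c \<le> 1" for c j d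
    using that
  proof (induction d arbitrary: c j)
    case 0
    have "(\<integral>z. \<bar>indicat_real {..<c} ((sig m ^^ j) (snd z))\<bar> \<partial>lam2) \<le> (\<integral>z. 1 \<partial>lam2)"
      by (intro integral_mono integrable_lam2 bb_abs bj bb_const) (auto split: split_indicator)
    then show ?case using dev_lim_le[OF bj, of c j] by simp
  next
    case (Suc d)
    have "dev_lim (\<lambda>z. indicator {..<sig m c} ((sig m ^^ Suc j) (snd z))) \<le> 2 * (1 / real m) ^ d"
      using sig_bounds[OF m] Suc.prems by (intro Suc.IH) auto
    then have "1 / real m * dev_lim (\<lambda>z. indicator {..<sig m c} ((sig m ^^ Suc j) (snd z)))
        \<le> 1 / real m * (2 * (1 / real m) ^ d)"
      by (intro mult_left_mono) auto
    with step[OF Suc.prems, of j] show ?case by simp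
  qed
  have "(\<lambda>d. 2 * (1 / real m) ^ d) \<longlonglongrightarrow> 2 * 0"
    using m2 by (intro tendsto_mult tendsto_const LIMSEQ_power_zero) auto
  then have lim: "(\<lambda>d. 2 * (1 / real m) ^ d) \<longlonglongrightarrow> 0" by simp
  have "dev_lim (\<lambda>z. indicator {..<c} (snd z)) \<le> 0"
    by (rule LIMSEQ_le_const[OF lim]) (use all[OF assms, of 0] in auto)
  then show ?thesis using dev_lim_nonneg[OF bj[of c 0]] by simp
qed

end

section \<open>Uniform mixing of the two-dimensional map\<close>

lemma Times_borel: "I \<in> sets borel \<Longrightarrow> J \<in> sets borel \<Longrightarrow> I \<times> J \<in> sets borel"
  for I :: "'a::second_countable_topology set" and J :: "'b::second_countable_topology set"
  by (subst borel_prod[symmetric]) (rule pair_measureI)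

lemma sets_borel_prod:
  "sets (borel :: ('a::second_countable_topology \<times> 'b::second_countable_topology) measure)
    = sigma_sets UNIV {a \<times> b | a b. a \<in> sets borel \<and> b \<in> sets borel}"
  by (subst borel_prod[symmetric]) (simp add: sets_pair_measure)

lemma sets_borel_lessThan: "sets (borel :: real measure) = sigma_sets UNIV (range lessThan)"
proof -
  have 1: "sets (borel :: real measure) = sigma_sets UNIV (range (\<lambda>a::real. {x. eucl_less x a}))"
    by (subst borel_eq_lessThan) (simp add: sets_measure_of)
  have 2: "(\<lambda>a::real. {x. eucl_less x a}) = lessThan" by (auto simp: eucl_less_def)
  show ?thesis unfolding 1 2 ..
qed

lemma Int_stable_lessThan: "Int_stable (range (lessThan :: real \<Rightarrow> real set))"
proof (clarsimp simp: Int_stable_def)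
  fix a b :: real
  have "{..<a} \<inter> {..<b} = {..<min a b}" by auto
  then show "{..<a} \<inter> {..<b} \<in> range lessThan" by blast
qed

section \<open>Sets with vanishing deviation and exactness of the planar map\<close>

context heterochaos
begin

text \<open>These sets form a Dynkin system, which reduces exactness to generators.\<close>

definition dev_null :: "(real \<times> real) set \<Rightarrow> bool" where
  "dev_null A \<longleftrightarrow> A \<in> sets borel \<and> dev_lim (indicator A) = 0"

lemma dev_null_const: "dev_null {}" "dev_null UNIV"
proof -
  have "(indicator {} :: real \<times> real \<Rightarrow> real) = (\<lambda>_. 0)" "(indicator UNIV :: real \<times> real \<Rightarrow> real) = (\<lambda>_. 1)"
    by auto
  then show "dev_null {}" "dev_null UNIV" by (simp_all add: dev_null_def dev_lim_const)
qed

lemma dev_null_Diff: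
  assumes "dev_null A" "dev_null B" "A \<subseteq> B"
  shows "dev_null (B - A)"
proof -
  have b: "bounded_borel (indicator A :: _ \<Rightarrow> real)" "bounded_borel (indicator B :: _ \<Rightarrow> real)"
    and D: "B - A \<in> sets borel"
    using assms by (auto simp: dev_null_def bb_indicator)
  have "(indicator (B - A) :: _ \<Rightarrow> real) = (\<lambda>z. indicator B z + - 1 * indicator A z)"
    using assms(3) by (auto simp: fun_eq_iff split: split_indicator)
  then have "dev_lim (indicator (B - A)) \<le> dev_lim (indicator B) + dev_lim (\<lambda>z. - 1 * indicator A z)"
    using dev_lim_add[OF b(2) bb_cmult[OF b(1), of "-1"]] by simp
  also have "\<dots> = 0" using assms unfolding dev_lim_cmult[OF b(1)] by (simp add: dev_null_def)
  finally show ?thesis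
    using dev_lim_nonneg[OF bb_indicator[OF D]] D by (simp add: dev_null_def)
qed

text \<open>Finitely many members contribute nothing by subadditivity, and the tail
  \<open>R n\<close> contributes at most twice its measure, which tends to 0.\<close>

lemma dev_null_UN:
  assumes dj: "disjoint_family A" and A: "\<And>i::nat. dev_null (A i)"
  shows "dev_null (\<Union>i. A i)"
proof -
  have Ab: "A i \<in> sets borel" for i using A by (simp add: dev_null_def)
  have UB: "(\<Union>i. A i) \<in> sets borel" using Ab by auto
  define R where "R n = (\<Union>i. A i) - (\<Union>i<n. A i)" for n
  have RB: "R n \<in> sets borel" for n unfolding R_def using UB Ab by auto
  have le: "dev_lim (indicator (\<Union>i. A i)) \<le> 2 * measure lam2 (R n)" for n
  proof -
    have ind: "(indicator (\<Union>i. A i) :: _ \<Rightarrow> real) = (\<lambda>z. (\<Sum>i<n. indicator (A i) z) + indicator (R n) z)"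
    proof
      fix z
      have "(indicator (\<Union>i<n. A i) z :: real) = (\<Sum>i<n. indicator (A i) z)"
        using dj by (intro indicator_UN_disjoint) (auto simp: disjoint_family_on_def)
      moreover have "(indicator (\<Union>i. A i) z :: real) = indicator (\<Union>i<n. A i) z + indicator (R n) z"
        by (auto simp: R_def split: split_indicator)
      ultimately show "(indicator (\<Union>i. A i) z :: real) = (\<Sum>i<n. indicator (A i) z) + indicator (R n) z" by simp
    qed
    have "dev_lim (indicator (\<Union>i. A i)) \<le> dev_lim (\<lambda>z. \<Sum>i<n. indicator (A i) z) + dev_lim (indicator (R n))"
      unfolding ind by (intro dev_lim_add bb_sum bb_indicator Ab RB)
    also have "dev_lim (\<lambda>z. \<Sum>i<n. indicator (A i) z) \<le> (\<Sum>i<n. dev_lim (indicator (A i)))"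
      by (intro dev_lim_sum bb_indicator Ab)
    also have "(\<Sum>i<n. dev_lim (indicator (A i))) = 0" using A by (simp add: dev_null_def)
    also have "dev_lim (indicator (R n)) \<le> 2 * (\<integral>z. \<bar>indicator (R n) z\<bar> \<partial>lam2)"
      by (intro dev_lim_le bb_indicator RB)
    finally show ?thesis using RB by simp
  qed
  have mR: "measure lam2 (R n) = measure lam2 (\<Union>i. A i) - (\<Sum>i<n. measure lam2 (A i))" for n
  proof -
    have "measure lam2 (\<Union>i<n. A i) = (\<Sum>i<n. measure lam2 (A i))"
      using Ab dj by (intro lam2.finite_measure_finite_Union) (auto simp: disjoint_family_on_def)
    then show ?thesis
      unfolding R_def using UB Ab by (subst lam2.finite_measure_Diff) auto
  qed
  have "(\<lambda>n. \<Sum>i<n. measure lam2 (A i)) \<longlonglongrightarrow> measure lam2 (\<Union>i. A i)"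
    using lam2.finite_measure_UNION[of A] Ab dj by (auto simp: sums_def)
  then have "(\<lambda>n. 2 * measure lam2 (R n)) \<longlonglongrightarrow> 2 * (measure lam2 (\<Union>i. A i) - measure lam2 (\<Union>i. A i))"
    unfolding mR by (intro tendsto_intros)
  then have lim: "(\<lambda>n. 2 * measure lam2 (R n)) \<longlonglongrightarrow> 0" by simp
  have "dev_lim (indicator (\<Union>i. A i)) \<le> 0"
    by (rule LIMSEQ_le_const[OF lim]) (use le in auto)
  then show ?thesis
    using dev_lim_nonneg[OF bb_indicator[OF UB]] UB by (simp add: dev_null_def)
qed

text \<open>Dynkin's theorem relative to a set \<open>K\<close> and pulled back along
  \<open>h\<close>, so that one statement serves the second coordinate, the first coordinate inside
  a strip, and rectangles.\<close>

lemma dev_null_sigma_sets: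
  assumes G: "Int_stable G" and K: "dev_null K"
    and base: "\<And>B. B \<in> G \<Longrightarrow> dev_null (h -` B \<inter> K)"
    and B: "B \<in> sigma_sets UNIV G"
  shows "dev_null (h -` B \<inter> K)"
  using G subset_UNIV[of G, folded Pow_UNIV] B
proof (induction rule: sigma_sets_induct_disjoint)
  case (basic A)
  then show ?case by (rule base)
next
  case empty
  then show ?case by (simp add: dev_null_const)
next
  case (compl A)
  have "h -` (UNIV - A) \<inter> K = K - (h -` A \<inter> K)" by auto
  then show ?case using dev_null_Diff[OF compl(2) K] by simp
next
  case (union A)
  have "dev_null (\<Union>i. h -` A i \<inter> K)"
    using union by (intro dev_null_UN) (auto simp: disjoint_family_on_def)
  moreover have "h -` \<Union> (range A) \<inter> K = (\<Union>i. h -` A i \<inter> K)" by auto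
  ultimately show ?case by simp
qed

lemma dev_null_cong_const:
  assumes "A \<in> sets borel" "\<And>z. z \<in> {0..<1} \<times> {0..<1} \<Longrightarrow> indicator A z = (c :: real)"
  shows "dev_null A"
  using assms dev_lim_cong[OF bb_indicator[OF assms(1)] bb_const assms(2)] dev_lim_const[of c]
  by (simp add: dev_null_def)

lemma dev_null_UNIV_Times:
  assumes "J \<in> sets borel"
  shows "dev_null (UNIV \<times> J)"
proof -
  have "dev_null (snd -` J \<inter> UNIV)"
  proof (rule dev_null_sigma_sets[OF Int_stable_lessThan dev_null_const(2)])
    show "J \<in> sigma_sets UNIV (range lessThan)" using assms by (simp add: sets_borel_lessThan)
  next
    fix B :: "real set" assume "B \<in> range lessThan"
    then obtain c where c: "B = {..<c}" by auto
    have "snd -` B \<inter> UNIV = (UNIV :: real set) \<times> {..<c}" using c by auto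
    moreover have meas: "UNIV \<times> {..<c} \<in> sets (borel :: (real \<times> real) measure)" by (intro Times_borel) auto
    moreover have "dev_null (UNIV \<times> {..<c})"
    proof -
      consider "c < 0" | "0 \<le> c" "c \<le> 1" | "1 < c" by linarith
      then show ?thesis
      proof cases
        case 1
        then show ?thesis by (intro dev_null_cong_const[OF meas, of 0]) auto
      next
        case 2
        have "(indicator (UNIV \<times> {..<c}) :: real \<times> real \<Rightarrow> real) = (\<lambda>z. indicator {..<c} (snd z))"
          by (auto split: split_indicator)
        then show ?thesis using dev_lim_lessThan[OF 2] meas by (simp add: dev_null_def)
      next
        case 3
        then show ?thesis by (intro dev_null_cong_const[OF meas, of 1]) auto
      qed
    qed
    ultimately show "dev_null (snd -` B \<inter> UNIV)" by simp
  qed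
  moreover have "snd -` J \<inter> UNIV = (UNIV :: real set) \<times> J" by auto
  ultimately show ?thesis by simp
qed

text \<open>Applying \<open>tr\<close> to a strip \<open>[0, c) \<times> J\<close> leaves a function of the second coordinate plus a strip of
  the same kind with weight at most \<open>max p (1 - p)\<close>.\<close>

lemma tr_strip_left:
  assumes c: "0 \<le> c" "c < p" and z: "z \<in> {0..<1} \<times> {0..<1}"
  shows "tr (indicator ({..<c} \<times> J)) z
    = p * indicator (UNIV \<times> {y. dig m y < dig m (c / p) \<and> sig m y \<in> J}) z
      + p * indicator ({..<sig m (c / p)} \<times> {y. dig m y = dig m (c / p) \<and> sig m y \<in> J}) z"
proof -
  obtain x y where xy: "z = (x, y)" "0 \<le> x" "x < 1" using z by (cases z) auto
  have t: "0 \<le> c / p" "c / p \<le> 1" using c p by auto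
  have "p * ((x + real i) / real m) < c \<longleftrightarrow> (x + real i) / real m < c / p" for i
    using p by (simp add: field_simps)
  also have "\<dots> i \<longleftrightarrow> i < dig m (c / p) \<or> i = dig m (c / p) \<and> x < sig m (c / p)" for i
    using less_iff_dig_sig[OF m xy(2,3) t] by simp
  finally have *: "p * ((x + real i) / real m) < c \<longleftrightarrow> i < dig m (c / p) \<or> i = dig m (c / p) \<and> x < sig m (c / p)" for i .
  have "0 \<le> (1 - p) * x" using p xy by simp
  then have "\<not> p + (1 - p) * x < c" using c by linarith
  then show ?thesis using * by (auto simp: tr_def xy(1) split: split_indicator)
qed

text \<open>For \<open>p \<le> c\<close> every left preimage already lies below \<open>c\<close>, so
  the left term depends on the second coordinate only; the condition on the right branches is solved
  for the first coordinate.\<close>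

lemma tr_strip_right:
  assumes c: "p \<le> c" "c \<le> 1" and z: "z \<in> {0..<1} \<times> {0..<1}"
  shows "tr (indicator ({..<c} \<times> J)) z
    = p * indicator (UNIV \<times> sig m -` J) z
      + (1 - p) * ((\<Sum>i<m. indicator ({..<(c - p) / (1 - p)} \<times> (\<lambda>y. (y + real i) / real m) -` J) z) / real m)"
proof -
  obtain x y where xy: "z = (x, y)" "0 \<le> x" "x < 1" using z by (cases z) auto
  have "(x + real (dig m y)) / real m < 1"
  proof -
    have "x + real (dig m y) < real m" using xy dig_less[OF m, of y] by linarith
    then show ?thesis using m by simp
  qed
  then have "p * ((x + real (dig m y)) / real m) < p * 1"
    using p by (intro mult_strict_left_mono) auto
  then have 1: "p * ((x + real (dig m y)) / real m) < c" using c by simp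
  have 2: "p + (1 - p) * x < c \<longleftrightarrow> x < (c - p) / (1 - p)" using p by (simp add: field_simps)
  show ?thesis unfolding tr_def xy(1) fst_conv snd_conv
    using 1 by (intro arg_cong2[where f = "(+)"] arg_cong2[where f = "(*)"] arg_cong2[where f = "(/)"] sum.cong refl)
      (auto simp: 2 split: split_indicator)
qed

text \<open>\<open>dev_lim\<close> does not notice an application of \<open>tr\<close>, and the part
  depending on the second coordinate has deviation 0. What remains is one strip of weight
  \<open>p\<close>, or m strips of weight \<open>(1 - p) / m\<close>; their bases \<open>J\<close>
  change, so \<open>J\<close> is arbitrary in the induction.\<close>

lemma dev_lim_strip:
  assumes "0 \<le> c" "c \<le> 1" "J \<in> sets borel"
  shows "dev_lim (indicator ({..<c} \<times> J)) \<le> 2 * max p (1 - p) ^ d"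
  using assms
proof (induction d arbitrary: c J)
  case 0
  have b: "bounded_borel (indicator ({..<c} \<times> J) :: _ \<Rightarrow> real)"
    by (intro bb_indicator Times_borel 0) auto
  have "(\<integral>z. \<bar>indicat_real ({..<c} \<times> J) z\<bar> \<partial>lam2) = measure lam2 ({..<c} \<times> J)"
    using 0 by (simp add: Times_borel)
  also have "\<dots> \<le> 1" by simp
  finally have "(\<integral>z. \<bar>indicat_real ({..<c} \<times> J) z\<bar> \<partial>lam2) \<le> 1" .
  then have "dev_lim (indicator ({..<c} \<times> J)) \<le> 2" using dev_lim_le[OF b] by linarith
  then show ?case by simp
next
  case (Suc d)
  let ?r = "max p (1 - p)"
  have bT: "bounded_borel (indicator (I \<times> L) :: real \<times> real \<Rightarrow> real)" if "I \<in> sets borel" "L \<in> sets borel" for I L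
    by (intro bb_indicator Times_borel that)
  have bA: "bounded_borel (indicator ({..<c} \<times> J) :: _ \<Rightarrow> real)" using Suc.prems by (intro bT) auto
  show ?case
  proof (cases "c < p")
    case True
    let ?J1 = "{y. dig m y < dig m (c / p) \<and> sig m y \<in> J}"
    let ?J2 = "{y. dig m y = dig m (c / p) \<and> sig m y \<in> J}"
    have [measurable]: "J \<in> sets borel" by fact
    have J: "?J1 \<in> sets borel" "?J2 \<in> sets borel" by measurable
    have t: "0 \<le> sig m (c / p)" "sig m (c / p) \<le> 1"
      using sig_bounds[OF m, of "c / p"] Suc.prems True p by auto
    have "dev_lim (indicator ({..<c} \<times> J)) = dev_lim (tr (indicator ({..<c} \<times> J)))"
      by (rule dev_lim_tr[OF bA, symmetric])
    also have "\<dots> = dev_lim (\<lambda>z. p * indicator (UNIV \<times> ?J1) z + p * indicator ({..<sig m (c / p)} \<times> ?J2) z)"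
      by (intro dev_lim_cong bb_tr bA bb_add bb_cmult bT J tr_strip_left Suc.prems True) auto
    also have "\<dots> \<le> dev_lim (\<lambda>z. p * indicator (UNIV \<times> ?J1) z) + dev_lim (\<lambda>z. p * indicator ({..<sig m (c / p)} \<times> ?J2) z)"
      by (intro dev_lim_add bb_cmult bT J) auto
    also have "\<dots> = p * dev_lim (indicator (UNIV \<times> ?J1)) + p * dev_lim (indicator ({..<sig m (c / p)} \<times> ?J2))"
      using p by (subst (1 2) dev_lim_cmult) (auto intro!: bT J)
    also have "\<dots> \<le> p * 0 + ?r * (2 * ?r ^ d)"
      using dev_null_UNIV_Times[OF J(1)] p Suc.IH[OF t J(2)]
      by (intro add_mono mult_mono) (auto simp: dev_null_def intro!: dev_lim_nonneg bT J)
    finally show ?thesis by simp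
  next
    case False
    define c' where "c' = (c - p) / (1 - p)"
    have c': "0 \<le> c'" "c' \<le> 1" using Suc.prems False p by (auto simp: c'_def)
    let ?Ji = "\<lambda>i. (\<lambda>y. (y + real i) / real m) -` J"
    have J: "sig m -` J \<in> sets borel" "?Ji i \<in> sets borel" for i
      using measurable_sets[OF measurable_sig Suc.prems(3)] measurable_sets[of "\<lambda>y. (y + real i) / real m" borel borel J] Suc.prems by auto
    have bs: "bounded_borel (\<lambda>z. (\<Sum>i<m. indicat_real ({..<c'} \<times> ?Ji i) z) / real m)"
      by (intro bb_divide bb_sum bT J) auto
    have "dev_lim (indicator ({..<c} \<times> J)) = dev_lim (tr (indicator ({..<c} \<times> J)))"
      by (rule dev_lim_tr[OF bA, symmetric])
    also have "\<dots> = dev_lim (\<lambda>z. p * indicator (UNIV \<times> sig m -` J) z + (1 - p) * ((\<Sum>i<m. indicator ({..<c'} \<times> ?Ji i) z) / real m))"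
      unfolding c'_def using False
      by (intro dev_lim_cong bb_tr bA bb_add bb_cmult bT J tr_strip_right Suc.prems bs[unfolded c'_def]) auto
    also have "\<dots> \<le> dev_lim (\<lambda>z. p * indicator (UNIV \<times> sig m -` J) z) + dev_lim (\<lambda>z. (1 - p) * ((\<Sum>i<m. indicator ({..<c'} \<times> ?Ji i) z) / real m))"
      by (intro dev_lim_add bb_cmult bT J bs) auto
    also have "dev_lim (\<lambda>z. p * indicator (UNIV \<times> sig m -` J) z) = 0"
      using dev_null_UNIV_Times[OF J(1)] by (subst dev_lim_cmult) (auto simp: dev_null_def bb_indicator)
    also have "dev_lim (\<lambda>z. (1 - p) * ((\<Sum>i<m. indicator ({..<c'} \<times> ?Ji i) z) / real m))
        = (1 - p) * (1 / real m * dev_lim (\<lambda>z. \<Sum>i<m. indicator ({..<c'} \<times> ?Ji i) z))"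
      using dev_lim_cmult[OF bs, of "1 - p"] dev_lim_cmult[of "\<lambda>z. \<Sum>i<m. indicator ({..<c'} \<times> ?Ji i) z" "1 / real m"] p
      by (simp add: bb_sum bT J)
    also have "\<dots> \<le> (1 - p) * (1 / real m * (\<Sum>i<m. 2 * ?r ^ d))"
      using p by (intro mult_left_mono order_trans[OF dev_lim_sum] sum_mono Suc.IH c' J bT) auto
    also have "\<dots> = (1 - p) * (2 * ?r ^ d)" using m by simp
    also have "\<dots> \<le> ?r * (2 * ?r ^ d)" using p by (intro mult_right_mono) auto
    finally show ?thesis by simp
  qed
qed

lemma dev_null_strip:
  assumes J: "J \<in> sets borel"
  shows "dev_null ({..<c} \<times> J)"
proof -
  have meas: "{..<c} \<times> J \<in> sets borel" by (intro Times_borel J) auto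
  consider "c < 0" | "0 \<le> c" "c \<le> 1" | "1 < c" by linarith
  then show ?thesis
  proof cases
    case 1
    then show ?thesis by (intro dev_null_cong_const[OF meas, of 0]) auto
  next
    case 2
    have "(\<lambda>d. 2 * max p (1 - p) ^ d) \<longlonglongrightarrow> 2 * 0"
      using p by (intro tendsto_mult tendsto_const LIMSEQ_power_zero) auto
    then have lim: "(\<lambda>d. 2 * max p (1 - p) ^ d) \<longlonglongrightarrow> 0" by simp
    have "dev_lim (indicator ({..<c} \<times> J)) \<le> 0"
      by (rule LIMSEQ_le_const[OF lim]) (use dev_lim_strip[OF 2 J] in auto)
    then show ?thesis
      using dev_lim_nonneg[OF bb_indicator[OF meas]] meas by (simp add: dev_null_def)
  next
    case 3
    have "dev_lim (indicator ({..<c} \<times> J)) = dev_lim (indicator (UNIV \<times> J))"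
      using 3 by (intro dev_lim_cong bb_indicator meas Times_borel J) (auto split: split_indicator)
    then show ?thesis using dev_null_UNIV_Times[OF J] meas by (simp add: dev_null_def)
  qed
qed

text \<open>Exactness. Dynkin's theorem is applied in the first coordinate with \<open>J\<close>
  fixed, from strips to rectangles, and then from rectangles to Borel sets.\<close>

lemma dev_null_borel:
  assumes "A \<in> sets borel"
  shows "dev_null A"
proof -
  have rect: "dev_null (I \<times> J)" if "I \<in> sets borel" "J \<in> sets borel" for I J
  proof -
    have "dev_null (fst -` I \<inter> UNIV \<times> J)"
    proof (rule dev_null_sigma_sets[OF Int_stable_lessThan dev_null_UNIV_Times[OF that(2)]])
      show "I \<in> sigma_sets UNIV (range lessThan)" using that by (simp add: sets_borel_lessThan)
      show "dev_null (fst -` B \<inter> UNIV \<times> J)" if "B \<in> range lessThan" for B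
      proof -
        obtain c where "B = {..<c}" using \<open>B \<in> range lessThan\<close> by auto
        then have "fst -` B \<inter> UNIV \<times> J = {..<c} \<times> J" by auto
        then show ?thesis using dev_null_strip[OF \<open>J \<in> sets borel\<close>] by simp
      qed
    qed
    moreover have "fst -` I \<inter> UNIV \<times> J = I \<times> J" by auto
    ultimately show ?thesis by simp
  qed
  have "dev_null (id -` A \<inter> UNIV)"
  proof (rule dev_null_sigma_sets[OF Int_stable_pair_measure_generator[of borel borel] dev_null_const(2)])
    show "A \<in> sigma_sets UNIV {a \<times> b | a b. a \<in> sets borel \<and> b \<in> sets borel}"
      using assms by (simp add: sets_borel_prod)
  qed (use rect in auto)
  then show ?thesis by simp
qed

text \<open>By duality the error is the integral over \<open>B\<close> of the iterated density minus
  its mean, hence at most \<open>dev n (indicator A)\<close>, whatever \<open>B\<close> is.\<close>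

lemma hmap_uniformly_mixing:
  assumes A: "A \<in> sets borel" and e: "0 < e"
  shows "\<exists>N. \<forall>n\<ge>N. \<forall>B\<in>sets borel. \<bar>measure lam2 (A \<inter> (hmap ^^ n) -` B) - measure lam2 A * measure lam2 B\<bar> < e"
proof -
  have bA: "bounded_borel (indicator A :: _ \<Rightarrow> real)" by (rule bb_indicator[OF A])
  have lim: "(\<lambda>n. dev n (indicator A)) \<longlonglongrightarrow> 0"
    using dev_LIMSEQ[OF bA] dev_null_borel[OF A] by (simp add: dev_null_def)
  obtain N where N: "\<And>n. N \<le> n \<Longrightarrow> dev n (indicator A) < e"
    using order_tendstoD(2)[OF lim e] unfolding eventually_sequentially by blast
  have "\<bar>measure lam2 (A \<inter> (hmap ^^ n) -` B) - measure lam2 A * measure lam2 B\<bar> \<le> dev n (indicator A)"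
    if B: "B \<in> sets borel" for n B
  proof -
    have bB: "bounded_borel (indicator B :: _ \<Rightarrow> real)" by (rule bb_indicator[OF B])
    have hB: "(hmap ^^ n) -` B \<in> sets borel"
      using measure_vimage_funpow(1)[OF preserves_measure_hmap, of B n] B by simp
    have "measure lam2 (A \<inter> (hmap ^^ n) -` B) = (\<integral>z. indicator (A \<inter> (hmap ^^ n) -` B) z \<partial>lam2)"
      using A hB by simp
    also have "\<dots> = (\<integral>z. indicator A z * indicator B ((hmap ^^ n) z) \<partial>lam2)"
      by (intro Bochner_Integration.integral_cong) (auto split: split_indicator)
    also have "\<dots> = (\<integral>z. (tr ^^ n) (indicator A) z * indicator B z \<partial>lam2)"
      by (rule integral_mult_hmap_funpow[OF bA bB])
    finally have "measure lam2 (A \<inter> (hmap ^^ n) -` B) - measure lam2 A * measure lam2 B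
        = (\<integral>z. (tr ^^ n) (indicator A) z * indicator B z \<partial>lam2) - (\<integral>z. measure lam2 A * indicator B z \<partial>lam2)"
      using B by simp
    also have "\<dots> = (\<integral>z. ((tr ^^ n) (indicator A) z - measure lam2 A) * indicator B z \<partial>lam2)"
      by (subst Bochner_Integration.integral_diff[symmetric])
        (auto intro!: integrable_lam2 bb_mult bb_tr_funpow bb_const bA bB simp: left_diff_distrib)
    also have "\<bar>\<dots>\<bar> \<le> (\<integral>z. \<bar>((tr ^^ n) (indicator A) z - measure lam2 A) * indicator B z\<bar> \<partial>lam2)"
      by (rule integral_abs_bound)
    also have "\<dots> \<le> (\<integral>z. \<bar>(tr ^^ n) (indicator A) z - measure lam2 A\<bar> \<partial>lam2)"
      by (intro integral_mono integrable_lam2 bb_abs bb_mult bb_diff bb_tr_funpow bb_const bA bB)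
        (auto split: split_indicator)
    also have "\<dots> = dev n (indicator A)" using A by (simp add: dev_def)
    finally show ?thesis .
  qed
  then show ?thesis using N by (intro exI[of _ N]) (auto intro: le_less_trans)
qed

lemma mixing_all_orders_hmap: "mixing_all_orders lam2 hmap"
proof (rule mixing_all_orders_core[where F = "sets borel"])
  show "hmap -` A \<in> sets borel" if "A \<in> sets borel" for A
    using measurable_sets[OF measurable_hmap that] by simp
  show "\<exists>N. \<forall>n\<ge>N. \<forall>B\<in>sets borel. \<bar>measure lam2 (A \<inter> (hmap ^^ n) -` B) - measure lam2 A * measure lam2 B\<bar> < e"
    if "A \<in> sets borel" "0 < e" for A e
    using that by (rule hmap_uniformly_mixing)
  show "\<exists>n. \<exists>B\<in>sets borel. measure lam2 (sym_diff ((hmap ^^ n) -` A) B) < e" if "A \<in> sets lam2" "0 < e" for A e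
    using that by (intro exI[of _ 0] bexI[of _ A]) auto
qed (auto simp: preserves_measure_hmap lam2.prob_space_axioms)

end

section \<open>The three-dimensional map\<close>

text \<open>The iterate \<open>n\<close> may depend on \<open>e\<close>: a set that involves the
  contracted coordinate comes close to \<open>F\<close> only after many iterations.\<close>

definition approximable :: "'a measure \<Rightarrow> ('a \<Rightarrow> 'a) \<Rightarrow> 'a set set \<Rightarrow> 'a set \<Rightarrow> bool" where
  "approximable M T F A \<longleftrightarrow> A \<in> sets M \<and>
    (\<forall>e>0. \<exists>n. \<exists>B\<in>F. measure M (sym_diff ((T ^^ n) -` A) B) < e)"

locale invariant_algebra = prob_space M for M :: "'a measure" and T and F +
  assumes space_UNIV: "space M = UNIV"
    and pres: "preserves_measure M T"
    and F_sets: "F \<subseteq> sets M"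
    and F_compl: "A \<in> F \<Longrightarrow> - A \<in> F"
    and F_Un: "A \<in> F \<Longrightarrow> B \<in> F \<Longrightarrow> A \<union> B \<in> F"
    and F_vimage: "A \<in> F \<Longrightarrow> T -` A \<in> F"
begin

lemma F_Int: "A \<in> F \<Longrightarrow> B \<in> F \<Longrightarrow> A \<inter> B \<in> F"
  using F_compl[OF F_Un[OF F_compl F_compl]] by simp

lemma F_vimage_funpow: "A \<in> F \<Longrightarrow> (T ^^ n) -` A \<in> F"
  by (induction n arbitrary: A) (auto simp: F_vimage vimage_comp[symmetric] funpow_Suc_right simp del: funpow.simps(2))

lemma approximable_F:
  assumes "A \<in> F"
  shows "approximable M T F A"
  unfolding approximable_def
proof (intro conjI allI impI)
  show "\<exists>n. \<exists>B\<in>F. measure M (sym_diff ((T ^^ n) -` A) B) < e" if "0 < e" for e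
    using assms that by (intro exI[of _ 0] bexI[of _ A]) auto
qed (use assms F_sets in auto)

lemma approximable_compl:
  assumes "approximable M T F A"
  shows "approximable M T F (- A)"
  unfolding approximable_def
proof (intro conjI allI impI)
  show "- A \<in> events"
    using assms sets.compl_sets[of A M] by (simp add: approximable_def space_UNIV Compl_eq_Diff_UNIV)
  fix e :: real assume "0 < e"
  then obtain n B where "B \<in> F" "prob (sym_diff ((T ^^ n) -` A) B) < e"
    using assms unfolding approximable_def by blast
  moreover have "sym_diff ((T ^^ n) -` (- A)) (- B) = sym_diff ((T ^^ n) -` A) B" by auto
  ultimately show "\<exists>n. \<exists>B\<in>F. prob (sym_diff ((T ^^ n) -` (- A)) B) < e"
    using F_compl by (intro exI[of _ n] bexI[of _ "- B"]) auto
qed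

lemma approximable_Un:
  assumes "approximable M T F A" "approximable M T F B"
  shows "approximable M T F (A \<union> B)"
  unfolding approximable_def
proof (intro conjI allI impI)
  have AB: "A \<in> events" "B \<in> events" using assms by (auto simp: approximable_def)
  then show "A \<union> B \<in> events" by auto
  fix e :: real assume e: "0 < e"
  obtain k A' where A': "A' \<in> F" "prob (sym_diff ((T ^^ k) -` A) A') < e / 2"
    using assms(1) half_gt_zero[OF e] unfolding approximable_def by blast
  obtain l B' where B': "B' \<in> F" "prob (sym_diff ((T ^^ l) -` B) B') < e / 2"
    using assms(2) half_gt_zero[OF e] unfolding approximable_def by blast
  note vim = measure_vimage_funpow[OF pres space_UNIV]
  have s: "sym_diff ((T ^^ k) -` A) A' \<in> events" "sym_diff ((T ^^ l) -` B) B' \<in> events"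
    using A' B' F_sets AB vim(1) by auto
  \<comment> \<open>The two approximations need different iterates; each is pulled back by the
    number of the other, which makes \<open>k + l\<close> common to both.\<close>
  let ?C = "(T ^^ l) -` A' \<union> (T ^^ k) -` B'"
  have kl: "(T ^^ (k + l)) -` A = (T ^^ l) -` (T ^^ k) -` A" "(T ^^ (k + l)) -` B = (T ^^ k) -` (T ^^ l) -` B"
    by (simp_all add: vimage_comp funpow_add[symmetric] add.commute)
  have "prob (sym_diff ((T ^^ (k + l)) -` (A \<union> B)) ?C)
      \<le> prob ((T ^^ l) -` sym_diff ((T ^^ k) -` A) A' \<union> (T ^^ k) -` sym_diff ((T ^^ l) -` B) B')"
    unfolding vimage_Un kl using vim(1)[OF s(1)] vim(1)[OF s(2)] by (intro finite_measure_mono) auto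
  also have "\<dots> \<le> prob ((T ^^ l) -` sym_diff ((T ^^ k) -` A) A') + prob ((T ^^ k) -` sym_diff ((T ^^ l) -` B) B')"
    using vim(1)[OF s(1)] vim(1)[OF s(2)] by (rule measure_Un_le)
  also have "\<dots> = prob (sym_diff ((T ^^ k) -` A) A') + prob (sym_diff ((T ^^ l) -` B) B')"
    using vim(2)[OF s(1)] vim(2)[OF s(2)] by simp
  also have "\<dots> < e" using A' B' by simp
  finally show "\<exists>n. \<exists>C\<in>F. prob (sym_diff ((T ^^ n) -` (A \<union> B)) C) < e"
    using A' B' F_Un F_vimage_funpow by (intro exI[of _ "k + l"] bexI[of _ ?C]) auto
qed

lemma approximable_Int:
  "approximable M T F A \<Longrightarrow> approximable M T F B \<Longrightarrow> approximable M T F (A \<inter> B)"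
  using approximable_compl[OF approximable_Un[OF approximable_compl approximable_compl]] by simp

text \<open>A finite subunion exhausts the union up to \<open>e / 2\<close>, and only this subunion
  is approximated; no uniformity of the iterates over all \<open>i\<close> is required.\<close>

lemma approximable_UN:
  assumes A: "\<And>i::nat. approximable M T F (A i)"
  shows "approximable M T F (\<Union>i. A i)"
  unfolding approximable_def
proof (intro conjI allI impI)
  have Ab: "A i \<in> events" for i using A by (simp add: approximable_def)
  then show UB: "(\<Union>i. A i) \<in> events" by auto
  define C where "C k = (\<Union>i\<le>k. A i)" for k
  have C: "approximable M T F (C k)" for k
    unfolding C_def by (induction k) (auto simp: atMost_Suc intro!: approximable_Un A)
  have Cs: "C k \<in> events" for k using C by (simp add: approximable_def)
  fix e :: real assume e: "0 < e"
  have "(\<lambda>k. prob (C k)) \<longlonglongrightarrow> prob (\<Union>k. C k)"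
  proof (rule finite_Lim_measure_incseq)
    show "incseq C" unfolding C_def incseq_def by (intro allI impI UN_mono) auto
  qed (use Cs in auto)
  moreover have CU: "(\<Union>k. C k) = (\<Union>i. A i)" by (auto simp: C_def)
  ultimately have lim: "(\<lambda>k. prob (C k)) \<longlonglongrightarrow> prob (\<Union>i. A i)" by simp
  obtain k where k: "prob (\<Union>i. A i) - e / 2 < prob (C k)"
    using order_tendstoD(1)[OF lim, of "prob (\<Union>i. A i) - e / 2"] e
    unfolding eventually_sequentially by auto
  obtain n B where B: "B \<in> F" "prob (sym_diff ((T ^^ n) -` C k) B) < e / 2"
    using C[of k] half_gt_zero[OF e] unfolding approximable_def by blast
  note vim = measure_vimage_funpow[OF pres space_UNIV]
  let ?D = "(\<Union>i. A i) - C k"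
  have D: "?D \<in> events" using UB Cs by auto
  have s: "sym_diff ((T ^^ n) -` C k) B \<in> events" using vim(1)[OF Cs] B F_sets by auto
  have "prob (sym_diff ((T ^^ n) -` (\<Union>i. A i)) B) \<le> prob ((T ^^ n) -` ?D \<union> sym_diff ((T ^^ n) -` C k) B)"
    using vim(1)[OF D, of n] s CU by (intro finite_measure_mono) auto
  also have "\<dots> \<le> prob ((T ^^ n) -` ?D) + prob (sym_diff ((T ^^ n) -` C k) B)"
    using vim(1)[OF D] s by (rule measure_Un_le)
  also have "prob ((T ^^ n) -` ?D) = prob (\<Union>i. A i) - prob (C k)"
    unfolding vim(2)[OF D] using CU by (intro finite_measure_Diff UB Cs) auto
  finally show "\<exists>n. \<exists>B\<in>F. prob (sym_diff ((T ^^ n) -` (\<Union>i. A i)) B) < e"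
    using k B by (intro exI[of _ n] bexI[of _ B]) auto
qed

lemma approximable_sigma_sets:
  assumes "\<And>B. B \<in> G \<Longrightarrow> approximable M T F (h -` B)" "F \<noteq> {}" and B: "B \<in> sigma_sets UNIV G"
  shows "approximable M T F (h -` B)"
  using B
proof induction
  case Empty
  obtain A where "A \<in> F" using assms(2) by auto
  then have "A \<inter> - A \<in> F" by (intro F_Int F_compl)
  then show ?case by (simp add: approximable_F)
next
  case (Compl B)
  then show ?case using approximable_compl by (simp add: vimage_Compl Compl_eq_Diff_UNIV[symmetric])
next
  case (Union B)
  then show ?case using approximable_UN[of "\<lambda>i. h -` B i"] by (simp add: vimage_UN)
qed (use assms(1) in auto)

end

definition lam3 :: "((real \<times> real) \<times> real) measure" where
  "lam3 = lam2 \<Otimes>\<^sub>M lam"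

lemma sets_lam3[simp, measurable_cong]: "sets lam3 = sets borel"
  unfolding lam3_def by (metis borel_prod sets_lam sets_lam2 sets_pair_measure_cong)

lemma space_lam3[simp]: "space lam3 = UNIV"
  by (simp add: lam3_def space_pair_measure)

interpretation lam2_lam: pair_prob_space lam2 lam ..

interpretation lam3: prob_space lam3
  unfolding lam3_def by (rule lam2_lam.prob_space_axioms)

lemma integral_lam3:
  assumes "bounded_borel f"
  shows "integral\<^sup>L lam3 f = (\<integral>w. \<integral>z. f (w, z) \<partial>lam \<partial>lam2)"
    "integral\<^sup>L lam3 f = (\<integral>z. \<integral>w. f (w, z) \<partial>lam2 \<partial>lam)"
proof -
  have "integrable lam3 f"
    using assms by (rule bb_integrable[rotated 2]) (auto intro: lam3.finite_measure_axioms)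
  then show "integral\<^sup>L lam3 f = (\<integral>w. \<integral>z. f (w, z) \<partial>lam \<partial>lam2)"
    "integral\<^sup>L lam3 f = (\<integral>z. \<integral>w. f (w, z) \<partial>lam2 \<partial>lam)"
    using lam2_lam.integral_fst'[of f] lam2_lam.integral_snd[of "\<lambda>x y. f (x, y)"]
    unfolding lam3_def by simp_all
qed

lemma measure_lam3_vimage_fst:
  assumes "A \<in> sets borel"
  shows "measure lam3 (fst -` A) = measure lam2 A"
proof -
  have "emeasure lam3 (A \<times> UNIV) = emeasure lam2 A * emeasure lam UNIV"
    unfolding lam3_def using assms by (intro lam.emeasure_pair_measure_Times) auto
  moreover have "fst -` A = A \<times> (UNIV :: real set)" by auto
  ultimately show ?thesis using lam.emeasure_space_1 by (simp add: measure_def)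
qed

lemma measure_lam3_vimage_snd:
  assumes "A \<in> sets borel"
  shows "measure lam3 (snd -` A) = measure lam A"
proof -
  have "emeasure lam3 (UNIV \<times> A) = emeasure lam2 UNIV * emeasure lam A"
    unfolding lam3_def using assms by (intro lam.emeasure_pair_measure_Times) auto
  moreover have "snd -` A = (UNIV :: (real \<times> real) set) \<times> A" by auto
  ultimately show ?thesis using lam2.emeasure_space_1 by (simp add: measure_def)
qed

section \<open>The spatial map as an extension of the planar map\<close>

context heterochaos
begin

text \<open>The third coordinate stores what \<open>hmap\<close> forgets: [0,p] records the left
  strip, and the i-th of m equal parts of [p,1] records the dropped digit.\<close>

definition gmap :: "(real \<times> real) \<times> real \<Rightarrow> (real \<times> real) \<times> real" where
  "gmap v = (hmap (fst v),
     if fst (fst v) < p then p * snd v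
     else p + (1 - p) * ((snd v + real (dig m (snd (fst v)))) / real m))"

lemma measurable_gmap[measurable]: "gmap \<in> measurable borel borel"
proof -
  have [measurable]: "hmap \<in> measurable (borel \<Otimes>\<^sub>M borel) (borel \<Otimes>\<^sub>M borel)"
    using measurable_hmap by (simp add: borel_prod)
  show ?thesis unfolding gmap_def borel_prod[symmetric] by measurable
qed

lemma integral_gmap:
  assumes H: "bounded_borel H"
  shows "(\<integral>v. H (gmap v) \<partial>lam3) = integral\<^sup>L lam3 H"
proof -
  \<comment> \<open>The result of applying \<open>tr\<close> in the plane with the old height
    frozen: a weighted sum over the planar preimages, each with its new height. Integrating over the
    height gives \<open>H\<close> back, because the images of the height branches tile
    [0,1].\<close>
  define K where "K v = p * H (fst v, p * snd v)
     + (1 - p) * ((\<Sum>i<m. H (fst v, p + (1 - p) * ((snd v + real i) / real m))) / real m)" for v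
  have bH: "bounded_borel (\<lambda>v. H (fst v, p * snd v))"
    "bounded_borel (\<lambda>v. H (fst v, p + (1 - p) * ((snd v + real i) / real m)))" for i
    by (rule bb_comp[OF H]; unfold borel_prod[symmetric]; measurable)+
  have bK: "bounded_borel K"
    unfolding K_def[abs_def] by (intro bb_add bb_cmult bb_divide bb_sum bH)
  have bg: "bounded_borel (\<lambda>v. H (gmap v))" by (rule bb_comp[OF H]) measurable
  have slice: "(\<integral>w. H (gmap (w, z)) \<partial>lam2) = (\<integral>w. K (w, z) \<partial>lam2)" for z
  proof -
    have b: "bounded_borel (\<lambda>w. H (gmap (w, z)))" using bb_slice2[OF bg] by simp
    show ?thesis
      unfolding integral_tr[OF b, symmetric]
    proof (rule lam2_integral_cong[OF bb_tr[OF b] bb_slice2[OF bK]])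
      fix w :: "real \<times> real" assume w: "w \<in> {0..<1} \<times> {0..<1}"
      obtain x y where xy: "w = (x, y)" "0 \<le> x" "x < 1" "0 \<le> y" "y < 1" using w by (cases w) auto
      have 1: "gmap ((p * ((x + real (dig m y)) / real m), sig m y), z) = (w, p * z)"
        using hmap_left[OF xy(2,3), of y] by (simp add: gmap_def xy(1))
      have 2: "gmap ((p + (1 - p) * x, (y + real i) / real m), z) = (w, p + (1 - p) * ((z + real i) / real m))"
        if "i < m" for i
        using hmap_right[OF xy(2,4,5) that] dig_branch(1)[OF xy(4,5) that]
        unfolding gmap_def by (simp add: xy(1))
      show "tr (\<lambda>w. H (gmap (w, z))) w = K (w, z)"
        unfolding tr_def K_def by (simp only: xy(1) fst_conv snd_conv 1[unfolded xy(1)])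
          (simp add: 2[unfolded xy(1)])
    qed
  qed
  have slice': "(\<integral>z. K (w, z) \<partial>lam) = (\<integral>z. H (w, z) \<partial>lam)" for w
  proof -
    have b: "bounded_borel (\<lambda>z. H (w, z))" by (rule bb_slice1[OF H])
    have b1: "bounded_borel (\<lambda>z. H (w, p * z))" using bb_slice1[OF bH(1), of w] by simp
    have b2: "bounded_borel (\<lambda>z. H (w, p + (1 - p) * z))" by (rule bb_comp[OF b]) auto
    have "(\<integral>z. K (w, z) \<partial>lam) = (\<integral>z. p * H (w, p * z) + (1 - p) * avg m (\<lambda>z. H (w, p + (1 - p) * z)) z \<partial>lam)"
      by (simp add: K_def avg_def)
    also have "\<dots> = p * (\<integral>z. H (w, p * z) \<partial>lam) + (1 - p) * (\<integral>z. avg m (\<lambda>z. H (w, p + (1 - p) * z)) z \<partial>lam)"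
      using integrable_lam[OF b1] integrable_lam[OF bb_avg[OF b2, of m]] by simp
    also have "\<dots> = (\<integral>z. H (w, z) \<partial>lam)"
      unfolding lam_integral_split2[OF b p] using integral_avg[OF b2 m] by simp
    finally show ?thesis .
  qed
  have "(\<integral>v. H (gmap v) \<partial>lam3) = (\<integral>z. \<integral>w. K (w, z) \<partial>lam2 \<partial>lam)"
    unfolding integral_lam3(2)[OF bg] slice ..
  also have "\<dots> = (\<integral>w. \<integral>z. K (w, z) \<partial>lam \<partial>lam2)"
    unfolding integral_lam3[OF bK, symmetric] ..
  also have "\<dots> = integral\<^sup>L lam3 H" unfolding slice' integral_lam3(1)[OF H] ..
  finally show ?thesis .
qed

lemma preserves_measure_gmap: "preserves_measure lam3 gmap"
  unfolding preserves_measure_def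
proof
  show meas: "gmap \<in> measurable lam3 lam3" by measurable
  show "distr lam3 lam3 gmap = lam3"
  proof (rule measure_eqI)
    fix A assume "A \<in> sets (distr lam3 lam3 gmap)"
    then have A: "A \<in> sets borel" by simp
    have gA: "gmap -` A \<in> sets borel" using measurable_sets[OF measurable_gmap A] by simp
    have "measure lam3 (gmap -` A) = (\<integral>v. indicator A (gmap v) \<partial>lam3)"
      using gA by (simp add: indicator_vimage[symmetric])
    also have "\<dots> = measure lam3 A"
      using A by (subst integral_gmap) (auto intro: bb_indicator)
    finally show "emeasure (distr lam3 lam3 gmap) A = emeasure lam3 A"
      using A by (simp add: emeasure_distr[OF meas] lam3.emeasure_eq_measure)
  qed simp
qed

lemma fst_gmap_funpow: "fst ((gmap ^^ n) v) = (hmap ^^ n) (fst v)"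
  by (induction n) (auto simp: gmap_def)

lemma vimage_gmap_funpow_fst: "(gmap ^^ n) -` (fst -` B) = fst -` ((hmap ^^ n) -` B)"
  by (simp add: vimage_def fst_gmap_funpow)

text \<open>Both branches of \<open>gmap\<close> contract the third coordinate by at least the factor \<open>max p (1 - p)\<close>.\<close>

lemma snd_gmap_funpow_contract:
  assumes "0 \<le> z" "z \<le> 1"
  shows "0 \<le> snd ((gmap ^^ n) (w, z)) - snd ((gmap ^^ n) (w, 0))
    \<and> snd ((gmap ^^ n) (w, z)) - snd ((gmap ^^ n) (w, 0)) \<le> max p (1 - p) ^ n"
proof (induction n)
  case (Suc n)
  define d where "d = snd ((gmap ^^ n) (w, z)) - snd ((gmap ^^ n) (w, 0))"
  \<comment> \<open>Both points lie over the same planar orbit, so they use the same branch and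
    digit; the digit cancels in the difference and only the contraction rate is left.\<close>
  define c where "c = (if fst ((hmap ^^ n) w) < p then p else (1 - p) / real m)"
  have "(1 - p) / real m \<le> (1 - p) / 1" using p m by (intro divide_left_mono) auto
  then have c: "0 \<le> c" "c \<le> max p (1 - p)" using p by (auto simp: c_def)
  have "snd ((gmap ^^ Suc n) (w, z)) - snd ((gmap ^^ Suc n) (w, 0)) = c * d"
    by (simp add: gmap_def fst_gmap_funpow d_def c_def add_divide_distrib algebra_simps)
  moreover have "0 \<le> c * d" "c * d \<le> max p (1 - p) * max p (1 - p) ^ n"
    using c Suc by (auto simp: d_def intro!: mult_mono)
  ultimately show ?case by simp
qed (use assms in simp)

definition fst_algebra :: "((real \<times> real) \<times> real) set set" where
  "fst_algebra = (\<lambda>B. fst -` B) ` sets borel"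

lemma fst_vimage_borel: "A \<in> sets borel \<Longrightarrow> fst -` A \<in> sets (borel :: ((real \<times> real) \<times> real) measure)"
  using Times_borel[of A "UNIV :: real set"] by (simp add: vimage_fst vimage_snd)

lemma snd_vimage_borel: "A \<in> sets borel \<Longrightarrow> snd -` A \<in> sets (borel :: ((real \<times> real) \<times> real) measure)"
  using Times_borel[of "UNIV :: (real \<times> real) set" A] by (simp add: vimage_fst vimage_snd)

sublocale invariant_algebra lam3 gmap fst_algebra
proof
  show "fst_algebra \<subseteq> sets lam3" by (auto simp: fst_algebra_def fst_vimage_borel)
  fix A assume "A \<in> fst_algebra"
  then obtain A' where A: "A = fst -` A'" "A' \<in> sets borel" by (auto simp: fst_algebra_def)
  have "- A = fst -` (- A')" using A by auto
  then show "- A \<in> fst_algebra" using A by (auto simp: fst_algebra_def)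
  have "gmap -` A = fst -` (hmap -` A')" using A vimage_gmap_funpow_fst[of 1 A'] by simp
  moreover have "hmap -` A' \<in> sets borel" using measurable_sets[OF measurable_hmap A(2)] by simp
  ultimately show "gmap -` A \<in> fst_algebra" by (auto simp: fst_algebra_def)
  fix B assume "B \<in> fst_algebra"
  then obtain B' where B: "B = fst -` B'" "B' \<in> sets borel" by (auto simp: fst_algebra_def)
  have "A \<union> B = fst -` (A' \<union> B')" using A B by auto
  then show "A \<union> B \<in> fst_algebra"
    unfolding fst_algebra_def by (rule image_eqI) (use A B in auto)
qed (auto simp: preserves_measure_gmap)

text \<open>After \<open>n\<close> steps the true height is compared with the height of the orbit
  started at 0, which depends on the planar point only. They differ by at most \<open>r\<close>, so
  a disagreement about being below \<open>c\<close> forces the true height into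
  \<open>[c, c + r]\<close>, and by invariance this has measure at most \<open>r\<close>.\<close>

lemma approximable_snd_lessThan: "approximable lam3 gmap fst_algebra (snd -` {..<c})"
  unfolding approximable_def
proof (intro conjI allI impI)
  show "snd -` {..<c} \<in> sets lam3" by (simp add: snd_vimage_borel)
  fix e :: real assume e: "0 < e"
  have "max p (1 - p) < 1" using p by simp
  then obtain n where n: "max p (1 - p) ^ n < e" using real_arch_pow_inv[OF e] by blast
  define r where "r = max p (1 - p) ^ n"
  have r: "0 \<le> r" using p by (auto simp: r_def)
  have gm: "(gmap ^^ n) \<in> measurable borel borel" by (rule measurable_compose_n) measurable
  have "(\<lambda>w. snd ((gmap ^^ n) (w, 0))) \<in> borel_measurable borel"
  proof -
    have "(\<lambda>w. (w, 0::real)) \<in> measurable borel (borel :: ((real \<times> real) \<times> real) measure)"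
      unfolding borel_prod[symmetric] by measurable
    then have "(\<lambda>w. (gmap ^^ n) (w, 0)) \<in> measurable borel borel"
      using measurable_compose[OF _ gm] by blast
    then show ?thesis
      using measurable_compose[OF _ measurable_snd[of "borel :: (real \<times> real) measure" "borel :: real measure"]]
      by (simp add: borel_prod)
  qed
  then have B: "{w. snd ((gmap ^^ n) (w, 0)) < c} \<in> sets borel" by simp
  let ?B = "fst -` {w. snd ((gmap ^^ n) (w, 0)) < c} :: ((real \<times> real) \<times> real) set"
  let ?S = "sym_diff ((gmap ^^ n) -` (snd -` {..<c})) ?B"
  let ?U = "(gmap ^^ n) -` (snd -` {c..c + r})"
  have U: "?U \<in> sets borel"
    using measurable_sets[OF gm snd_vimage_borel[of "{c..c + r}"]] by simp
  have SB: "?S \<in> sets borel"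
    using measurable_sets[OF gm snd_vimage_borel[of "{..<c}"]] fst_vimage_borel[OF B] by auto
  have Z: "measure lam3 (snd -` (- {0..1})) = 0"
    by (subst measure_lam3_vimage_snd) (auto simp: measure_def emeasure_lam)
  \<comment> \<open>The contraction estimate needs an initial height in [0,1]; all other heights
    form a null set. As the reference height 0 is the lowest, the error interval extends only to the
    right of \<open>c\<close>.\<close>
  have "?S \<subseteq> ?U \<union> snd -` (- {0..1})"
  proof
    fix v assume v: "v \<in> ?S"
    show "v \<in> ?U \<union> snd -` (- {0..1})"
    proof (cases "0 \<le> snd v \<and> snd v \<le> 1")
      case True
      then show ?thesis
        using v snd_gmap_funpow_contract[of "snd v" n "fst v"] by (auto simp: r_def)
    qed auto
  qed
  then have "measure lam3 ?S \<le> measure lam3 (?U \<union> snd -` (- {0..1}))"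
    using U by (intro lam3.finite_measure_mono) (auto intro!: sets.Un snd_vimage_borel)
  also have "\<dots> \<le> measure lam3 ?U + measure lam3 (snd -` (- {0..1}))"
    using U by (intro measure_Un_le) (auto intro!: snd_vimage_borel)
  also have "measure lam3 ?U = measure lam {c..c + r}"
    using measure_vimage_funpow(2)[OF preserves_measure_gmap, of "snd -` {c..c + r}" n]
    by (simp add: snd_vimage_borel measure_lam3_vimage_snd)
  also have "measure lam {c..c + r} \<le> r"
  proof -
    have "emeasure lam {c..c + r} \<le> emeasure lborel {c..c + r}"
      by (subst emeasure_lam) (auto intro: emeasure_mono)
    then show ?thesis using r by (simp add: lam.emeasure_eq_measure)
  qed
  also have "r < e" using n by (simp add: r_def)
  finally show "\<exists>n. \<exists>B\<in>fst_algebra. measure lam3 (sym_diff ((gmap ^^ n) -` (snd -` {..<c})) B) < e"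
    using Z imageI[OF B, of "vimage fst"] unfolding fst_algebra_def
    by (intro exI[of _ n] bexI[of _ ?B]) (simp_all only: add_0_right)
qed

lemma approximable_borel:
  assumes "A \<in> sets borel"
  shows "approximable lam3 gmap fst_algebra A"
proof -
  have ne: "fst_algebra \<noteq> {}" by (auto simp: fst_algebra_def)
  have s: "approximable lam3 gmap fst_algebra (snd -` J)" if "J \<in> sets borel" for J
    by (rule approximable_sigma_sets[OF _ ne that[unfolded sets_borel_lessThan]])
      (auto intro: approximable_snd_lessThan)
  have rect: "approximable lam3 gmap fst_algebra (I \<times> J)" if "I \<in> sets borel" "J \<in> sets borel" for I J
  proof -
    have "approximable lam3 gmap fst_algebra (fst -` I \<inter> snd -` J)"
      using that by (intro approximable_Int s approximable_F) (auto simp: fst_algebra_def)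
    moreover have "I \<times> J = fst -` I \<inter> snd -` J" by auto
    ultimately show ?thesis by simp
  qed
  have "approximable lam3 gmap fst_algebra (id -` A)"
  proof (rule approximable_sigma_sets[OF _ ne])
    show "A \<in> sigma_sets UNIV {a \<times> b | a b. a \<in> sets borel \<and> b \<in> sets borel}"
      using assms by (simp add: sets_borel_prod)
  qed (use rect in auto)
  then show ?thesis by simp
qed

text \<open>On sets determined by the planar coordinates the correlations of \<open>gmap\<close> are
  those of \<open>hmap\<close>, so the uniform estimate is inherited with the same
  \<open>N\<close>.\<close>

lemma mixing_all_orders_gmap: "mixing_all_orders lam3 gmap"
proof (rule mixing_all_orders_core[OF lam3.prob_space_axioms space_UNIV pres F_sets F_Int F_vimage])
  fix A and e :: real assume "A \<in> fst_algebra" and e: "0 < e"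
  then obtain A' where A: "A = fst -` A'" "A' \<in> sets borel" by (auto simp: fst_algebra_def)
  obtain N where N: "\<And>n B. N \<le> n \<Longrightarrow> B \<in> sets borel \<Longrightarrow>
      \<bar>measure lam2 (A' \<inter> (hmap ^^ n) -` B) - measure lam2 A' * measure lam2 B\<bar> < e"
    using hmap_uniformly_mixing[OF A(2) e] by blast
  show "\<exists>N. \<forall>n\<ge>N. \<forall>B\<in>fst_algebra. \<bar>measure lam3 (A \<inter> (gmap ^^ n) -` B) - measure lam3 A * measure lam3 B\<bar> < e"
  proof (intro exI allI impI ballI)
    fix n B assume n: "N \<le> n" and "B \<in> fst_algebra"
    then obtain B' where B: "B = fst -` B'" "B' \<in> sets borel" by (auto simp: fst_algebra_def)
    have hB: "(hmap ^^ n) -` B' \<in> sets borel"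
      using measure_vimage_funpow(1)[OF preserves_measure_hmap, of B' n] B by simp
    have "A \<inter> (gmap ^^ n) -` B = fst -` (A' \<inter> (hmap ^^ n) -` B')"
      unfolding A B vimage_gmap_funpow_fst by auto
    then have "measure lam3 (A \<inter> (gmap ^^ n) -` B) = measure lam2 (A' \<inter> (hmap ^^ n) -` B')"
      using A(2) hB by (simp only:) (rule measure_lam3_vimage_fst, auto)
    then show "\<bar>measure lam3 (A \<inter> (gmap ^^ n) -` B) - measure lam3 A * measure lam3 B\<bar> < e"
      using N[OF n B(2)] A B hB by (simp add: measure_lam3_vimage_fst)
  qed
qed (use approximable_borel in \<open>auto simp: approximable_def\<close>)

end

section \<open>Identification with the heterochaos baker maps\<close>

lemma unit_square_borel: "unit_square \<in> sets borel"
  by (auto simp: unit_square_def intro!: Times_borel)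

lemma lam2_eq_density: "lam2 = density lborel (indicator unit_square)"
proof -
  have "lam2 = density (lborel \<Otimes>\<^sub>M lborel) (\<lambda>(x, y). indicator {0..1} x * indicator {0..1} y)"
    unfolding lam2_def lam_def
    by (rule pair_measure_density)
      (auto intro: lborel.sigma_finite_measure_axioms lam.sigma_finite_measure_axioms simp: lam_def[symmetric])
  also have "(\<lambda>(x, y). indicator {0..1} x * indicator {0..1} y) = (indicator unit_square :: real \<times> real \<Rightarrow> ennreal)"
    by (auto simp: unit_square_def split: split_indicator)
  finally show ?thesis by (simp add: lborel_prod)
qed

lemma lam3_eq_density: "lam3 = density lborel (indicator unit_cube)"
proof -
  have "lam3 = density (lborel \<Otimes>\<^sub>M lborel) (\<lambda>(x, y). indicator unit_square x * indicator {0..1} y)"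
    unfolding lam3_def lam2_eq_density lam_def
    by (rule pair_measure_density)
      (auto intro: lborel.sigma_finite_measure_axioms lam.sigma_finite_measure_axioms intro!: borel_measurable_indicator simp: lam_def[symmetric] unit_square_borel)
  also have "(\<lambda>(x, y). indicator unit_square x * indicator {0..1} y) = (indicator unit_cube :: _ \<Rightarrow> ennreal)"
    by (auto simp: unit_square_def unit_cube_def split: split_indicator)
  finally show ?thesis by (simp add: lborel_prod)
qed

text \<open>The alternative \<open>Suc i = m\<close> covers the closed last strip, where the upper
  bound may be attained.\<close>

lemma dig_eq:
  assumes "i < m" "real i \<le> real m * t" "real m * t < real i + 1 \<or> Suc i = m"
  shows "dig m t = i"
proof (cases "real m * t < real i + 1")
  case True
  then have "\<lfloor>real m * t\<rfloor> = int i" using assms by (intro floor_unique) auto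
  then show ?thesis using assms by (simp add: dig_def)
next
  case False
  then have "int i \<le> \<lfloor>real m * t\<rfloor>" "Suc i = m" using assms by (auto simp: le_floor_iff)
  then show ?thesis by (auto simp: dig_def)
qed

theorem theoremA:
  fixes m :: nat and a :: real
  assumes "2 \<le> m" and "0 < a" and "a < 1 / real m"
  shows "mixing_all_orders (lebesgue_on unit_square) (baker2 m a) \<and>
         mixing_all_orders (lebesgue_on unit_cube) (baker3_vol m a)"
proof -
  define p where "p = real m * a"
  have m0: "0 < m" using assms by simp
  have p: "0 < p" "p < 1" using assms by (auto simp: p_def field_simps)
  interpret heterochaos m p using assms(1) p by unfold_locales
  \<comment> \<open>For this value of \<open>b\<close> the factor \<open>1 - m b\<close> equals
    \<open>p\<close> and \<open>b\<close> equals \<open>(1 - p) / m\<close>, exactly the height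
    contractions of \<open>gmap\<close>.\<close>
  have b: "1 / real m - a = (1 - p) / real m" using m0 by (simp add: p_def field_simps)
  \<comment> \<open>The equality holds on the whole closed cube, boundary included, thanks to the
    convention for the last digit. Strips are numbered from 1 and digits from 0, so strip
    \<open>i\<close> has digit \<open>i - 1\<close>.\<close>
  have branch: "baker2 m a (x, y) = hmap (x, y) \<and> baker3_vol m a ((x, y), z) = gmap ((x, y), z)"
    if xy: "(x, y) \<in> unit_square" and z: "z \<in> {0..1}" for x y z
  proof -
    obtain i where i: "i \<in> {1..m}" "(x, y) \<in> Omega_alpha2 m a i \<or> (x, y) \<in> Omega_beta2 m a i"
      using xy unit_square_partition[OF assms(2,3) m0] by blast
    have ri: "real (i - 1) = real i - 1" "real (i - Suc 0) = real i - 1" using i by auto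
    show ?thesis
    proof (cases "(x, y) \<in> Omega_alpha2 m a i")
      case True
      then have x: "(real i - 1) * a \<le> x" "x < real i * a" by (auto simp: Omega_alpha2_def)
      have xp: "x < p" unfolding p_def using alpha_less[OF assms(2) _ x(2)] i by auto
      have mx: "real m * (x / p) = x / a" using m0 assms(2) by (simp add: p_def)
      have xa: "real i - 1 \<le> x / a" "x / a < real i"
        using x assms(2) by (simp_all add: field_simps)
      have d: "dig m (x / p) = i - 1"
        by (rule dig_eq) (unfold mx ri, use i xa in auto)
      have t: "tau m a x = sig m (x / p)"
        unfolding sig_def d mx ri using tau_alpha[OF assms(2) i(1)] x assms(2) by (simp add: field_simps)
      have 2: "baker2 m a (x, y) = hmap (x, y)"
        using baker2_alpha[OF assms(2) i(1) True] xp by (simp add: hmap_def t d ri add_divide_distrib)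
      have "((x, y), z) \<in> Omega_alpha3 m a i" using True z by (simp add: Omega_alpha3_def)
      then have "baker3_vol m a ((x, y), z) = (hmap (x, y), p * z)"
        unfolding baker3_vol_def using baker3_alpha[OF i(1)] 2 b m0 by simp
      with 2 xp show ?thesis by (simp add: gmap_def)
    next
      case False
      then have bt: "(x, y) \<in> Omega_beta2 m a i" using i by simp
      then have x: "p \<le> x" by (simp add: Omega_beta2_def p_def)
      have y: "real i - 1 \<le> real m * y" "real m * y < real i \<or> i = m"
        using bt i m0 by (auto simp: Omega_beta2_def field_simps split: if_splits)
      have d: "dig m y = i - 1"
        by (rule dig_eq) (use i y in \<open>auto simp: ri\<close>)
      have t: "tau m a x = (x - p) / (1 - p)"
        using tau_beta[OF assms(2)] x by (simp add: p_def)
      have 2: "baker2 m a (x, y) = hmap (x, y)"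
        using baker2_beta[OF assms(2) m0 i(1) bt] x by (simp add: hmap_def t sig_def d ri)
      have "((x, y), z) \<in> Omega_beta3 m a i" using bt z by (simp add: Omega_beta3_def)
      then have "baker3_vol m a ((x, y), z)
          = (hmap (x, y), (1 - p) / real m * z + 1 + (1 - p) / real m * (real i - real m - 1))"
        unfolding baker3_vol_def using baker3_beta[OF assms(2) m0 i(1)] 2 b by simp
      also have "(1 - p) / real m * z + 1 + (1 - p) / real m * (real i - real m - 1)
          = p + (1 - p) * ((z + real (i - 1)) / real m)"
        unfolding ri using m0 by (simp add: field_simps)
      finally show ?thesis using 2 x by (simp add: gmap_def d)
    qed
  qed
  have quot: "0 \<le> (t + real (dig m s)) / real m \<and> (t + real (dig m s)) / real m \<le> 1" if "0 \<le> t" "t \<le> 1" for t s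
  proof -
    have "t + real (dig m s) \<le> real m" using that dig_less[OF m0, of s] by linarith
    then show ?thesis using that m0 by simp
  qed
  have hmap_sq: "hmap w \<in> unit_square" if wS: "w \<in> unit_square" for w
  proof -
    obtain x y where w: "w = (x, y)" "0 \<le> x" "x \<le> 1" "0 \<le> y" "y \<le> 1"
      using wS by (cases w) (auto simp: unit_square_def)
    show ?thesis
      using w p sig_bounds[OF m0, of "x / p"] sig_bounds[OF m0, of y] quot[of y "x / p"]
      by (auto simp: hmap_def unit_square_def)
  qed
  have gmap_cube: "gmap v \<in> unit_cube" if "v \<in> unit_cube" for v
  proof -
    have sq: "hmap (fst v) \<in> unit_square" using that by (intro hmap_sq) (auto simp: unit_cube_def unit_square_def)
    have z: "0 \<le> snd v" "snd v \<le> 1" using that by (auto simp: unit_cube_def)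
    define t where "t = (snd v + real (dig m (snd (fst v)))) / real m"
    have t: "0 \<le> t" "t \<le> 1" using quot[OF z] by (auto simp: t_def)
    have "(1 - p) * t \<le> (1 - p) * 1" using t p by (intro mult_left_mono) auto
    then have "(1 - p) * t \<le> 1 - p" by (simp only: mult_1_right)
    moreover have "0 \<le> (1 - p) * t" using t p by simp
    ultimately have "p + (1 - p) * t \<in> {0..1}"
      unfolding atLeastAtMost_iff using p by (intro conjI; linarith)
    moreover have "p * snd v \<le> 1 * 1" using z p by (intro mult_mono) auto
    then have "p * snd v \<in> {0..1}" using z p by simp
    ultimately show ?thesis
      using sq unfolding gmap_def t_def[symmetric] unit_cube_def unit_square_def by simp
  qed
  show ?thesis
  proof
    show "mixing_all_orders (lebesgue_on unit_square) (baker2 m a)"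
    proof (rule mixing_all_orders_lebesgue_on)
      show "unit_square \<in> sets borel" by (rule unit_square_borel)
      show "mixing_all_orders (density lborel (indicator unit_square)) hmap"
        using mixing_all_orders_hmap by (simp add: lam2_eq_density)
      show eq: "baker2 m a w = hmap w" if "w \<in> unit_square" for w
        using branch[of "fst w" "snd w" 0] that by simp
      show "baker2 m a w \<in> unit_square" if "w \<in> unit_square" for w
        using eq hmap_sq that by simp
    qed
    show "mixing_all_orders (lebesgue_on unit_cube) (baker3_vol m a)"
    proof (rule mixing_all_orders_lebesgue_on)
      show "unit_cube \<in> sets borel" by (auto simp: unit_cube_def intro!: Times_borel)
      show "mixing_all_orders (density lborel (indicator unit_cube)) gmap"
        using mixing_all_orders_gmap by (simp add: lam3_eq_density)
      show eq: "baker3_vol m a v = gmap v" if "v \<in> unit_cube" for v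
        using branch[of "fst (fst v)" "snd (fst v)" "snd v"] that by (auto simp: unit_cube_def unit_square_def)
      show "baker3_vol m a v \<in> unit_cube" if "v \<in> unit_cube" for v
        using eq gmap_cube that by simp
    qed
  qed
qed

end
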